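(* Let $G,H$ be two locally compact groups, and let $d\geq 2$ be an integer. Then $G\times H$ is $M_d$-weakly amenable if and only if both $G$ and $H$ are $M_d$-weakly amenable. Moreover, in this case, $$\boldsymbol\Lambda(G\times H,d)\leq\boldsymbol\Lambda(G,d)\,\boldsymbol\Lambda(H,d).$$
   Context: Let $G$ be a locally compact group with a left Haar measure, $C_b(G)$ the bounded continuous complex-valued functions on $G$, $C_c(G)$ those with compact support, and $d\ge 2$ an integer. A function $\varphi\in C_b(G)$ is an $M_d$-multiplier of $G$ if there are Hilbert spaces $\mathcal{H}_0,\ldots,\mathcal{H}_d$ with $\mathcal{H}_0=\mathcal{H}_d=\mathbb{C}$ and bounded maps $\xi_i:G\to\mathbf{B}(\mathcal{H}_i,\mathcal{H}_{i-1})$ ($i=1,\ldots,d$) such that $$\varphi(t_1\cdots t_d)=\xi_1(t_1)\cdots\xi_d(t_d)1\quad\text{for all } t_1,\ldots,t_d\in G,$$ where $\mathbf{B}(E,F)$ denotes the bounded linear operators from $E$ to $F$. $M_d(G)$ is the space of all $M_d$-multipliers, with norm $\|\varphi\|_{M_d(G)}=\inf\{\sup_{t_1\in G}\|\xi_1(t_1)\|\cdots\sup_{t_d\in G}\|\xi_d(t_d)\|\}$, the infimum being over all such decompositions. $X_d(G)$ is the completion of $L^1(G)$ for the norm $\|g\|_{X_d(G)}=\sup\{|\int_G\varphi(t)g(t)\,dt| : \varphi\in M_d(G),\ \|\varphi\|_{M_d(G)}\le 1\}$. It is known that $X_d(G)^*=M_d(G)$ for the duality $\langle\varphi,g\rangle=\int_G\varphi(t)g(t)\,dt$,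 $g\in L^1(G)$. $G$ is $M_d$-weakly amenable if there is $C\ge 1$ such that the constant function $1$ is in the $\sigma(M_d(G),X_d(G))$-closure, in $M_d(G)$, of $\{\varphi\in C_c(G) : \|\varphi\|_{M_d(G)}\le C\}$. $\boldsymbol\Lambda(G,d)$ is the infimum of all $C\ge 1$ for which this holds (and $\boldsymbol\Lambda(G,d)=\infty$ if there is none). *)

theory Defs
  imports "HOL-Analysis.Analysis"
begin

section \<open>Locally compact groups and Haar measure\<close>

text \<open>
  Groups are written additively, in the class \<^class>\<open>topological_group_add\<close>, which is the topological
  group class of the library; it does not assume commutativity. The order of summation therefore
  matters below, and \<open>G \<times> H\<close> is the product type with its componentwise operations and its
  product topology.
\<close>

instance prod :: (topological_group_add, topological_group_add) topological_group_add
proof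
  fix a b :: "'a \<times> 'b"
  show "((\<lambda>x. fst x + snd x) \<longlongrightarrow> a + b) (nhds a \<times>\<^sub>F nhds b)"
  proof -
    have f: "(fst \<longlongrightarrow> a) (nhds a \<times>\<^sub>F nhds b)" "(snd \<longlongrightarrow> b) (nhds a \<times>\<^sub>F nhds b)"
      using filterlim_fst filterlim_snd by blast+
    have "((\<lambda>x. (fst (fst x) + fst (snd x), snd (fst x) + snd (snd x))) \<longlongrightarrow>
        (fst a + fst b, snd a + snd b)) (nhds a \<times>\<^sub>F nhds b)"
      by (intro tendsto_Pair tendsto_add tendsto_fst tendsto_snd f)
    then show ?thesis
      by (simp add: plus_prod_def)
  qed
  show "(uminus \<longlongrightarrow> - a) (nhds a)"
  proof -
    have "((\<lambda>x. (- fst x, - snd x)) \<longlongrightarrow> (- fst a, - snd a)) (nhds a)"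
      by (intro tendsto_Pair tendsto_minus tendsto_fst tendsto_snd filterlim_ident)
    moreover have "(uminus :: 'a \<times> 'b \<Rightarrow> _) = (\<lambda>x. (- fst x, - snd x))"
      by (simp add: fun_eq_iff uminus_prod_def)
    ultimately show ?thesis
      by (simp add: uminus_prod_def)
  qed
qed

definition left_haar_measure :: "'g::{topological_group_add, t2_space} measure \<Rightarrow> bool" where
  "left_haar_measure \<mu> \<longleftrightarrow>
     sets \<mu> = sets borel \<and>
     emeasure \<mu> UNIV \<noteq> 0 \<and>
     (\<forall>K. compact K \<longrightarrow> emeasure \<mu> K < \<infinity>) \<and>
     (\<forall>A\<in>sets borel. emeasure \<mu> A = (INF U\<in>{U. open U \<and> A \<subseteq> U}. emeasure \<mu> U)) \<and>
     (\<forall>U. open U \<longrightarrow> emeasure \<mu> U = (SUP K\<in>{K. compact K \<and> K \<subseteq> U}. emeasure \<mu> K)) \<and>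
     (\<forall>s. \<forall>A\<in>sets borel. emeasure \<mu> ((\<lambda>t. s + t) ` A) = emeasure \<mu> A)"

definition Cb :: "('g::topological_space \<Rightarrow> complex) set" where
  "Cb = {\<phi>. continuous_on UNIV \<phi> \<and> bounded (range \<phi>)}"

definition Cc :: "('g::topological_space \<Rightarrow> complex) set" where
  "Cc = {\<phi>. continuous_on UNIV \<phi> \<and> compact (closure {t. \<phi> t \<noteq> 0})}"


section \<open>Complex Hilbert spaces on a carrier set\<close>

text \<open>
  The definition of a multiplier quantifies over families of Hilbert spaces, so these have to be
  objects of the logic and not types.
\<close>

record 'v inner_space =
  vectors :: "'v set"
  vzero :: 'v
  vplus :: "'v \<Rightarrow> 'v \<Rightarrow> 'v"
  vscale :: "complex \<Rightarrow> 'v \<Rightarrow> 'v"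
  vinner :: "'v \<Rightarrow> 'v \<Rightarrow> complex"

definition vnorm :: "'v inner_space \<Rightarrow> 'v \<Rightarrow> real" where
  "vnorm E x = sqrt (Re (vinner E x x))"

definition vdist :: "'v inner_space \<Rightarrow> 'v \<Rightarrow> 'v \<Rightarrow> real" where
  "vdist E x y = vnorm E (vplus E x (vscale E (-1) y))"

locale complex_hilbert_space =
  fixes E :: "'v inner_space"
  assumes zero_closed: "vzero E \<in> vectors E"
    and plus_closed: "\<lbrakk>x \<in> vectors E; y \<in> vectors E\<rbrakk> \<Longrightarrow> vplus E x y \<in> vectors E"
    and scale_closed: "x \<in> vectors E \<Longrightarrow> vscale E a x \<in> vectors E"
    and plus_assoc: "\<lbrakk>x \<in> vectors E; y \<in> vectors E; z \<in> vectors E\<rbrakk> \<Longrightarrow>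
           vplus E (vplus E x y) z = vplus E x (vplus E y z)"
    and plus_commute: "\<lbrakk>x \<in> vectors E; y \<in> vectors E\<rbrakk> \<Longrightarrow> vplus E x y = vplus E y x"
    and plus_zero: "x \<in> vectors E \<Longrightarrow> vplus E x (vzero E) = x"
    and plus_neg: "x \<in> vectors E \<Longrightarrow> vplus E x (vscale E (-1) x) = vzero E"
    and scale_scale: "x \<in> vectors E \<Longrightarrow> vscale E a (vscale E b x) = vscale E (a * b) x"
    and scale_one: "x \<in> vectors E \<Longrightarrow> vscale E 1 x = x"
    and scale_plus_right: "\<lbrakk>x \<in> vectors E; y \<in> vectors E\<rbrakk> \<Longrightarrow>
           vscale E a (vplus E x y) = vplus E (vscale E a x) (vscale E a y)"
    and scale_plus_left: "x \<in> vectors E \<Longrightarrow>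
           vscale E (a + b) x = vplus E (vscale E a x) (vscale E b x)"
    and inner_plus_left: "\<lbrakk>x \<in> vectors E; y \<in> vectors E; z \<in> vectors E\<rbrakk> \<Longrightarrow>
           vinner E (vplus E x y) z = vinner E x z + vinner E y z"
    and inner_scale_left: "\<lbrakk>x \<in> vectors E; y \<in> vectors E\<rbrakk> \<Longrightarrow>
           vinner E (vscale E a x) y = a * vinner E x y"
    and inner_cnj: "\<lbrakk>x \<in> vectors E; y \<in> vectors E\<rbrakk> \<Longrightarrow> vinner E y x = cnj (vinner E x y)"
    and inner_nonneg: "x \<in> vectors E \<Longrightarrow> 0 \<le> Re (vinner E x x)"
    and inner_definite: "\<lbrakk>x \<in> vectors E; vinner E x x = 0\<rbrakk> \<Longrightarrow> x = vzero E"
    and complete: "\<lbrakk>\<forall>n. \<sigma> n \<in> vectors E;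
             \<forall>e>0. \<exists>N. \<forall>m\<ge>N. \<forall>n\<ge>N. vdist E (\<sigma> m) (\<sigma> n) < e\<rbrakk> \<Longrightarrow>
           \<exists>x\<in>vectors E. (\<lambda>n. vdist E (\<sigma> n) x) \<longlonglongrightarrow> 0"

definition bounded_operators :: "'v inner_space \<Rightarrow> 'w inner_space \<Rightarrow> ('v \<Rightarrow> 'w) set" where
  "bounded_operators E F =
     {T. (\<forall>x\<in>vectors E. T x \<in> vectors F) \<and>
         (\<forall>x\<in>vectors E. \<forall>y\<in>vectors E. T (vplus E x y) = vplus F (T x) (T y)) \<and>
         (\<forall>a. \<forall>x\<in>vectors E. T (vscale E a x) = vscale F a (T x)) \<and>
         (\<exists>c. \<forall>x\<in>vectors E. vnorm F (T x) \<le> c * vnorm E x)}"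

definition operator_norm :: "'v inner_space \<Rightarrow> 'w inner_space \<Rightarrow> ('v \<Rightarrow> 'w) \<Rightarrow> real" where
  "operator_norm E F T = (SUP x\<in>vectors E. vnorm F (T x) / vnorm E x)"

text \<open>The Hilbert space \<open>\<complex>\<close>, as a space of vectors in a sum type.\<close>

definition scalars :: "(complex + 'w) inner_space" where
  "scalars = \<lparr>vectors = range Inl,
     vzero = Inl 0,
     vplus = (\<lambda>x y. Inl (projl x + projl y)),
     vscale = (\<lambda>a x. Inl (a * projl x)),
     vinner = (\<lambda>x y. projl x * cnj (projl y))\<rparr>"


section \<open>Multipliers\<close>

text \<open>The \<open>foldr\<close> expression is \<open>\<xi> 1 (t 1) (\<xi> 2 (t 2) (\<dots> (\<xi> d (t d) 1)))\<close>, and the sum is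
  \<open>t 1 + \<dots> + t d\<close> in this order.\<close>

definition Md_factorization ::
  "nat \<Rightarrow> ('g::group_add \<Rightarrow> complex) \<Rightarrow> (nat \<Rightarrow> (complex + 'w) inner_space) \<Rightarrow>
    (nat \<Rightarrow> 'g \<Rightarrow> complex + 'w \<Rightarrow> complex + 'w) \<Rightarrow> bool" where
  "Md_factorization d \<phi> H \<xi> \<longleftrightarrow>
     (\<forall>i\<le>d. complex_hilbert_space (H i)) \<and> H 0 = scalars \<and> H d = scalars \<and>
     (\<forall>i\<in>{1..d}. (\<forall>t. \<xi> i t \<in> bounded_operators (H i) (H (i - 1))) \<and>
        bdd_above (range (\<lambda>t. operator_norm (H i) (H (i - 1)) (\<xi> i t)))) \<and>
     (\<forall>t :: nat \<Rightarrow> 'g. foldr (\<lambda>i. \<xi> i (t i)) [1..<Suc d] (Inl 1) =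
        Inl (\<phi> (sum_list (map t [1..<Suc d]))))"

definition Md_factorization_bound ::
  "nat \<Rightarrow> (nat \<Rightarrow> (complex + 'w) inner_space) \<Rightarrow>
    (nat \<Rightarrow> 'g::group_add \<Rightarrow> complex + 'w \<Rightarrow> complex + 'w) \<Rightarrow> real" where
  "Md_factorization_bound d H \<xi> =
     (\<Prod>i=1..d. SUP t. operator_norm (H i) (H (i - 1)) (\<xi> i t))"

text \<open>
  An existential quantifier over all Hilbert spaces has to range over those with vectors in one type.
  For multipliers of \<open>G\<close> this type is \<open>'g model\<close> below, which is large enough: by
  \<open>Md_factorization_in_model\<close> at the end of this theory, a factorization through Hilbert spaces
  with vectors in an arbitrary type gives one in \<open>'g model\<close> with a bound that is not larger.
\<close>

type_synonym 'g model = "complex + ('g list \<Rightarrow> complex)"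

definition Md :: "nat \<Rightarrow> ('g::topological_group_add \<Rightarrow> complex) set" where
  "Md d = {\<phi>\<in>Cb. \<exists>(H :: nat \<Rightarrow> 'g model inner_space) \<xi>. Md_factorization d \<phi> H \<xi>}"

definition Md_norm :: "nat \<Rightarrow> ('g::topological_group_add \<Rightarrow> complex) \<Rightarrow> real" where
  "Md_norm d \<phi> = Inf {Md_factorization_bound d H \<xi> | (H :: nat \<Rightarrow> 'g model inner_space) \<xi>.
     Md_factorization d \<phi> H \<xi>}"


section \<open>The predual and weak amenability\<close>

definition pairing ::
  "'g::topological_group_add measure \<Rightarrow> ('g \<Rightarrow> complex) \<Rightarrow> ('g \<Rightarrow> complex) \<Rightarrow> complex" where
  "pairing \<mu> \<phi> g = (\<integral>t. \<phi> t * g t \<partial>\<mu>)"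

definition Xd_norm ::
  "'g::topological_group_add measure \<Rightarrow> nat \<Rightarrow> ('g \<Rightarrow> complex) \<Rightarrow> real" where
  "Xd_norm \<mu> d g = (SUP \<phi>\<in>{\<phi>\<in>Md d. Md_norm d \<phi> \<le> 1}. cmod (pairing \<mu> \<phi> g))"

text \<open>The completion of \<open>L\<^sup>1(G)\<close> consists of the Cauchy sequences modulo the null sequences.
  Functions that agree almost everywhere are identified as well, since the norm of their difference
  is zero.\<close>

definition Xd_Cauchy ::
  "'g::topological_group_add measure \<Rightarrow> nat \<Rightarrow> (nat \<Rightarrow> 'g \<Rightarrow> complex) set" where
  "Xd_Cauchy \<mu> d = {g. (\<forall>n. integrable \<mu> (g n)) \<and>
     (\<forall>e>0. \<exists>N. \<forall>m\<ge>N. \<forall>n\<ge>N. Xd_norm \<mu> d (\<lambda>t. g m t - g n t) < e)}"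

definition Xd_equiv ::
  "'g::topological_group_add measure \<Rightarrow> nat \<Rightarrow>
    ((nat \<Rightarrow> 'g \<Rightarrow> complex) \<times> (nat \<Rightarrow> 'g \<Rightarrow> complex)) set" where
  "Xd_equiv \<mu> d = {(g, h). g \<in> Xd_Cauchy \<mu> d \<and> h \<in> Xd_Cauchy \<mu> d \<and>
     (\<lambda>n. Xd_norm \<mu> d (\<lambda>t. g n t - h n t)) \<longlonglongrightarrow> 0}"

definition Xd ::
  "'g::topological_group_add measure \<Rightarrow> nat \<Rightarrow> (nat \<Rightarrow> 'g \<Rightarrow> complex) set set" where
  "Xd \<mu> d = Xd_Cauchy \<mu> d // Xd_equiv \<mu> d"

text \<open>The extension by continuity of the duality from \<open>L\<^sup>1(G)\<close> to its completion.\<close>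

definition Xd_pairing ::
  "'g::topological_group_add measure \<Rightarrow> ('g \<Rightarrow> complex) \<Rightarrow> (nat \<Rightarrow> 'g \<Rightarrow> complex) set \<Rightarrow> complex"
  where
  "Xd_pairing \<mu> \<phi> x = (THE c. \<forall>g\<in>x. (\<lambda>n. pairing \<mu> \<phi> (g n)) \<longlonglongrightarrow> c)"

text \<open>The topology \<open>\<sigma>(M\<^sub>d(G), X\<^sub>d(G))\<close>.\<close>

definition Md_weak_topology ::
  "'g::topological_group_add measure \<Rightarrow> nat \<Rightarrow> ('g \<Rightarrow> complex) topology" where
  "Md_weak_topology \<mu> d = topology_generated_by
     {{\<phi>\<in>Md d. Xd_pairing \<mu> \<phi> x \<in> U} | x U. x \<in> Xd \<mu> d \<and> open U}"

definition Md_weakly_amenable_with ::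
  "'g::topological_group_add measure \<Rightarrow> nat \<Rightarrow> real \<Rightarrow> bool" where
  "Md_weakly_amenable_with \<mu> d C \<longleftrightarrow>
     (\<lambda>t. 1) \<in> Md_weak_topology \<mu> d closure_of {\<phi>\<in>Cc \<inter> Md d. Md_norm d \<phi> \<le> C}"

definition Md_weakly_amenable :: "'g::topological_group_add measure \<Rightarrow> nat \<Rightarrow> bool" where
  "Md_weakly_amenable \<mu> d \<longleftrightarrow> (\<exists>C\<ge>1. Md_weakly_amenable_with \<mu> d C)"

text \<open>In \<^typ>\<open>ereal\<close>, the infimum of the empty set is \<open>\<infinity>\<close>.\<close>

definition Md_constant :: "'g::topological_group_add measure \<Rightarrow> nat \<Rightarrow> ereal" where
  "Md_constant \<mu> d = Inf {ereal C | C. 1 \<le> C \<and> Md_weakly_amenable_with \<mu> d C}"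


section \<open>Sufficiency of the type of models\<close>

context complex_hilbert_space
begin

lemma inner_plus_right:
  assumes "x \<in> vectors E" "y \<in> vectors E" "z \<in> vectors E"
  shows "vinner E x (vplus E y z) = vinner E x y + vinner E x z"
  using inner_cnj[OF plus_closed[OF assms(2,3)] assms(1)] inner_cnj[OF assms(2,1)]
    inner_cnj[OF assms(3,1)] inner_plus_left[OF assms(2,3,1)] by simp

lemma inner_scale_right:
  assumes "x \<in> vectors E" "y \<in> vectors E"
  shows "vinner E x (vscale E a y) = cnj a * vinner E x y"
  using inner_cnj[OF scale_closed[OF assms(2)] assms(1)] inner_cnj[OF assms(2,1)]
    inner_scale_left[OF assms(2,1)] by simp

lemma inner_self: "x \<in> vectors E \<Longrightarrow> vinner E x x = complex_of_real ((vnorm E x)\<^sup>2)"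
proof -
  assume x: "x \<in> vectors E"
  then have "Im (vinner E x x) = 0"
    using inner_cnj[OF x x] by (simp add: complex_eq_iff)
  then show ?thesis
    using inner_nonneg[OF x] by (simp add: vnorm_def complex_eq_iff)
qed

lemma vnorm_nonneg: "x \<in> vectors E \<Longrightarrow> 0 \<le> vnorm E x"
  by (simp add: vnorm_def inner_nonneg)

lemma Cauchy_Schwarz:
  assumes x: "x \<in> vectors E" and y: "y \<in> vectors E"
  shows "cmod (vinner E x y) \<le> vnorm E x * vnorm E y"
proof (cases "vnorm E y = 0")
  case True
  then have "vinner E y y = 0" using inner_self[OF y] by simp
  then have "y = vzero E" using inner_definite[OF y] by blast
  moreover have "vscale E 0 y = vzero E"
    using scale_plus_left[OF y, of 1 "-1"] scale_one[OF y] plus_neg[OF y] by simp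
  ultimately have "vinner E x y = 0"
    using inner_scale_right[OF x y, of 0] by simp
  then show ?thesis using True by simp
next
  case False
  define p where "p = vinner E x y"
  define b where "b = (vnorm E y)\<^sup>2"
  have b: "b > 0" using False by (simp add: b_def)
  define a where "a = - p / complex_of_real b"
  define z where "z = vplus E x (vscale E a y)"
  have ay: "vscale E a y \<in> vectors E" using y by (rule scale_closed)
  have z: "z \<in> vectors E" unfolding z_def using x ay by (rule plus_closed)
  have "vinner E z z = vinner E x x + cnj a * p + (a * cnj p + a * (cnj a * vinner E y y))"
    unfolding z_def p_def
    by (simp add: inner_plus_left inner_plus_right inner_scale_left inner_scale_right x y ay
        plus_closed inner_cnj[OF x y] distrib_left)
  also have "\<dots> = vinner E x x - complex_of_real ((cmod p)\<^sup>2 / b)"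
    using b inner_self[OF y] complex_norm_square[of p] unfolding a_def b_def[symmetric]
    by (simp add: field_simps power2_eq_square)
  finally have "0 \<le> (vnorm E x)\<^sup>2 - (cmod p)\<^sup>2 / b"
    using inner_nonneg[OF z] inner_self[OF x] by simp
  then have "(cmod p)\<^sup>2 \<le> (vnorm E x)\<^sup>2 * b"
    using b by (simp add: field_simps)
  then have "(cmod p)\<^sup>2 \<le> (vnorm E x * vnorm E y)\<^sup>2"
    by (simp add: b_def power_mult_distrib)
  then show ?thesis
    unfolding p_def by (rule power2_le_imp_le) (simp add: vnorm_nonneg x y)
qed

lemma scale_zero: "x \<in> vectors E \<Longrightarrow> vscale E 0 x = vzero E"
  using scale_plus_left[of x 1 "-1"] scale_one[of x] plus_neg[of x] by simp

lemma vdiff_closed: "x \<in> vectors E \<Longrightarrow> y \<in> vectors E \<Longrightarrow> vplus E x (vscale E (-1) y) \<in> vectors E"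
  by (simp add: plus_closed scale_closed)

lemma vdiff_eq_zero:
  assumes x: "x \<in> vectors E" and y: "y \<in> vectors E" and "vplus E x (vscale E (-1) y) = vzero E"
  shows "x = y"
proof -
  have "x = vplus E x (vplus E (vscale E (-1) y) y)"
    using plus_zero[OF x] plus_neg[OF y] plus_commute[OF y scale_closed[OF y]] by simp
  also have "\<dots> = vplus E (vzero E) y"
    using plus_assoc[OF x scale_closed[OF y] y, of "-1"] assms(3) by simp
  also have "\<dots> = y"
    using plus_zero[OF y] plus_commute[OF y zero_closed] by simp
  finally show ?thesis .
qed


definition closed_subspace :: "'v set \<Rightarrow> bool" where
  "closed_subspace S \<longleftrightarrow> S \<subseteq> vectors E \<and> vzero E \<in> S \<and>
     (\<forall>x\<in>S. \<forall>y\<in>S. vplus E x y \<in> S) \<and> (\<forall>a. \<forall>x\<in>S. vscale E a x \<in> S) \<and>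
     (\<forall>\<sigma>. \<forall>x\<in>vectors E. (\<forall>n. \<sigma> n \<in> S) \<and> (\<lambda>n. vdist E (\<sigma> n) x) \<longlonglongrightarrow> 0 \<longrightarrow> x \<in> S)"

lemma closed_subspace_vectors: "closed_subspace (vectors E)"
  by (simp add: closed_subspace_def zero_closed plus_closed scale_closed)

definition closed_hull :: "'v set \<Rightarrow> 'v set" where
  "closed_hull A = \<Inter>{S. closed_subspace S \<and> A \<subseteq> S}"

lemma closed_hull_minimal: "closed_subspace S \<Longrightarrow> A \<subseteq> S \<Longrightarrow> closed_hull A \<subseteq> S"
  by (auto simp: closed_hull_def)

lemma closed_subspace_hull: "A \<subseteq> vectors E \<Longrightarrow> closed_subspace (closed_hull A)"
proof -
  assume A: "A \<subseteq> vectors E"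
  have "closed_hull A \<subseteq> vectors E"
    using closed_hull_minimal[OF closed_subspace_vectors A] .
  moreover have "x \<in> closed_hull A"
    if "x \<in> vectors E" "\<forall>n. \<sigma> n \<in> closed_hull A" "(\<lambda>n. vdist E (\<sigma> n) x) \<longlonglongrightarrow> 0" for \<sigma> x
    unfolding closed_hull_def
  proof (intro InterI, clarify)
    fix S assume S: "closed_subspace S" "A \<subseteq> S"
    then have "\<forall>n. \<sigma> n \<in> S" using that(2) closed_hull_minimal by blast
    then show "x \<in> S" using S(1) that unfolding closed_subspace_def by blast
  qed
  moreover have "vplus E x y \<in> closed_hull A" if "x \<in> closed_hull A" "y \<in> closed_hull A" for x y
    using that unfolding closed_hull_def closed_subspace_def by simp
  moreover have "vscale E a x \<in> closed_hull A" if "x \<in> closed_hull A" for a x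
    using that unfolding closed_hull_def closed_subspace_def by simp
  moreover have "vzero E \<in> closed_hull A"
    unfolding closed_hull_def closed_subspace_def by simp
  ultimately show ?thesis
    unfolding closed_subspace_def by blast
qed

lemma closed_hull_subset: "A \<subseteq> closed_hull A"
  by (auto simp: closed_hull_def)

lemma closed_subspace_orthogonal:
  assumes v: "v \<in> vectors E"
  shows "closed_subspace {x \<in> vectors E. vinner E v x = 0}"
  unfolding closed_subspace_def
proof (intro conjI allI ballI impI)
  fix \<sigma> x
  assume x: "x \<in> vectors E"
    and h: "(\<forall>n. \<sigma> n \<in> {x \<in> vectors E. vinner E v x = 0}) \<and> (\<lambda>n. vdist E (\<sigma> n) x) \<longlonglongrightarrow> 0"
  have "cmod (vinner E v x) \<le> vnorm E v * vdist E (\<sigma> n) x" for n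
  proof -
    have s: "\<sigma> n \<in> vectors E" "vinner E v (\<sigma> n) = 0" using h by auto
    have "vinner E v (vplus E (\<sigma> n) (vscale E (-1) x)) = - vinner E v x"
      using s v x by (simp add: inner_plus_right inner_scale_right scale_closed)
    then show ?thesis
      using Cauchy_Schwarz[OF v vdiff_closed[OF s(1) x]] by (simp add: vdist_def)
  qed
  moreover have "(\<lambda>n. vnorm E v * vdist E (\<sigma> n) x) \<longlonglongrightarrow> vnorm E v * 0"
    using h by (intro tendsto_mult tendsto_const) simp
  ultimately have "cmod (vinner E v x) \<le> 0"
    by (intro LIMSEQ_le_const) auto
  then show "x \<in> {x \<in> vectors E. vinner E v x = 0}" using x by simp
next
  show "vzero E \<in> {x \<in> vectors E. vinner E v x = 0}"
    using zero_closed inner_scale_right[OF v zero_closed, of 0] scale_zero[OF zero_closed] by simp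
qed (use v in \<open>auto simp: zero_closed plus_closed scale_closed inner_plus_right inner_scale_right\<close>)

lemma closed_subspace_vimage:
  assumes "complex_hilbert_space F" and T: "T \<in> bounded_operators E F"
    and S: "complex_hilbert_space.closed_subspace F S"
  shows "closed_subspace {x \<in> vectors E. T x \<in> S}"
proof -
  interpret F: complex_hilbert_space F by fact
  obtain c where c: "\<And>x. x \<in> vectors E \<Longrightarrow> vnorm F (T x) \<le> c * vnorm E x"
    using T unfolding bounded_operators_def by blast
  have Tv: "\<And>x. x \<in> vectors E \<Longrightarrow> T x \<in> vectors F"
    and Tp: "\<And>x y. x \<in> vectors E \<Longrightarrow> y \<in> vectors E \<Longrightarrow> T (vplus E x y) = vplus F (T x) (T y)"
    and Ts: "\<And>a x. x \<in> vectors E \<Longrightarrow> T (vscale E a x) = vscale F a (T x)"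
    using T by (auto simp: bounded_operators_def)
  have T0: "T (vzero E) = vzero F"
    using Ts[OF zero_closed, of 0] scale_zero[OF zero_closed] F.scale_zero[OF Tv[OF zero_closed]]
    by simp
  have SF: "S \<subseteq> vectors F" "vzero F \<in> S"
    "\<And>x y. x \<in> S \<Longrightarrow> y \<in> S \<Longrightarrow> vplus F x y \<in> S" "\<And>a x. x \<in> S \<Longrightarrow> vscale F a x \<in> S"
    "\<And>x \<tau>. x \<in> vectors F \<Longrightarrow> \<forall>n. \<tau> n \<in> S \<Longrightarrow> (\<lambda>n. vdist F (\<tau> n) x) \<longlonglongrightarrow> 0 \<Longrightarrow> x \<in> S"
    using S unfolding F.closed_subspace_def by blast+
  show ?thesis
    unfolding closed_subspace_def
  proof (intro conjI allI ballI impI)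
    fix \<sigma> x
    assume x: "x \<in> vectors E"
      and h: "(\<forall>n. \<sigma> n \<in> {x \<in> vectors E. T x \<in> S}) \<and> (\<lambda>n. vdist E (\<sigma> n) x) \<longlonglongrightarrow> 0"
    have b: "vdist F (T (\<sigma> n)) (T x) \<le> c * vdist E (\<sigma> n) x" for n
    proof -
      have s: "\<sigma> n \<in> vectors E" using h by auto
      show ?thesis
        using c[OF vdiff_closed[OF s x]] s x by (simp add: vdist_def Tp Ts scale_closed)
    qed
    have nn: "0 \<le> vdist F (T (\<sigma> n)) (T x)" for n
      using h x by (simp add: vdist_def F.vnorm_nonneg F.vdiff_closed Tv)
    have "(\<lambda>n. c * vdist E (\<sigma> n) x) \<longlonglongrightarrow> 0"
      using h by (intro tendsto_mult_right_zero) simp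
    then have "(\<lambda>n. vdist F (T (\<sigma> n)) (T x)) \<longlonglongrightarrow> 0"
      by (rule tendsto_sandwich[OF _ _ tendsto_const, rotated 2]) (simp_all add: b nn)
    then have "T x \<in> S"
      using SF(5)[of "T x" "\<lambda>n. T (\<sigma> n)"] Tv[OF x] h by simp
    then show "x \<in> {x \<in> vectors E. T x \<in> S}" using x by simp
  qed (auto simp: SF(2-4) zero_closed plus_closed scale_closed T0 Tp Ts)
qed

end

definition transport :: "'v inner_space \<Rightarrow> 'v set \<Rightarrow> ('v \<Rightarrow> 'w) \<Rightarrow> 'w inner_space" where
  "transport E S e = \<lparr>vectors = e ` S, vzero = e (vzero E),
     vplus = (\<lambda>x y. e (vplus E (inv_into S e x) (inv_into S e y))),
     vscale = (\<lambda>a x. e (vscale E a (inv_into S e x))),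
     vinner = (\<lambda>x y. vinner E (inv_into S e x) (inv_into S e y))\<rparr>"

definition embedding :: "'v inner_space \<Rightarrow> 'v set \<Rightarrow> ('v \<Rightarrow> 'w) \<Rightarrow> 'w inner_space \<Rightarrow> bool" where
  "embedding E S e F \<longleftrightarrow> inj_on e S \<and> vectors F = e ` S \<and> vzero F = e (vzero E) \<and>
     (\<forall>x\<in>S. \<forall>y\<in>S. vplus F (e x) (e y) = e (vplus E x y) \<and> vinner F (e x) (e y) = vinner E x y) \<and>
     (\<forall>a. \<forall>x\<in>S. vscale F a (e x) = e (vscale E a x))"

lemma embedding_transport: "inj_on e S \<Longrightarrow> embedding E S e (transport E S e)"
  by (simp add: embedding_def transport_def)

lemma embedding_hilbert:
  fixes E :: "'a inner_space" and F :: "'b inner_space"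
  assumes "complex_hilbert_space E" "complex_hilbert_space.closed_subspace E S" "embedding E S e F"
  shows "complex_hilbert_space F"
proof -
  interpret complex_hilbert_space E by fact
  have S: "S \<subseteq> vectors E" "vzero E \<in> S"
    "\<And>x y. x \<in> S \<Longrightarrow> y \<in> S \<Longrightarrow> vplus E x y \<in> S" "\<And>a x. x \<in> S \<Longrightarrow> vscale E a x \<in> S"
    "\<And>\<sigma> x. x \<in> vectors E \<Longrightarrow> \<forall>n. \<sigma> n \<in> S \<Longrightarrow> (\<lambda>n. vdist E (\<sigma> n) x) \<longlonglongrightarrow> 0 \<Longrightarrow> x \<in> S"
    using assms(2) unfolding closed_subspace_def by blast+
  have v: "\<And>x. x \<in> S \<Longrightarrow> x \<in> vectors E" using S(1) by blast
  have e: "inj_on e S" "vectors F = e ` S" "vzero F = e (vzero E)"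
    "\<And>x y. x \<in> S \<Longrightarrow> y \<in> S \<Longrightarrow> vplus F (e x) (e y) = e (vplus E x y)"
    "\<And>x y. x \<in> S \<Longrightarrow> y \<in> S \<Longrightarrow> vinner F (e x) (e y) = vinner E x y"
    "\<And>a x. x \<in> S \<Longrightarrow> vscale F a (e x) = e (vscale E a x)"
    using assms(3) unfolding embedding_def by blast+
  have d: "vdist F (e x) (e y) = vdist E x y" if "x \<in> S" "y \<in> S" for x y
    using that by (simp add: vdist_def vnorm_def e S)
  have comm: "e (vplus E x y) = e (vplus E y x)" if "x \<in> S" "y \<in> S" for x y
    using plus_commute[OF v v, OF that] by simp
  have cnj: "vinner E y x = cnj (vinner E x y)" if "x \<in> S" "y \<in> S" for x y
    using inner_cnj[OF v v, OF that] .
  show ?thesis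
  proof
    fix \<sigma> :: "nat \<Rightarrow> 'b"
    assume 1: "\<forall>n. \<sigma> n \<in> vectors F"
      and 2: "\<forall>r>0. \<exists>N. \<forall>m\<ge>N. \<forall>n\<ge>N. vdist F (\<sigma> m) (\<sigma> n) < r"
    have "\<forall>n. \<exists>x. x \<in> S \<and> \<sigma> n = e x" using 1 e(2) by auto
    then obtain \<tau> where \<tau>: "\<And>n. \<tau> n \<in> S" "\<And>n. \<sigma> n = e (\<tau> n)" by metis
    have "\<forall>r>0. \<exists>N. \<forall>m\<ge>N. \<forall>n\<ge>N. vdist E (\<tau> m) (\<tau> n) < r"
      using 2 by (simp add: \<tau> d)
    then obtain x where x: "x \<in> vectors E" "(\<lambda>n. vdist E (\<tau> n) x) \<longlonglongrightarrow> 0"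
      using complete[of \<tau>] \<tau>(1) v by blast
    then have xS: "x \<in> S" using S(5)[of x \<tau>] \<tau>(1) by blast
    then have "(\<lambda>n. vdist F (\<sigma> n) (e x)) \<longlonglongrightarrow> 0"
      using x by (simp add: \<tau> d)
    then show "\<exists>x\<in>vectors F. (\<lambda>n. vdist F (\<sigma> n) x) \<longlonglongrightarrow> 0"
      using xS e(2) by auto
  next
    fix x assume x: "x \<in> vectors F" "vinner F x x = 0"
    then obtain x' where x': "x' \<in> S" "x = e x'" using e(2) by auto
    then show "x = vzero F"
      using x(2) inner_definite[of x'] v by (simp add: e)
  qed (auto simp: e S v plus_assoc plus_zero plus_neg scale_scale scale_one
      scale_plus_right scale_plus_left inner_plus_left inner_scale_left inner_nonneg
      intro: comm cnj)
qed

lemma embedding_vnorm: "embedding E S e F \<Longrightarrow> x \<in> S \<Longrightarrow> vnorm F (e x) = vnorm E x"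
  by (simp add: embedding_def vnorm_def)

lemma operator_norm_bdd:
  assumes "complex_hilbert_space E" "T \<in> bounded_operators E F"
  shows "bdd_above ((\<lambda>x. vnorm F (T x) / vnorm E x) ` vectors E)"
proof -
  interpret complex_hilbert_space E by fact
  obtain c where c: "\<And>x. x \<in> vectors E \<Longrightarrow> vnorm F (T x) \<le> c * vnorm E x"
    using assms(2) unfolding bounded_operators_def by blast
  have "vnorm F (T x) / vnorm E x \<le> \<bar>c\<bar>" if x: "x \<in> vectors E" for x
  proof (cases "vnorm E x = 0")
    case False
    then have "vnorm E x > 0" using vnorm_nonneg[OF x] by simp
    moreover from this have "c * vnorm E x \<le> \<bar>c\<bar> * vnorm E x"
      by (intro mult_right_mono) auto
    ultimately show ?thesis
      using order_trans[OF c[OF x]] by (subst pos_divide_le_eq) blast+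
  qed simp
  then show ?thesis by (intro bdd_aboveI2) blast
qed

lemma operator_norm_nonneg:
  assumes "complex_hilbert_space E" "complex_hilbert_space F" "T \<in> bounded_operators E F"
  shows "0 \<le> operator_norm E F T"
proof -
  interpret E: complex_hilbert_space E by fact
  interpret F: complex_hilbert_space F by fact
  have "T (vzero E) \<in> vectors F"
    using assms(3) E.zero_closed by (simp add: bounded_operators_def)
  then have "0 \<le> vnorm F (T (vzero E)) / vnorm E (vzero E)"
    by (simp add: E.vnorm_nonneg F.vnorm_nonneg E.zero_closed)
  also have "\<dots> \<le> operator_norm E F T"
    unfolding operator_norm_def
    by (intro cSUP_upper operator_norm_bdd assms E.zero_closed)
  finally show ?thesis .
qed

lemma embedding_operator:
  assumes "complex_hilbert_space E" "complex_hilbert_space F" and T: "T \<in> bounded_operators E F"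
    and S: "complex_hilbert_space.closed_subspace E S" and R: "complex_hilbert_space.closed_subspace F R"
    and e: "embedding E S e E'" and f: "embedding F R f F'"
    and TS: "\<And>x. x \<in> S \<Longrightarrow> T x \<in> R"
  defines "T' \<equiv> \<lambda>y. f (T (inv_into S e y))"
  shows "T' \<in> bounded_operators E' F'" and "operator_norm E' F' T' \<le> operator_norm E F T"
    and "\<And>x. x \<in> S \<Longrightarrow> T' (e x) = f (T x)"
proof -
  interpret E: complex_hilbert_space E by fact
  interpret F: complex_hilbert_space F by fact
  have SE: "S \<subseteq> vectors E" and S0: "vzero E \<in> S"
    and Sp: "\<And>x y. x \<in> S \<Longrightarrow> y \<in> S \<Longrightarrow> vplus E x y \<in> S"
    and Ss: "\<And>a x. x \<in> S \<Longrightarrow> vscale E a x \<in> S"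
    using S unfolding E.closed_subspace_def by blast+
  show T': "T' (e x) = f (T x)" if "x \<in> S" for x
    using that e by (simp add: T'_def embedding_def)
  have E': "vectors E' = e ` S" using e by (simp add: embedding_def)
  obtain c where c: "\<And>x. x \<in> vectors E \<Longrightarrow> vnorm F (T x) \<le> c * vnorm E x"
    using T unfolding bounded_operators_def by blast
  have n: "vnorm F' (T' (e x)) = vnorm F (T x)" "vnorm E' (e x) = vnorm E x" if "x \<in> S" for x
    using that TS by (simp_all add: T' embedding_vnorm[OF e] embedding_vnorm[OF f])
  show "T' \<in> bounded_operators E' F'"
    unfolding bounded_operators_def
  proof (intro CollectI conjI ballI allI exI)
    fix x assume "x \<in> vectors E'"
    then obtain x' where x': "x' \<in> S" "x = e x'" using E' by auto
    show "T' x \<in> vectors F'"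
      using x' TS f by (simp add: T' embedding_def)
    show "vnorm F' (T' x) \<le> c * vnorm E' x"
      using x' n c SE by auto
    show "T' (vscale E' a x) = vscale F' a (T' x)" for a
      using x' T TS e f SE by (auto simp: T' embedding_def bounded_operators_def Ss)
    fix y assume "y \<in> vectors E'"
    then obtain y' where y': "y' \<in> S" "y = e y'" using E' by auto
    show "T' (vplus E' x y) = vplus F' (T' x) (T' y)"
    proof -
      have "vplus E' x y = e (vplus E x' y')" using e x' y' by (simp add: embedding_def)
      moreover have "T (vplus E x' y') = vplus F (T x') (T y')"
        using T x' y' SE unfolding bounded_operators_def by blast
      moreover have "vplus F' (f (T x')) (f (T y')) = f (vplus F (T x') (T y'))"
        using f TS x' y' by (simp add: embedding_def)
      ultimately show ?thesis using x' y' by (simp add: T' Sp)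
    qed
  qed
  show "operator_norm E' F' T' \<le> operator_norm E F T"
    unfolding operator_norm_def E' image_image
  proof (rule cSUP_mono)
    show "S \<noteq> {}" using S0 by blast
    show "bdd_above ((\<lambda>x. vnorm F (T x) / vnorm E x) ` vectors E)"
      by (rule operator_norm_bdd) fact+
    show "\<exists>x\<in>vectors E. vnorm F' (T' (e y)) / vnorm E' (e y) \<le> vnorm F (T x) / vnorm E x"
      if "y \<in> S" for y
      using that SE n by (intro bexI[of _ y]) auto
  qed
qed

text \<open>
  The Hilbert space \<open>H i\<close> (\<open>0 < i < d\<close>) is cut down to the closed linear span \<open>K i\<close> of the vectors
  \<open>\<xi> (i + 1) (t (i + 1)) (\<dots> (\<xi> d (t d) 1))\<close>. These are indexed by words over the group, and \<open>K i\<close> is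
  identified with a set of functions on words, a vector being sent to its inner products with them.
\<close>

lemma Md_factorization_in_model:
  fixes H :: "nat \<Rightarrow> (complex + 'w) inner_space" and \<phi> :: "'g::group_add \<Rightarrow> complex"
  assumes fac: "Md_factorization d \<phi> H \<xi>"
  shows "\<exists>(H' :: nat \<Rightarrow> 'g model inner_space) \<xi>'. Md_factorization d \<phi> H' \<xi>' \<and>
    Md_factorization_bound d H' \<xi>' \<le> Md_factorization_bound d H \<xi>"
proof -
  have Hil: "complex_hilbert_space (H i)" if "i \<le> d" for i
    using fac that by (simp add: Md_factorization_def)
  have H0: "H 0 = scalars" and Hd: "H d = scalars"
    using fac by (auto simp: Md_factorization_def)
  have op: "\<xi> i t \<in> bounded_operators (H i) (H (i - 1))" if "i \<in> {1..d}" for i t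
    using fac that by (auto simp: Md_factorization_def)
  have bdd: "bdd_above (range (\<lambda>t. operator_norm (H i) (H (i - 1)) (\<xi> i t)))" if "i \<in> {1..d}" for i
    using fac that by (auto simp: Md_factorization_def)
  have eq: "foldr (\<lambda>i. \<xi> i (t i)) [1..<Suc d] (Inl 1) = Inl (\<phi> (sum_list (map t [1..<Suc d])))"
    for t :: "nat \<Rightarrow> 'g"
    using fac by (auto simp: Md_factorization_def)

  define orb where "orb i t = foldr (\<lambda>j. \<xi> j (t j)) [Suc i..<Suc d] (Inl 1)" for i and t :: "nat \<Rightarrow> 'g"
  have orb_step: "orb (i - 1) t = \<xi> i (t i) (orb i t)" if "i \<in> {1..d}" for i t
    using that by (simp add: orb_def upt_conv_Cons del: upt_Suc)
  have orb_in: "orb i t \<in> vectors (H i)" if "i \<le> d" for i t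
    using that
  proof (induction "d - i" arbitrary: i)
    case 0
    then have "i = d" by simp
    then show ?case using Hd by (simp add: orb_def scalars_def)
  next
    case (Suc k)
    then have "orb (Suc i) t \<in> vectors (H (Suc i))" by simp
    then show ?case
      using op[of "Suc i" "t (Suc i)"] orb_step[of "Suc i" t] Suc
      by (auto simp: bounded_operators_def)
  qed
  have orb_cong: "orb i t = orb i s" if "\<And>j. j \<in> {Suc i..d} \<Longrightarrow> t j = s j" for i t s
    unfolding orb_def using that by (intro foldr_cong) auto
  define word where "word i w j = (w :: 'g list) ! (j - Suc i)" for i j w
  have orb_word: "orb i t = orb i (word i (map t [Suc i..<Suc d]))" for i t
    by (rule orb_cong) (auto simp: word_def simp del: upt_Suc)

  define K where "K i = (if i = 0 \<or> i = d then vectors (H i)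
    else complex_hilbert_space.closed_hull (H i) (range (orb i)))" for i
  define e :: "nat \<Rightarrow> complex + 'w \<Rightarrow> 'g model" where
    "e i = (if i = 0 \<or> i = d then (\<lambda>v. Inl (projl v))
      else (\<lambda>v. Inr (\<lambda>w. vinner (H i) v (orb i (word i w)))))" for i
  define H' where "H' i = (if i = 0 \<or> i = d then scalars else transport (H i) (K i) (e i))" for i
  define \<xi>' where "\<xi>' i t v = e (i - 1) (\<xi> i t (inv_into (K i) (e i) v))" for i t v

  have K: "complex_hilbert_space.closed_subspace (H i) (K i)" if "i \<le> d" for i
  proof -
    interpret complex_hilbert_space "H i" using Hil that .
    show ?thesis
      unfolding K_def using closed_subspace_vectors closed_subspace_hull[of "range (orb i)"] orb_in[OF that]
      by auto
  qed
  have orb_K: "orb i t \<in> K i" if "i \<le> d" for i t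
  proof -
    interpret complex_hilbert_space "H i" using Hil that .
    show ?thesis
      unfolding K_def using closed_hull_subset[of "range (orb i)"] orb_in[OF that] by auto
  qed
  have inj: "inj_on (e i) (K i)" if i: "i \<le> d" "i \<noteq> 0" "i \<noteq> d" for i
  proof (rule inj_onI)
    interpret complex_hilbert_space "H i" using Hil i(1) .
    fix x y assume xy: "x \<in> K i" "y \<in> K i" and exy: "e i x = e i y"
    have sub: "K i \<subseteq> vectors (H i)" and
      Kd: "vplus (H i) x (vscale (H i) (-1) y) \<in> K i"
      using K[OF i(1)] xy unfolding closed_subspace_def by blast+
    define z where "z = vplus (H i) x (vscale (H i) (-1) y)"
    have z: "z \<in> vectors (H i)" using Kd sub by (auto simp: z_def)
    have v: "x \<in> vectors (H i)" "y \<in> vectors (H i)" using xy sub by auto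
    have "vinner (H i) z (orb i t) = 0" for t
    proof -
      have "vinner (H i) x (orb i t) = vinner (H i) y (orb i t)"
        using exy i orb_word[of i t] by (auto simp: e_def fun_eq_iff)
      then show ?thesis
        using v orb_in[OF i(1)] by (simp add: z_def inner_plus_left inner_scale_left scale_closed)
    qed
    then have "range (orb i) \<subseteq> {u \<in> vectors (H i). vinner (H i) z u = 0}"
      using orb_in[OF i(1)] by auto
    then have "K i \<subseteq> {u \<in> vectors (H i). vinner (H i) z u = 0}"
      using i closed_hull_minimal[OF closed_subspace_orthogonal[OF z]] by (simp add: K_def)
    then have "z = vzero (H i)"
      using Kd inner_definite[OF z] by (auto simp: z_def)
    then show "x = y" using vdiff_eq_zero[OF v] by (simp add: z_def)
  qed
  have emb_scalars: "embedding scalars (vectors scalars) (\<lambda>v :: complex + 'w. Inl (projl v)) scalars"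
    by (auto simp: embedding_def scalars_def inj_on_def image_iff)
  have emb: "embedding (H i) (K i) (e i) (H' i)" if "i \<le> d" for i
  proof (cases "i = 0 \<or> i = d")
    case True
    then have "H i = scalars" using H0 Hd by auto
    then show ?thesis using True emb_scalars unfolding K_def e_def H'_def by simp
  next
    case False
    then show ?thesis using embedding_transport[OF inj[OF that]] by (simp add: H'_def)
  qed
  have TK: "\<xi> i t x \<in> K (i - 1)" if i: "i \<in> {1..d}" and x: "x \<in> K i" for i t x
  proof -
    have id: "i \<le> d" "i - 1 \<le> d" using i by auto
    interpret complex_hilbert_space "H i" using Hil id(1) .
    interpret F: complex_hilbert_space "H (i - 1)" using Hil id(2) .
    have xv: "x \<in> vectors (H i)" using K[OF id(1)] x unfolding closed_subspace_def by blast
    have xiv: "\<xi> i t x \<in> vectors (H (i - 1))"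
      using op[OF i] xv by (auto simp: bounded_operators_def)
    show ?thesis
    proof (cases "i = d")
      case False
      let ?S = "{x \<in> vectors (H i). \<xi> i t x \<in> K (i - 1)}"
      have "closed_subspace ?S"
        using closed_subspace_vimage[OF F.complex_hilbert_space_axioms op[OF i] K[OF id(2)]] .
      moreover have "orb i s \<in> ?S" for s
      proof -
        have "orb (i - 1) (s(i := t)) = \<xi> i t (orb i s)"
          using orb_step[OF i, of "s(i := t)"] orb_cong[of i "s(i := t)" s] by simp
        then show ?thesis using orb_K[OF id(2), of "s(i := t)"] orb_in[OF id(1)] by simp
      qed
      ultimately have "closed_hull (range (orb i)) \<subseteq> ?S"
        by (intro closed_hull_minimal) blast+
      moreover have "K i = closed_hull (range (orb i))"
        using False i by (simp add: K_def)
      ultimately have "K i \<subseteq> ?S" by simp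
      then show ?thesis using x by blast
    next
      case True
      have "x \<in> range Inl" using xv True Hd by (simp add: scalars_def)
      then obtain a where a: "x = Inl a" by auto
      have o: "orb d s = Inl 1" for s by (simp add: orb_def)
      have "\<xi> i t x = vscale (H (i - 1)) a (\<xi> i t (Inl 1))"
      proof -
        have "x = vscale (H i) a (Inl 1)" "Inl 1 \<in> vectors (H i)"
          using a True Hd by (auto simp: scalars_def)
        then show ?thesis using op[OF i, of t] by (auto simp: bounded_operators_def)
      qed
      moreover have "\<xi> i t (Inl 1) = orb (i - 1) (\<lambda>_. t)"
        using orb_step[OF i, of "\<lambda>_. t"] True o by simp
      ultimately show ?thesis
        using orb_K[OF id(2)] K[OF id(2)] unfolding F.closed_subspace_def by simp
    qed
  qed
  have Hil': "complex_hilbert_space (H' i)" if "i \<le> d" for i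
    using embedding_hilbert[OF Hil K emb] that by blast
  have step: "\<xi>' i t \<in> bounded_operators (H' i) (H' (i - 1))"
      "operator_norm (H' i) (H' (i - 1)) (\<xi>' i t) \<le> operator_norm (H i) (H (i - 1)) (\<xi> i t)"
      "\<And>x. x \<in> K i \<Longrightarrow> \<xi>' i t (e i x) = e (i - 1) (\<xi> i t x)"
    if i: "i \<in> {1..d}" for i t
  proof -
    have id: "i \<le> d" "i - 1 \<le> d" using i by auto
    note * = embedding_operator[OF Hil[OF id(1)] Hil[OF id(2)] op[OF i] K[OF id(1)] K[OF id(2)]
        emb[OF id(1)] emb[OF id(2)] TK[OF i], folded \<xi>'_def]
    have x: "(\<lambda>v. \<xi>' i t v) = (\<lambda>y. e (i - 1) (\<xi> i t (inv_into (K i) (e i) y)))"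
      by (simp add: \<xi>'_def)
    show "\<xi>' i t \<in> bounded_operators (H' i) (H' (i - 1))"
      "operator_norm (H' i) (H' (i - 1)) (\<xi>' i t) \<le> operator_norm (H i) (H (i - 1)) (\<xi> i t)"
      "\<And>x. x \<in> K i \<Longrightarrow> \<xi>' i t (e i x) = e (i - 1) (\<xi> i t x)"
      using * by auto
  qed
  have orb': "foldr (\<lambda>j. \<xi>' j (t j)) [Suc i..<Suc d] (Inl 1) = e i (orb i t)" if "i \<le> d" for i t
    using that
  proof (induction "d - i" arbitrary: i)
    case 0
    then show ?case by (simp add: orb_def e_def)
  next
    case (Suc k)
    then have "foldr (\<lambda>j. \<xi>' j (t j)) [Suc i..<Suc d] (Inl 1) = \<xi>' (Suc i) (t (Suc i)) (e (Suc i) (orb (Suc i) t))"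
      by (simp add: upt_conv_Cons del: upt_Suc)
    also have "\<dots> = e i (orb i t)"
      using step(3)[of "Suc i" "orb (Suc i) t" "t (Suc i)"] orb_K[of "Suc i" t] orb_step[of "Suc i" t] Suc
      by auto
    finally show ?case .
  qed
  have le: "(SUP t. operator_norm (H' i) (H' (i - 1)) (\<xi>' i t)) \<le> (SUP t. operator_norm (H i) (H (i - 1)) (\<xi> i t))"
    and bdd': "bdd_above (range (\<lambda>t. operator_norm (H' i) (H' (i - 1)) (\<xi>' i t)))"
    and nn: "0 \<le> (SUP t. operator_norm (H' i) (H' (i - 1)) (\<xi>' i t))"
    if i: "i \<in> {1..d}" for i
  proof -
    show "(SUP t. operator_norm (H' i) (H' (i - 1)) (\<xi>' i t)) \<le> (SUP t. operator_norm (H i) (H (i - 1)) (\<xi> i t))"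
      using step(2)[OF i] bdd[OF i] by (intro cSUP_mono) auto
    obtain M where "\<And>t. operator_norm (H i) (H (i - 1)) (\<xi> i t) \<le> M"
      using bdd[OF i] by (auto simp: bdd_above_def)
    then show b: "bdd_above (range (\<lambda>t. operator_norm (H' i) (H' (i - 1)) (\<xi>' i t)))"
      using step(2)[OF i] by (intro bdd_aboveI2[of _ _ M]) (meson order_trans)
    have "0 \<le> operator_norm (H' i) (H' (i - 1)) (\<xi>' i undefined)"
      using i by (intro operator_norm_nonneg Hil' step) auto
    also have "\<dots> \<le> (SUP t. operator_norm (H' i) (H' (i - 1)) (\<xi>' i t))"
      using b by (rule cSUP_upper[OF UNIV_I])
    finally show "0 \<le> (SUP t. operator_norm (H' i) (H' (i - 1)) (\<xi>' i t))" .
  qed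
  have "Md_factorization d \<phi> H' \<xi>'"
    unfolding Md_factorization_def
  proof (intro conjI allI ballI impI)
    show "H' 0 = scalars" "H' d = scalars" by (simp_all add: H'_def)
    fix t :: "nat \<Rightarrow> 'g"
    show "foldr (\<lambda>i. \<xi>' i (t i)) [1..<Suc d] (Inl 1) = Inl (\<phi> (sum_list (map t [1..<Suc d])))"
      using orb'[of 0 t] eq[of t] by (simp add: orb_def e_def del: upt_Suc)
  qed (use Hil' step(1) bdd' in auto)
  moreover have "Md_factorization_bound d H' \<xi>' \<le> Md_factorization_bound d H \<xi>"
    unfolding Md_factorization_bound_def using le nn by (intro prod_mono) auto
  ultimately show ?thesis by blast
qed

end

theory Submission
  imports Defs
begin

text \<open>
  Weak amenability is defined with the weak topology coming from the predual, which depends on the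
  Haar measure; on \<open>G \<times> H\<close> it is therefore tied to a Haar measure \<open>\<omega>\<close> that is only a Radon measure on
  the Borel sets of \<open>G \<times> H\<close>, and these need not be generated by the measurable rectangles. The proof
  removes the measures before it passes to the product. For \<open>C \<ge> 1\<close>, a group is weakly amenable with the constant \<open>C\<close> iff on every
  compact set \<open>1\<close> is a uniform limit of multipliers in \<open>C\<^sub>c\<close> of norm at most \<open>C\<close>
  (\<open>weakly_amenable_iff_unit_locally_uniform_limit\<close>). This criterion is intrinsic to the group.

  If such approximations exist, they converge to \<open>1\<close> against an integrable function \<open>g\<close>, because \<open>\<bar>g\<bar>\<close>
  has most of its mass on a compact set and the multipliers are bounded by \<open>C\<close>; norm bounds carry this
  over from \<open>L\<^sup>1\<close> to its completion. Conversely, let \<open>V\<close> be compact of positive measure. The mean of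
  \<open>\<phi>\<close> over \<open>s + V\<close> is the pairing of \<open>\<phi>\<close> with an integrable function that depends continuously on \<open>s\<close>
  in \<open>L\<^sup>1\<close>, so for \<open>s\<close> in a compact set only finitely many pairings have to be controlled. As a
  function of \<open>s\<close>, this mean is a uniform limit of convex combinations of right translates of \<open>\<phi>\<close>,
  because \<open>\<phi>\<close> is uniformly continuous. A convex combination of right translates is a multiplier of at
  most the same norm: it suffices to take the combination in the last operator of a factorization.

  With the criterion, one direction restricts multipliers of \<open>G \<times> H\<close> to the factors, and the other
  takes products \<open>\<phi>(s) \<psi>(t)\<close>, whose norm is at most \<open>\<parallel>\<phi>\<parallel> \<parallel>\<psi>\<parallel>\<close> (\<open>Md_tensor\<close>). The latter is where Hilbert
  spaces are needed: factorizations of \<open>\<phi>\<close> and \<open>\<psi>\<close> through \<open>H i\<close> and \<open>H' i\<close> give one through tensor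
  products. Only the span of the vectors \<open>\<xi> (i + 1) (t (i + 1)) (\<dots> (\<xi> d (t d) 1))\<close> matters, so the
  tensor product is built as the completion for the product of two Gram kernels, which is positive
  semidefinite by Schur's theorem (\<open>psd_kernel_mult\<close>). The norm estimate for the tensor product of two
  operators is again a statement about positive semidefinite kernels, and the operators are obtained
  by extension from a dense span (\<open>operator_extension\<close>).
\<close>


section \<open>Combinations of vectors and extension of operators\<close>

context complex_hilbert_space
begin

text \<open>
  Vector identities in a space with a carrier set become identities between complex numbers, on which
  the simplifier can work.
\<close>

lemma vector_eqI:
  assumes "x \<in> vectors E" "y \<in> vectors E"
    and "\<And>z. z \<in> vectors E \<Longrightarrow> vinner E x z = vinner E y z"
  shows "x = y"
proof (rule vdiff_eq_zero[OF assms(1,2)])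
  let ?d = "vplus E x (vscale E (-1) y)"
  have d: "?d \<in> vectors E" using assms(1,2) by (rule vdiff_closed)
  show "?d = vzero E"
    using assms(3)[OF d] by (intro inner_definite d) (simp add: inner_plus_left inner_scale_left scale_closed assms d)
qed

lemma inner_zero_left: "z \<in> vectors E \<Longrightarrow> vinner E (vzero E) z = 0"
  using inner_scale_left[of "vzero E" z 0] zero_closed scale_zero by simp

lemma vnorm_power2: "(vnorm E x)\<^sup>2 = Re (vinner E x x)" if "x \<in> vectors E"
  using that by (simp add: vnorm_def inner_nonneg)

lemma vnorm_triangle:
  assumes x: "x \<in> vectors E" and y: "y \<in> vectors E"
  shows "vnorm E (vplus E x y) \<le> vnorm E x + vnorm E y"
proof (rule power2_le_imp_le)
  have "(vnorm E (vplus E x y))\<^sup>2 = (vnorm E x)\<^sup>2 + 2 * Re (vinner E x y) + (vnorm E y)\<^sup>2"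
    using inner_cnj[OF x y] x y
    by (simp add: vnorm_power2 plus_closed inner_plus_left inner_plus_right)
  also have "\<dots> \<le> (vnorm E x + vnorm E y)\<^sup>2"
    using Cauchy_Schwarz[OF x y] complex_Re_le_cmod[of "vinner E x y"] by (simp add: power2_sum)
  finally show "(vnorm E (vplus E x y))\<^sup>2 \<le> (vnorm E x + vnorm E y)\<^sup>2" .
qed (simp add: vnorm_nonneg x y)

lemma vnorm_scale:
  assumes x: "x \<in> vectors E"
  shows "vnorm E (vscale E a x) = cmod a * vnorm E x"
proof -
  have "vinner E (vscale E a x) (vscale E a x) = complex_of_real ((cmod a * vnorm E x)\<^sup>2)"
    using complex_norm_square[of a] inner_self[OF x] x
    by (simp only: inner_scale_left inner_scale_right scale_closed) (simp add: power_mult_distrib)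
  then show ?thesis
    using vnorm_nonneg[OF x] by (simp add: vnorm_def[of E "vscale E a x"])
qed

lemma vnorm_eq_zero: "x \<in> vectors E \<Longrightarrow> vnorm E x = 0 \<Longrightarrow> x = vzero E"
  using inner_self[of x] inner_definite[of x] by simp

lemma vnorm_zero: "vnorm E (vzero E) = 0"
  by (simp add: vnorm_def inner_zero_left zero_closed)

lemma vdist_self: "x \<in> vectors E \<Longrightarrow> vdist E x x = 0"
  by (simp add: vdist_def plus_neg vnorm_zero)

lemma vdist_nonneg: "x \<in> vectors E \<Longrightarrow> y \<in> vectors E \<Longrightarrow> 0 \<le> vdist E x y"
  by (simp add: vdist_def vnorm_nonneg vdiff_closed)

lemma vdist_plus:
  assumes "x \<in> vectors E" "y \<in> vectors E" "x' \<in> vectors E" "y' \<in> vectors E"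
  shows "vdist E (vplus E x x') (vplus E y y') \<le> vdist E x y + vdist E x' y'"
proof -
  have "vplus E (vplus E x x') (vscale E (-1) (vplus E y y')) =
      vplus E (vplus E x (vscale E (-1) y)) (vplus E x' (vscale E (-1) y'))"
    by (rule vector_eqI)
      (simp_all add: assms plus_closed scale_closed inner_plus_left inner_scale_left)
  then show ?thesis
    using vnorm_triangle[OF vdiff_closed[OF assms(1,2)] vdiff_closed[OF assms(3,4)]]
    by (simp add: vdist_def)
qed

lemma tendsto_vdist_plus:
  assumes "\<And>n. \<sigma> n \<in> vectors E" "x \<in> vectors E" "\<And>n. \<tau> n \<in> vectors E" "y \<in> vectors E"
    and "(\<lambda>n. vdist E (\<sigma> n) x) \<longlonglongrightarrow> 0" "(\<lambda>n. vdist E (\<tau> n) y) \<longlonglongrightarrow> 0"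
  shows "(\<lambda>n. vdist E (vplus E (\<sigma> n) (\<tau> n)) (vplus E x y)) \<longlonglongrightarrow> 0"
proof (rule Lim_null_comparison)
  show "(\<lambda>n. vdist E (\<sigma> n) x + vdist E (\<tau> n) y) \<longlonglongrightarrow> 0"
    using tendsto_add[OF assms(5,6)] by simp
qed (simp add: assms(1-4) vdist_nonneg vdist_plus plus_closed)

lemma vdist_scale:
  assumes "x \<in> vectors E" "y \<in> vectors E"
  shows "vdist E (vscale E a x) (vscale E a y) = cmod a * vdist E x y"
proof -
  have "vplus E (vscale E a x) (vscale E (-1) (vscale E a y)) =
      vscale E a (vplus E x (vscale E (-1) y))"
    by (rule vector_eqI)
      (simp_all add: assms plus_closed scale_closed inner_plus_left inner_scale_left algebra_simps)
  then show ?thesis using assms by (simp add: vdist_def vnorm_scale vdiff_closed)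
qed

lemma vdist_triangle:
  assumes "x \<in> vectors E" "y \<in> vectors E" "z \<in> vectors E"
  shows "vdist E x z \<le> vdist E x y + vdist E y z"
proof -
  have "vplus E x (vscale E (-1) z) =
      vplus E (vplus E x (vscale E (-1) y)) (vplus E y (vscale E (-1) z))"
    by (rule vector_eqI)
      (simp_all add: assms plus_closed scale_closed inner_plus_left inner_scale_left)
  then show ?thesis
    using vnorm_triangle[OF vdiff_closed[OF assms(1,2)] vdiff_closed[OF assms(2,3)]]
    by (simp add: vdist_def)
qed

lemma vdist_commute:
  assumes "x \<in> vectors E" "y \<in> vectors E"
  shows "vdist E x y = vdist E y x"
proof -
  have "vplus E x (vscale E (-1) y) = vscale E (-1) (vplus E y (vscale E (-1) x))"
    by (rule vector_eqI)
      (simp_all add: assms plus_closed scale_closed inner_plus_left inner_scale_left)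
  then show ?thesis using assms by (simp add: vdist_def vnorm_scale vdiff_closed)
qed

lemma vnorm_diff:
  assumes x: "x \<in> vectors E" and y: "y \<in> vectors E"
  shows "vnorm E x \<le> vnorm E y + vdist E x y"
proof -
  have "x = vplus E y (vplus E x (vscale E (-1) y))"
    by (rule vector_eqI)
      (simp_all add: assms plus_closed scale_closed inner_plus_left inner_scale_left)
  then show ?thesis
    using vnorm_triangle[OF y vdiff_closed[OF x y]] by (simp add: vdist_def)
qed

lemma tendsto_vnorm:
  assumes "\<And>n. \<sigma> n \<in> vectors E" "x \<in> vectors E" "(\<lambda>n. vdist E (\<sigma> n) x) \<longlonglongrightarrow> 0"
  shows "(\<lambda>n. vnorm E (\<sigma> n)) \<longlonglongrightarrow> vnorm E x"
proof -
  have "\<bar>vnorm E (\<sigma> n) - vnorm E x\<bar> \<le> vdist E (\<sigma> n) x" for n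
    using vnorm_diff[OF assms(1)[of n] assms(2)] vnorm_diff[OF assms(2) assms(1)[of n]]
      vdist_commute[OF assms(1)[of n] assms(2)] by linarith
  then have "(\<lambda>n. vnorm E (\<sigma> n) - vnorm E x) \<longlonglongrightarrow> 0"
    by (intro Lim_null_comparison[OF _ assms(3)]) simp
  then show ?thesis by (simp add: LIM_zero_iff)
qed

end

text \<open>
  Formal sums are lists of coefficients and points: addition is concatenation. They need not be reduced
  to a normal form, since only the vectors that they stand for matter.
\<close>

type_synonym 'p formal_sum = "(complex \<times> 'p) list"

definition lincomb :: "'v inner_space \<Rightarrow> ('p \<Rightarrow> 'v) \<Rightarrow> 'p formal_sum \<Rightarrow> 'v" where
  "lincomb E \<delta> u = foldr (\<lambda>(a, p) x. vplus E (vscale E a (\<delta> p)) x) u (vzero E)"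

definition formal_scale :: "complex \<Rightarrow> 'p formal_sum \<Rightarrow> 'p formal_sum" where
  "formal_scale a u = map (\<lambda>(b, p). (a * b, p)) u"

definition kernel_form ::
  "('p \<Rightarrow> 'p \<Rightarrow> complex) \<Rightarrow> 'p formal_sum \<Rightarrow> 'p formal_sum \<Rightarrow> complex" where
  "kernel_form k u v = (\<Sum>(a, p)\<leftarrow>u. \<Sum>(b, q)\<leftarrow>v. a * cnj b * k p q)"

lemma lincomb_simps [simp]:
  "lincomb E \<delta> [] = vzero E"
  "lincomb E \<delta> ((a, p) # u) = vplus E (vscale E a (\<delta> p)) (lincomb E \<delta> u)"
  by (simp_all add: lincomb_def)

lemma formal_scale_simps [simp]:
  "formal_scale a [] = []"
  "formal_scale a ((b, p) # u) = (a * b, p) # formal_scale a u"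
  by (simp_all add: formal_scale_def)

lemma kernel_form_Nil [simp]: "kernel_form k [] v = 0" "kernel_form k u [] = 0"
  by (simp_all add: kernel_form_def case_prod_unfold)

lemma kernel_form_Cons_left:
  "kernel_form k ((a, p) # u) v = a * (\<Sum>(b, q)\<leftarrow>v. cnj b * k p q) + kernel_form k u v"
  by (simp add: kernel_form_def case_prod_unfold sum_list_const_mult mult.assoc)

lemma kernel_form_append_left: "kernel_form k (u @ u') v = kernel_form k u v + kernel_form k u' v"
  by (simp add: kernel_form_def)

lemma kernel_form_append_right: "kernel_form k u (v @ v') = kernel_form k u v + kernel_form k u v'"
  by (induction u) (auto simp: kernel_form_Cons_left algebra_simps)

lemma kernel_form_scale_left: "kernel_form k (formal_scale a u) v = a * kernel_form k u v"
  by (induction u) (auto simp: kernel_form_Cons_left algebra_simps)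

lemma kernel_form_scale_right: "kernel_form k u (formal_scale a v) = cnj a * kernel_form k u v"
proof (induction v)
  case (Cons bq v)
  obtain b q where bq: "bq = (b, q)" by (cases bq)
  have "kernel_form k u [(a * b, q)] = cnj a * kernel_form k u [(b, q)]"
    by (induction u) (auto simp: kernel_form_Cons_left algebra_simps)
  then show ?case
    using Cons kernel_form_append_right[of k u "[(a * b, q)]" "formal_scale a v"]
      kernel_form_append_right[of k u "[(b, q)]" v]
    by (simp add: bq distrib_left)
qed simp

lemma kernel_form_add:
  "kernel_form (\<lambda>p q. k p q + l p q) u v = kernel_form k u v + kernel_form l u v"
proof -
  have "(\<Sum>(b, q)\<leftarrow>v. cnj b * (k p q + l p q)) =
      (\<Sum>(b, q)\<leftarrow>v. cnj b * k p q) + (\<Sum>(b, q)\<leftarrow>v. cnj b * l p q)" for p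
    by (induction v) (auto simp: algebra_simps)
  then show ?thesis by (induction u) (auto simp: kernel_form_Cons_left algebra_simps)
qed

lemma kernel_form_cmult: "kernel_form (\<lambda>p q. c * k p q) u v = c * kernel_form k u v"
proof -
  have "(\<Sum>(b, q)\<leftarrow>v. cnj b * (c * k p q)) = c * (\<Sum>(b, q)\<leftarrow>v. cnj b * k p q)" for p
    by (induction v) (auto simp: algebra_simps)
  then show ?thesis by (induction u) (auto simp: kernel_form_Cons_left algebra_simps)
qed

lemma kernel_form_diff:
  "kernel_form (\<lambda>p q. k p q - l p q) u v = kernel_form k u v - kernel_form l u v"
  using kernel_form_add[of k "\<lambda>p q. - 1 * l p q" u v] kernel_form_cmult[of "-1" l u v] by simp

context complex_hilbert_space
begin

context
  fixes \<delta> :: "'p \<Rightarrow> 'v"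
  assumes \<delta>: "\<And>p. \<delta> p \<in> vectors E"
begin

lemma lincomb_closed: "lincomb E \<delta> u \<in> vectors E"
  by (induction u) (auto simp: zero_closed plus_closed scale_closed \<delta>)

lemma lincomb_append: "lincomb E \<delta> (u @ v) = vplus E (lincomb E \<delta> u) (lincomb E \<delta> v)"
proof (induction u)
  case Nil
  then show ?case
    by (simp add: plus_commute[OF zero_closed lincomb_closed] plus_zero lincomb_closed)
qed (auto simp: plus_assoc lincomb_closed scale_closed \<delta>)

lemma lincomb_scale: "lincomb E \<delta> (formal_scale a u) = vscale E a (lincomb E \<delta> u)"
proof (induction u)
  case Nil
  then show ?case
    by (intro vector_eqI) (auto simp: zero_closed scale_closed inner_scale_left inner_zero_left)
qed (auto simp: scale_plus_right scale_scale lincomb_closed scale_closed \<delta>)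

lemma inner_lincomb:
  "vinner E (lincomb E \<delta> u) (lincomb E \<delta> v) = kernel_form (\<lambda>p q. vinner E (\<delta> p) (\<delta> q)) u v"
proof -
  have "vinner E (\<delta> p) (lincomb E \<delta> v) = (\<Sum>(b, q)\<leftarrow>v. cnj b * vinner E (\<delta> p) (\<delta> q))" for p
  proof (induction v)
    case Nil
    then show ?case
      using inner_cnj[OF zero_closed \<delta>[of p]] inner_zero_left[OF \<delta>] by simp
  qed (auto simp: inner_plus_right inner_scale_right lincomb_closed scale_closed \<delta>)
  then show ?thesis
    by (induction u) (auto simp: kernel_form_Cons_left inner_plus_left inner_scale_left
        inner_zero_left lincomb_closed scale_closed \<delta>)
qed

lemma vnorm_lincomb_le:
  assumes "\<And>p. vnorm E (\<delta> p) \<le> c"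
  shows "vnorm E (lincomb E \<delta> u) \<le> (\<Sum>(a, p)\<leftarrow>u. cmod a) * c"
proof (induction u)
  case (Cons ap u)
  obtain a p where ap: "ap = (a, p)" by (cases ap)
  have "vnorm E (lincomb E \<delta> (ap # u)) \<le> cmod a * vnorm E (\<delta> p) + vnorm E (lincomb E \<delta> u)"
    using vnorm_triangle[OF scale_closed[OF \<delta>] lincomb_closed, of a p u]
    by (simp add: ap vnorm_scale \<delta>)
  also have "\<dots> \<le> cmod a * c + (\<Sum>(a, p)\<leftarrow>u. cmod a) * c"
    using Cons assms[of p] by (intro add_mono mult_left_mono) auto
  finally show ?case by (simp add: ap algebra_simps)
qed (simp add: vnorm_zero)

end

end

lemma bounded_operator_lincomb:
  assumes "complex_hilbert_space E" and "complex_hilbert_space F"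
    and T: "T \<in> bounded_operators E F" and \<delta>: "\<And>p. \<delta> p \<in> vectors E"
  shows "T (lincomb E \<delta> u) = lincomb F (\<lambda>p. T (\<delta> p)) u"
proof -
  interpret E: complex_hilbert_space E by fact
  interpret F: complex_hilbert_space F by fact
  have T': "\<And>x. x \<in> vectors E \<Longrightarrow> T x \<in> vectors F"
      "\<And>x y. x \<in> vectors E \<Longrightarrow> y \<in> vectors E \<Longrightarrow> T (vplus E x y) = vplus F (T x) (T y)"
      "\<And>a x. x \<in> vectors E \<Longrightarrow> T (vscale E a x) = vscale F a (T x)"
    using T by (auto simp: bounded_operators_def)
  have "T (vzero E) = vzero F"
    using T'(3)[OF E.zero_closed, of 0] E.scale_zero[OF E.zero_closed]
      F.scale_zero[OF T'(1)[OF E.zero_closed]] by simp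
  then show ?thesis
    by (induction u) (auto simp: T' \<delta> E.lincomb_closed E.scale_closed)
qed

text \<open>
  The image of \<open>x\<close> is the limit of the combinations of \<open>\<gamma>\<close> along any combinations of \<open>\<delta>\<close> that
  approximate \<open>x\<close>. The norm estimate gives existence of the limit, by completeness of \<open>F\<close>, and shows
  that it does not depend on the approximation. In particular different formal sums for the same
  vector cause no problem.
\<close>

lemma operator_extension:
  assumes "complex_hilbert_space E" and "complex_hilbert_space F"
    and \<delta>: "\<And>p. \<delta> p \<in> vectors E" and \<gamma>: "\<And>p. \<gamma> p \<in> vectors F"
    and dense: "\<And>x. x \<in> vectors E \<Longrightarrow> \<exists>\<sigma>. (\<lambda>n. vdist E (lincomb E \<delta> (\<sigma> n)) x) \<longlonglongrightarrow> 0"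
    and c: "0 \<le> c"
    and bound: "\<And>u. vnorm F (lincomb F \<gamma> u) \<le> c * vnorm E (lincomb E \<delta> u)"
  shows "\<exists>T\<in>bounded_operators E F.
    (\<forall>x\<in>vectors E. vnorm F (T x) \<le> c * vnorm E x) \<and> (\<forall>p. T (\<delta> p) = \<gamma> p)"
proof -
  interpret E: complex_hilbert_space E by fact
  interpret F: complex_hilbert_space F by fact
  let ?e = "lincomb E \<delta>" and ?f = "lincomb F \<gamma>"
  define P where "P x y \<longleftrightarrow> x \<in> vectors E \<and> y \<in> vectors F \<and>
    (\<exists>\<sigma>. (\<lambda>n. vdist E (?e (\<sigma> n)) x) \<longlonglongrightarrow> 0 \<and> (\<lambda>n. vdist F (?f (\<sigma> n)) y) \<longlonglongrightarrow> 0)" for x y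
  have cl: "?e u \<in> vectors E" "?f u \<in> vectors F" for u
    using E.lincomb_closed[of \<delta>] F.lincomb_closed[of \<gamma>] \<delta> \<gamma> by auto
  have ap: "?e (u @ v) = vplus E (?e u) (?e v)" "?f (u @ v) = vplus F (?f u) (?f v)" for u v
    using E.lincomb_append[of \<delta>] F.lincomb_append[of \<gamma>] \<delta> \<gamma> by auto
  have sc: "?e (formal_scale a u) = vscale E a (?e u)" "?f (formal_scale a u) = vscale F a (?f u)" for a u
    using E.lincomb_scale[of \<delta>] F.lincomb_scale[of \<gamma>] \<delta> \<gamma> by auto
  have dist: "vdist F (?f u) (?f v) \<le> c * vdist E (?e u) (?e v)" for u v
    using bound[of "u @ formal_scale (-1) v"] by (simp add: vdist_def ap sc)
  have P_plus: "P (vplus E x x') (vplus F y y')" if "P x y" "P x' y'" for x y x' y'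
  proof -
    obtain \<sigma> \<sigma>' where s: "(\<lambda>n. vdist E (?e (\<sigma> n)) x) \<longlonglongrightarrow> 0" "(\<lambda>n. vdist F (?f (\<sigma> n)) y) \<longlonglongrightarrow> 0"
        "(\<lambda>n. vdist E (?e (\<sigma>' n)) x') \<longlonglongrightarrow> 0" "(\<lambda>n. vdist F (?f (\<sigma>' n)) y') \<longlonglongrightarrow> 0"
      and v: "x \<in> vectors E" "y \<in> vectors F" "x' \<in> vectors E" "y' \<in> vectors F"
      using \<open>P x y\<close> \<open>P x' y'\<close> unfolding P_def by blast
    have "(\<lambda>n. vdist E (?e (\<sigma> n @ \<sigma>' n)) (vplus E x x')) \<longlonglongrightarrow> 0"
      unfolding ap by (rule E.tendsto_vdist_plus[OF cl(1) v(1) cl(1) v(3) s(1,3)])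
    moreover have "(\<lambda>n. vdist F (?f (\<sigma> n @ \<sigma>' n)) (vplus F y y')) \<longlonglongrightarrow> 0"
      unfolding ap by (rule F.tendsto_vdist_plus[OF cl(2) v(2) cl(2) v(4) s(2,4)])
    ultimately show ?thesis
      unfolding P_def using v by (intro conjI exI[of _ "\<lambda>n. \<sigma> n @ \<sigma>' n"] E.plus_closed F.plus_closed)
  qed
  have P_scale: "P (vscale E a x) (vscale F a y)" if "P x y" for a x y
  proof -
    obtain \<sigma> where s: "(\<lambda>n. vdist E (?e (\<sigma> n)) x) \<longlonglongrightarrow> 0" "(\<lambda>n. vdist F (?f (\<sigma> n)) y) \<longlonglongrightarrow> 0"
      and v: "x \<in> vectors E" "y \<in> vectors F"
      using \<open>P x y\<close> unfolding P_def by blast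
    have "(\<lambda>n. vdist E (?e (formal_scale a (\<sigma> n))) (vscale E a x)) \<longlonglongrightarrow> 0"
        "(\<lambda>n. vdist F (?f (formal_scale a (\<sigma> n))) (vscale F a y)) \<longlonglongrightarrow> 0"
      unfolding sc E.vdist_scale[OF cl(1) v(1)] F.vdist_scale[OF cl(2) v(2)]
      by (intro tendsto_mult_right_zero s)+
    then show ?thesis
      unfolding P_def using v
      by (intro conjI exI[of _ "\<lambda>n. formal_scale a (\<sigma> n)"] E.scale_closed F.scale_closed)
  qed
  have P_bound: "vnorm F y \<le> c * vnorm E x" if "P x y" for x y
  proof -
    obtain \<sigma> where s: "(\<lambda>n. vdist E (?e (\<sigma> n)) x) \<longlonglongrightarrow> 0" "(\<lambda>n. vdist F (?f (\<sigma> n)) y) \<longlonglongrightarrow> 0"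
      and v: "x \<in> vectors E" "y \<in> vectors F"
      using \<open>P x y\<close> unfolding P_def by blast
    have "(\<lambda>n. vnorm F (?f (\<sigma> n))) \<longlonglongrightarrow> vnorm F y" "(\<lambda>n. c * vnorm E (?e (\<sigma> n))) \<longlonglongrightarrow> c * vnorm E x"
      using F.tendsto_vnorm[OF cl(2) v(2) s(2)] E.tendsto_vnorm[OF cl(1) v(1) s(1)]
      by (auto intro: tendsto_intros)
    then show ?thesis by (rule LIMSEQ_le) (use bound in auto)
  qed
  have P_unique: "y = y'" if "P x y" "P x y'" for x y y'
  proof -
    have v: "x \<in> vectors E" "y \<in> vectors F" "y' \<in> vectors F" using that by (auto simp: P_def)
    have "P (vplus E x (vscale E (-1) x)) (vplus F y (vscale F (-1) y'))"
      by (intro P_plus P_scale that)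
    from P_bound[OF this] have "vnorm F (vplus F y (vscale F (-1) y')) \<le> 0"
      using v by (simp add: E.plus_neg E.vnorm_zero)
    then have "vnorm F (vplus F y (vscale F (-1) y')) = 0"
      using F.vnorm_nonneg[OF F.vdiff_closed[OF v(2,3)]] by simp
    then show ?thesis
      by (rule F.vdiff_eq_zero[OF v(2,3) F.vnorm_eq_zero[OF F.vdiff_closed[OF v(2,3)]]])
  qed
  have P_ex: "\<exists>y. P x y" if x: "x \<in> vectors E" for x
  proof -
    obtain \<sigma> where s: "(\<lambda>n. vdist E (?e (\<sigma> n)) x) \<longlonglongrightarrow> 0" using dense[OF x] by blast
    have "\<forall>e>0. \<exists>N. \<forall>m\<ge>N. \<forall>n\<ge>N. vdist F (?f (\<sigma> m)) (?f (\<sigma> n)) < e"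
    proof (intro allI impI)
      fix e :: real assume e: "e > 0"
      define e' where "e' = e / (2 * (c + 1))"
      have e': "e' > 0" using e c by (simp add: e'_def)
      obtain N where N: "\<And>n. n \<ge> N \<Longrightarrow> vdist E (?e (\<sigma> n)) x < e'"
        using LIMSEQ_D[OF s e'] E.vdist_nonneg[OF cl(1) x] by auto
      have "vdist F (?f (\<sigma> m)) (?f (\<sigma> n)) < e" if mn: "m \<ge> N" "n \<ge> N" for m n
      proof -
        have "vdist F (?f (\<sigma> m)) (?f (\<sigma> n)) \<le> c * vdist E (?e (\<sigma> m)) (?e (\<sigma> n))" by (rule dist)
        also have "\<dots> \<le> c * (2 * e')"
          using E.vdist_triangle[OF cl(1)[of "\<sigma> m"] x cl(1)[of "\<sigma> n"]] N[OF mn(1)] N[OF mn(2)]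
            E.vdist_commute[OF x cl(1)[of "\<sigma> n"]] c by (intro mult_left_mono) auto
        also have "\<dots> < (c + 1) * (2 * e')" using e' by simp
        also have "\<dots> = e" using c by (simp add: e'_def field_simps)
        finally show ?thesis .
      qed
      then show "\<exists>N. \<forall>m\<ge>N. \<forall>n\<ge>N. vdist F (?f (\<sigma> m)) (?f (\<sigma> n)) < e" by blast
    qed
    then obtain y where "y \<in> vectors F" "(\<lambda>n. vdist F (?f (\<sigma> n)) y) \<longlonglongrightarrow> 0"
      using F.complete[of "\<lambda>n. ?f (\<sigma> n)"] cl(2) by blast
    then show ?thesis using s x unfolding P_def by blast
  qed
  define T where "T x = (SOME y. P x y)" for x
  have T: "P x (T x)" if "x \<in> vectors E" for x
    unfolding T_def using P_ex[OF that] by (rule someI_ex)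
  have T_eq: "T x = y" if "P x y" for x y
    using P_unique[OF T that] that unfolding P_def by blast
  have "P (\<delta> p) (\<gamma> p)" for p
  proof -
    have "?e [(1, p)] = \<delta> p" "?f [(1, p)] = \<gamma> p"
      using \<delta> \<gamma> by (auto simp: E.scale_one F.scale_one E.plus_zero F.plus_zero)
    then show ?thesis
      unfolding P_def using \<delta> \<gamma>
      by (intro conjI exI[of _ "\<lambda>_. [(1, p)]"]) (simp_all add: E.vdist_self F.vdist_self del: lincomb_simps)
  qed
  then have "\<forall>p. T (\<delta> p) = \<gamma> p" using T_eq by blast
  moreover have "\<forall>x\<in>vectors E. vnorm F (T x) \<le> c * vnorm E x" using T P_bound by blast
  moreover from this have "T \<in> bounded_operators E F"
    unfolding bounded_operators_def
    using T_eq[OF P_plus[OF T T]] T_eq[OF P_scale[OF T]] T[unfolded P_def] by blast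
  ultimately show ?thesis by blast
qed


section \<open>Positive semidefinite kernels\<close>

locale psd_kernel =
  fixes k :: "'p \<Rightarrow> 'p \<Rightarrow> complex"
  assumes hermitian: "k q p = cnj (k p q)"
    and form_nonneg: "0 \<le> Re (kernel_form k u u)"
begin

definition seminorm :: "'p formal_sum \<Rightarrow> real" where
  "seminorm u = sqrt (Re (kernel_form k u u))"

lemma form_cnj: "kernel_form k v u = cnj (kernel_form k u v)"
proof (induction u)
  case (Cons ap u)
  obtain a p where ap: "ap = (a, p)" by (cases ap)
  have "kernel_form k v [(a, p)] = cnj (kernel_form k [(a, p)] v)"
    by (induction v) (auto simp: kernel_form_Cons_left hermitian[of p] algebra_simps)
  then show ?case
    using Cons kernel_form_append_right[of k v "[(a, p)]" u] kernel_form_append_left[of k "[(a, p)]" u v]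
    by (simp add: ap)
qed simp

lemma form_self: "kernel_form k u u = complex_of_real ((seminorm u)\<^sup>2)"
  using form_cnj[of u u] form_nonneg[of u] by (simp add: seminorm_def complex_eq_iff)

lemma seminorm_nonneg: "0 \<le> seminorm u"
  by (simp add: seminorm_def form_nonneg)

text \<open>
  The form may vanish on nonzero formal sums. The usual argument divides by the square of the seminorm
  of \<open>v\<close>; here a positive \<open>e\<close> is added to it, and \<open>e\<close> tends to \<open>0\<close> at the end.
\<close>

lemma form_Cauchy_Schwarz: "cmod (kernel_form k u v) \<le> seminorm u * seminorm v"
proof -
  define b where "b = kernel_form k u v"
  have key: "(cmod b)\<^sup>2 \<le> ((seminorm v)\<^sup>2 + e) * (seminorm u)\<^sup>2" if e: "e > 0" for e
  proof -
    define r where "r = 1 / ((seminorm v)\<^sup>2 + e)"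
    have pos: "(seminorm v)\<^sup>2 + e > 0" using e by (simp add: add_nonneg_pos)
    then have r: "r > 0" "r * ((seminorm v)\<^sup>2 + e) = 1" by (simp_all add: r_def)
    \<comment> \<open>This would be the component of \<open>u\<close> orthogonal to \<open>v\<close> if \<open>e\<close> were \<open>0\<close>.\<close>
    define w where "w = u @ formal_scale (- (complex_of_real r * b)) v"
    have "kernel_form k w w = kernel_form k u u - 2 * (r * (b * cnj b)) + r * r * (b * cnj b) * kernel_form k v v"
      unfolding w_def by (simp add: kernel_form_append_left kernel_form_append_right
          kernel_form_scale_left kernel_form_scale_right form_cnj[of v u] b_def[symmetric] algebra_simps)
    also have "\<dots> = complex_of_real ((seminorm u)\<^sup>2 - 2 * r * (cmod b)\<^sup>2 + r * (r * (seminorm v)\<^sup>2) * (cmod b)\<^sup>2)"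
      using complex_norm_square[of b] by (simp add: form_self mult_ac)
    finally have "0 \<le> (seminorm u)\<^sup>2 - 2 * r * (cmod b)\<^sup>2 + r * (r * (seminorm v)\<^sup>2) * (cmod b)\<^sup>2"
      using form_nonneg[of w] by simp
    moreover have "r * (r * (seminorm v)\<^sup>2) * (cmod b)\<^sup>2 \<le> r * 1 * (cmod b)\<^sup>2"
    proof (intro mult_right_mono mult_left_mono)
      have "r * e > 0" using r e by simp
      then show "r * (seminorm v)\<^sup>2 \<le> 1" using r(2) by (simp add: distrib_left)
    qed (use r in auto)
    ultimately have "r * (cmod b)\<^sup>2 \<le> (seminorm u)\<^sup>2" by simp
    then show ?thesis using pos by (simp add: r_def field_simps)
  qed
  have "(cmod b)\<^sup>2 \<le> (seminorm v)\<^sup>2 * (seminorm u)\<^sup>2"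
  proof (rule tendsto_lowerbound)
    show "((\<lambda>e. ((seminorm v)\<^sup>2 + e) * (seminorm u)\<^sup>2) \<longlongrightarrow> (seminorm v)\<^sup>2 * (seminorm u)\<^sup>2) (at_right 0)"
      by (auto intro!: tendsto_eq_intros)
    show "\<forall>\<^sub>F e in at_right 0. (cmod b)\<^sup>2 \<le> ((seminorm v)\<^sup>2 + e) * (seminorm u)\<^sup>2"
      using key by (auto simp: eventually_at_filter)
  qed simp
  then have "(cmod b)\<^sup>2 \<le> (seminorm u * seminorm v)\<^sup>2" by (simp add: power_mult_distrib mult.commute)
  then show ?thesis
    unfolding b_def by (rule power2_le_imp_le) (simp add: seminorm_nonneg)
qed

end

lemma psd_kernel_gram:
  assumes "complex_hilbert_space E" and \<delta>: "\<And>p. \<delta> p \<in> vectors E"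
  shows "psd_kernel (\<lambda>p q. vinner E (\<delta> p) (\<delta> q))"
proof -
  interpret complex_hilbert_space E by fact
  show ?thesis
  proof
    show "vinner E (\<delta> q) (\<delta> p) = cnj (vinner E (\<delta> p) (\<delta> q))" for p q
      by (rule inner_cnj[OF \<delta> \<delta>])
    show "0 \<le> Re (kernel_form (\<lambda>p q. vinner E (\<delta> p) (\<delta> q)) u u)" for u
      using inner_nonneg[OF lincomb_closed[where u = u, OF \<delta>]] by (simp add: inner_lincomb[OF \<delta>])
  qed
qed

lemma psd_kernel_add:
  assumes "psd_kernel k" "psd_kernel l"
  shows "psd_kernel (\<lambda>p q. k p q + l p q)"
proof
  show "k q p + l q p = cnj (k p q + l p q)" for p q
    using psd_kernel.hermitian[OF assms(1), of q p] psd_kernel.hermitian[OF assms(2), of q p] by simp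
  show "0 \<le> Re (kernel_form (\<lambda>p q. k p q + l p q) u u)" for u
    using psd_kernel.form_nonneg[OF assms(1)] psd_kernel.form_nonneg[OF assms(2)]
    by (simp add: kernel_form_add)
qed

lemma psd_kernel_scale:
  assumes "psd_kernel k" "0 \<le> c"
  shows "psd_kernel (\<lambda>p q. complex_of_real c * k p q)"
proof
  show "c * k q p = cnj (c * k p q)" for p q
    using psd_kernel.hermitian[OF assms(1), of q p] by simp
  show "0 \<le> Re (kernel_form (\<lambda>p q. complex_of_real c * k p q) u u)" for u
    using psd_kernel.form_nonneg[OF assms(1)] assms(2)
    by (simp add: kernel_form_cmult)
qed

text \<open>
  Cholesky decomposition: the kernel is diminished by a kernel of rank one so that it vanishes on the
  row and the column of one point, and positivity of the remainder, which is the Schur complement, is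
  the Cauchy-Schwarz inequality.
\<close>

lemma kernel_decomposition:
  assumes "psd_kernel k" "finite A"
  shows "\<exists>fs :: ('p \<Rightarrow> complex) list. \<forall>p\<in>A. \<forall>q\<in>A. k p q = (\<Sum>f\<leftarrow>fs. f p * cnj (f q))"
  using assms(2,1)
proof (induction A arbitrary: k rule: finite_induct)
  case (insert x A)
  interpret psd_kernel k by fact
  \<comment> \<open>If \<open>k x x = 0\<close> then the quotient is \<open>0\<close> and \<open>l = k\<close>, which has the desired
    zeros by the Cauchy-Schwarz inequality.\<close>
  define l where "l p q = k p q - k p x * cnj (k q x) / k x x" for p q
  have kxx: "k x x = complex_of_real (Re (k x x))"
    using hermitian[of x x] by (simp add: complex_eq_iff)
  have form_x: "kernel_form k u [(1, x)] = (\<Sum>(a, p)\<leftarrow>u. a * k p x)" for u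
    by (simp add: kernel_form_def case_prod_unfold)
  have norm_x: "(seminorm [(1, x)])\<^sup>2 = Re (k x x)"
    using form_nonneg[of "[(1, x)]"] by (simp add: seminorm_def kernel_form_def)
  have xx0: "0 \<le> Re (k x x)" using norm_x by (metis zero_le_power2)
  have zero: "k p x = 0" if "k x x = 0" for p
    using form_Cauchy_Schwarz[of "[(1, p)]" "[(1, x)]"] norm_x that by (simp add: form_x)
  have "psd_kernel l"
  proof
    show "l q p = cnj (l p q)" for p q
      using hermitian[of q p] hermitian[of x x] by (simp add: l_def mult.commute)
    fix u
    have "kernel_form (\<lambda>p q. k p x * cnj (k q x)) u u = kernel_form k u [(1, x)] * cnj (kernel_form k u [(1, x)])"
    proof -
      have *: "(\<Sum>(b, q)\<leftarrow>v. cnj b * (k p x * cnj (k q x))) = k p x * cnj (\<Sum>(b, q)\<leftarrow>v. b * k q x)" for p v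
        by (induction v) (auto simp: algebra_simps)
      have "kernel_form (\<lambda>p q. k p x * cnj (k q x)) u v = kernel_form k u [(1, x)] * cnj (kernel_form k v [(1, x)])" for v
        unfolding form_x by (induction u) (auto simp: kernel_form_Cons_left * algebra_simps)
      then show ?thesis .
    qed
    also have "\<dots> = complex_of_real ((cmod (kernel_form k u [(1, x)]))\<^sup>2)"
      by (simp only: complex_norm_square)
    finally have sq: "kernel_form (\<lambda>p q. k p x * cnj (k q x)) u u =
      complex_of_real ((cmod (kernel_form k u [(1, x)]))\<^sup>2)" .
    have "l = (\<lambda>p q. k p q - inverse (k x x) * (k p x * cnj (k q x)))"
      by (simp add: l_def fun_eq_iff divide_inverse mult.commute)
    then have "kernel_form l u u = kernel_form k u u -
        inverse (k x x) * complex_of_real ((cmod (kernel_form k u [(1, x)]))\<^sup>2)"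
      by (simp only: kernel_form_diff kernel_form_cmult sq)
    also have "\<dots> = complex_of_real ((seminorm u)\<^sup>2 - (cmod (kernel_form k u [(1, x)]))\<^sup>2 / Re (k x x))"
      unfolding form_self by (subst kxx) (simp add: divide_inverse mult.commute)
    finally have "kernel_form l u u = \<dots>" .
    moreover have "(cmod (kernel_form k u [(1, x)]))\<^sup>2 / Re (k x x) \<le> (seminorm u)\<^sup>2"
    proof -
      have "(cmod (kernel_form k u [(1, x)]))\<^sup>2 \<le> (seminorm u * seminorm [(1, x)])\<^sup>2"
        by (intro power_mono form_Cauchy_Schwarz) auto
      then show ?thesis
        using xx0 by (auto simp: power_mult_distrib norm_x divide_simps mult.commute)
    qed
    ultimately show "0 \<le> Re (kernel_form l u u)" by simp
  qed
  then obtain fs where fs: "\<And>p q. p \<in> A \<Longrightarrow> q \<in> A \<Longrightarrow> l p q = (\<Sum>f\<leftarrow>fs. f p * cnj (f q))"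
    using insert.IH by blast
  define gs where "gs = (\<lambda>p. k p x / sqrt (Re (k x x))) # map (\<lambda>f. f(x := 0)) fs"
  have lx: "l p x = 0" "l x p = 0" for p
    using zero[of p] hermitian[of x p] hermitian[of x x] by (auto simp: l_def)
  have l_sum: "l p q = (\<Sum>f\<leftarrow>map (\<lambda>f. f(x := 0)) fs. f p * cnj (f q))" if "p \<in> insert x A" "q \<in> insert x A" for p q
  proof (cases "p = x \<or> q = x")
    case True
    then show ?thesis by (induction fs) (auto simp: lx)
  next
    case False
    then show ?thesis using that fs[of p q] by (simp add: o_def)
  qed
  have k_l: "k p q = k p x / sqrt (Re (k x x)) * cnj (k q x / sqrt (Re (k x x))) + l p q" for p q
  proof -
    have "complex_of_real (sqrt (Re (k x x))) * complex_of_real (sqrt (Re (k x x))) = k x x"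
      using xx0 kxx by (simp only: flip: of_real_mult) simp
    then show ?thesis by (simp only: l_def complex_cnj_divide complex_cnj_complex_of_real times_divide_times_eq) simp
  qed
  have "\<forall>p\<in>insert x A. \<forall>q\<in>insert x A. k p q = (\<Sum>f\<leftarrow>gs. f p * cnj (f q))"
  proof (intro ballI)
    fix p q assume "p \<in> insert x A" "q \<in> insert x A"
    then show "k p q = (\<Sum>f\<leftarrow>gs. f p * cnj (f q))"
      by (subst k_l, subst l_sum) (simp_all only: gs_def list.map sum_list.Cons)
  qed
  then show ?case by blast
qed simp

text \<open>
  The Schur product theorem. If \<open>k p q\<close> is \<open>f p * cnj (f q)\<close>, then the form of the product at a formal
  sum is the form of \<open>l\<close> at the sum with coefficients multiplied by \<open>f\<close>; in general \<open>k\<close> is a sum of such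
  kernels on the finitely many points that occur.
\<close>

lemma psd_kernel_mult:
  assumes "psd_kernel k" "psd_kernel l"
  shows "psd_kernel (\<lambda>p q. k p q * l p q)"
proof
  show "k q p * l q p = cnj (k p q * l p q)" for p q
    using psd_kernel.hermitian[OF assms(1), of q p] psd_kernel.hermitian[OF assms(2), of q p] by simp
  fix u :: "'a formal_sum"
  obtain fs where fs: "\<And>p q. p \<in> snd ` set u \<Longrightarrow> q \<in> snd ` set u \<Longrightarrow> k p q = (\<Sum>f\<leftarrow>fs. f p * cnj (f q))"
    using kernel_decomposition[OF assms(1), of "snd ` set u"] by auto
  have fs': "k p q = (\<Sum>f\<leftarrow>fs. f p * cnj (f q))" if "(a, p) \<in> set u" "(b, q) \<in> set u" for a b p q
    using that by (intro fs) force+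
  define m where "m f v = map (\<lambda>(a, p). (a * f p, p)) v" for f :: "'a \<Rightarrow> complex" and v
  have m: "kernel_form (\<lambda>p q. f p * cnj (f q) * l p q) u' v = kernel_form l (m f u') (m f v)" for f u' v
    by (simp add: kernel_form_def m_def o_def case_prod_unfold mult_ac)
  have "kernel_form (\<lambda>p q. k p q * l p q) u u = kernel_form (\<lambda>p q. (\<Sum>f\<leftarrow>fs. f p * cnj (f q)) * l p q) u u"
    unfolding kernel_form_def by (auto intro!: arg_cong[where f = sum_list] map_cong simp: fs')
  also have "\<dots> = (\<Sum>f\<leftarrow>fs. kernel_form l (m f u) (m f u))"
  proof (induction fs)
    case Nil
    then show ?case by (simp add: kernel_form_def case_prod_unfold)
  next
    case (Cons f fs)
    then show ?case
      using kernel_form_add[of "\<lambda>p q. f p * cnj (f q) * l p q" "\<lambda>p q. (\<Sum>f\<leftarrow>fs. f p * cnj (f q)) * l p q" u u]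
      by (simp add: m distrib_right)
  qed
  finally have "kernel_form (\<lambda>p q. k p q * l p q) u u = (\<Sum>f\<leftarrow>fs. kernel_form l (m f u) (m f u))" .
  moreover have "0 \<le> Re (\<Sum>f\<leftarrow>gs. kernel_form l (m f u) (m f u))" for gs
    by (induction gs) (auto simp: psd_kernel.form_nonneg[OF assms(2)])
  ultimately show "0 \<le> Re (kernel_form (\<lambda>p q. k p q * l p q) u u)" by simp
qed

lemma psd_kernel_comp:
  assumes "psd_kernel k"
  shows "psd_kernel (\<lambda>p q. k (f p) (f q))"
proof
  show "k (f q) (f p) = cnj (k (f p) (f q))" for p q
    by (rule psd_kernel.hermitian[OF assms])
  have "kernel_form (\<lambda>p q. k (f p) (f q)) u v = kernel_form k (map (apsnd f) u) (map (apsnd f) v)" for u v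
    by (simp add: kernel_form_def o_def case_prod_unfold)
  then show "0 \<le> Re (kernel_form (\<lambda>p q. k (f p) (f q)) u u)" for u
    by (simp add: psd_kernel.form_nonneg[OF assms])
qed


section \<open>The Hilbert space of a positive semidefinite kernel\<close>

context psd_kernel
begin

abbreviation form :: "'p formal_sum \<Rightarrow> 'p formal_sum \<Rightarrow> complex" where
  "form \<equiv> kernel_form k"

abbreviation formal_diff :: "'p formal_sum \<Rightarrow> 'p formal_sum \<Rightarrow> 'p formal_sum" where
  "formal_diff u v \<equiv> u @ formal_scale (-1) v"

lemma form_diff_left: "form (formal_diff u v) w = form u w - form v w"
  by (simp add: kernel_form_append_left kernel_form_scale_left)

lemma form_diff_right: "form w (formal_diff u v) = form w u - form w v"
  by (simp add: kernel_form_append_right kernel_form_scale_right)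

text \<open>
  The seminorm is the norm of the functional that the form defines. Through this, the triangle
  inequalities below follow from additivity of the form.
\<close>

lemma seminorm_leI:
  assumes "\<And>w. cmod (form u w) \<le> r * seminorm w" "0 \<le> r"
  shows "seminorm u \<le> r"
proof (cases "seminorm u = 0")
  case False
  then have pos: "seminorm u > 0" using seminorm_nonneg[of u] by simp
  have "(seminorm u)\<^sup>2 \<le> r * seminorm u"
    using assms(1)[of u] by (simp add: form_self norm_power)
  then show ?thesis using pos by (simp add: power2_eq_square)
qed (use assms in simp)

lemma seminorm_diff_triangle:
  "seminorm (formal_diff u w) \<le> seminorm (formal_diff u v) + seminorm (formal_diff v w)"
proof (rule seminorm_leI)
  fix x
  have "form (formal_diff u w) x = form (formal_diff u v) x + form (formal_diff v w) x"
    by (simp add: form_diff_left)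
  then show "cmod (form (formal_diff u w) x) \<le>
      (seminorm (formal_diff u v) + seminorm (formal_diff v w)) * seminorm x"
    using form_Cauchy_Schwarz[of "formal_diff u v" x] form_Cauchy_Schwarz[of "formal_diff v w" x]
      norm_triangle_ineq[of "form (formal_diff u v) x" "form (formal_diff v w) x"]
    by (simp add: distrib_right)
qed (simp add: seminorm_nonneg)

lemma seminorm_diff_commute: "seminorm (formal_diff u v) = seminorm (formal_diff v u)"
  by (simp add: seminorm_def form_diff_left form_diff_right algebra_simps)

lemma seminorm_diff_add:
  "seminorm (formal_diff (u @ u') (v @ v')) \<le> seminorm (formal_diff u v) + seminorm (formal_diff u' v')"
proof (rule seminorm_leI)
  fix x
  have "form (formal_diff (u @ u') (v @ v')) x =
      form (formal_diff u v) x + form (formal_diff u' v') x"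
    by (simp add: form_diff_left kernel_form_append_left kernel_form_scale_left)
  then show "cmod (form (formal_diff (u @ u') (v @ v')) x) \<le>
      (seminorm (formal_diff u v) + seminorm (formal_diff u' v')) * seminorm x"
    using form_Cauchy_Schwarz[of "formal_diff u v" x] form_Cauchy_Schwarz[of "formal_diff u' v'" x]
      norm_triangle_ineq[of "form (formal_diff u v) x" "form (formal_diff u' v') x"]
    by (simp add: distrib_right)
qed (simp add: seminorm_nonneg)

lemma seminorm_diff_scale:
  "seminorm (formal_diff (formal_scale a u) (formal_scale a v)) \<le> cmod a * seminorm (formal_diff u v)"
proof (rule seminorm_leI)
  fix x
  have "form (formal_diff (formal_scale a u) (formal_scale a v)) x = a * form (formal_diff u v) x"
    by (simp add: form_diff_left kernel_form_append_left kernel_form_scale_left algebra_simps)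
  then show "cmod (form (formal_diff (formal_scale a u) (formal_scale a v)) x) \<le>
      cmod a * seminorm (formal_diff u v) * seminorm x"
    using mult_left_mono[OF form_Cauchy_Schwarz[of "formal_diff u v" x], of "cmod a"]
    by (simp add: norm_mult mult.assoc)
qed (simp add: seminorm_nonneg)

definition Cauchy_sums :: "(nat \<Rightarrow> 'p formal_sum) \<Rightarrow> bool" where
  "Cauchy_sums \<sigma> \<longleftrightarrow> (\<forall>e>0. \<exists>M. \<forall>m\<ge>M. \<forall>n\<ge>M. seminorm (formal_diff (\<sigma> m) (\<sigma> n)) < e)"

text \<open>
  A vector of the completion is the function \<open>w \<mapsto> lim \<langle>\<sigma> n, w\<rangle>\<close> on formal sums, for a Cauchy
  sequence \<open>\<sigma>\<close>. No quotient is needed, and the axioms of a vector space hold because addition and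
  scaling of functions are pointwise.
\<close>

definition represents ::
  "(nat \<Rightarrow> 'p formal_sum) \<Rightarrow> ('p formal_sum \<Rightarrow> complex) \<Rightarrow> bool" where
  "represents \<sigma> f \<longleftrightarrow> Cauchy_sums \<sigma> \<and> (\<forall>w. (\<lambda>n. form (\<sigma> n) w) \<longlonglongrightarrow> f w)"

lemma Cauchy_sums_const: "Cauchy_sums (\<lambda>_. u)"
proof -
  have "seminorm (formal_diff u u) = 0" by (simp add: seminorm_def form_diff_left)
  then show ?thesis by (simp add: Cauchy_sums_def)
qed

lemma Cauchy_sums_add:
  assumes "Cauchy_sums \<sigma>" "Cauchy_sums \<tau>"
  shows "Cauchy_sums (\<lambda>n. \<sigma> n @ \<tau> n)"
  unfolding Cauchy_sums_def
proof (intro allI impI)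
  fix e :: real assume "e > 0"
  then have "e / 2 > 0" by simp
  then obtain M1 M2 where M: "\<And>m n. m \<ge> M1 \<Longrightarrow> n \<ge> M1 \<Longrightarrow> seminorm (formal_diff (\<sigma> m) (\<sigma> n)) < e / 2"
      "\<And>m n. m \<ge> M2 \<Longrightarrow> n \<ge> M2 \<Longrightarrow> seminorm (formal_diff (\<tau> m) (\<tau> n)) < e / 2"
    using assms unfolding Cauchy_sums_def by metis
  have "seminorm (formal_diff (\<sigma> m @ \<tau> m) (\<sigma> n @ \<tau> n)) < e" if "m \<ge> max M1 M2" "n \<ge> max M1 M2" for m n
    using seminorm_diff_add[of "\<sigma> m" "\<tau> m" "\<sigma> n" "\<tau> n"] M(1)[of m n] M(2)[of m n] that by simp
  then show "\<exists>M. \<forall>m\<ge>M. \<forall>n\<ge>M. seminorm (formal_diff (\<sigma> m @ \<tau> m) (\<sigma> n @ \<tau> n)) < e" by blast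
qed

lemma Cauchy_sums_scale:
  assumes "Cauchy_sums \<sigma>"
  shows "Cauchy_sums (\<lambda>n. formal_scale a (\<sigma> n))"
  unfolding Cauchy_sums_def
proof (intro allI impI)
  fix e :: real assume e: "e > 0"
  define e' where "e' = e / (cmod a + 1)"
  have pos: "cmod a + 1 > 0" by (simp add: add_nonneg_pos)
  then have "e' > 0" using e by (simp add: e'_def)
  then obtain M where M: "\<And>m n. m \<ge> M \<Longrightarrow> n \<ge> M \<Longrightarrow> seminorm (formal_diff (\<sigma> m) (\<sigma> n)) < e'"
    using assms unfolding Cauchy_sums_def by metis
  have "seminorm (formal_diff (formal_scale a (\<sigma> m)) (formal_scale a (\<sigma> n))) < e" if "m \<ge> M" "n \<ge> M" for m n
  proof -
    have "seminorm (formal_diff (formal_scale a (\<sigma> m)) (formal_scale a (\<sigma> n))) \<le> cmod a * e'"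
      using seminorm_diff_scale[of a "\<sigma> m" "\<sigma> n"] M[OF that] by (meson less_imp_le mult_left_mono norm_ge_zero order_trans)
    also have "\<dots> < (cmod a + 1) * e'" using \<open>e' > 0\<close> by simp
    also have "\<dots> = e" using pos by (simp add: e'_def)
    finally show ?thesis .
  qed
  then show "\<exists>M. \<forall>m\<ge>M. \<forall>n\<ge>M. seminorm (formal_diff (formal_scale a (\<sigma> m)) (formal_scale a (\<sigma> n))) < e" by blast
qed

lemma Cauchy_sums_bounded:
  assumes "Cauchy_sums \<sigma>"
  shows "\<exists>M>0. \<exists>n0. \<forall>n\<ge>n0. seminorm (\<sigma> n) \<le> M"
proof -
  obtain n0 where n0: "\<And>m n. m \<ge> n0 \<Longrightarrow> n \<ge> n0 \<Longrightarrow> seminorm (formal_diff (\<sigma> m) (\<sigma> n)) < 1"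
    using assms unfolding Cauchy_sums_def by (metis zero_less_one)
  have "seminorm (\<sigma> n) \<le> 1 + seminorm (\<sigma> n0)" if "n \<ge> n0" for n
    using n0[OF that order_refl] seminorm_diff_triangle[of "\<sigma> n" "[]" "\<sigma> n0"] by simp
  moreover have "0 < 1 + seminorm (\<sigma> n0)" using seminorm_nonneg[of "\<sigma> n0"] by simp
  ultimately show ?thesis by blast
qed

lemma convergent_form:
  assumes \<sigma>: "Cauchy_sums \<sigma>" and \<tau>: "Cauchy_sums \<tau>"
  shows "convergent (\<lambda>n. form (\<sigma> n) (\<tau> n))"
proof (rule Cauchy_convergent, rule metric_CauchyI)
  fix e :: real assume e: "e > 0"
  obtain M1 n1 where M1: "M1 > 0" "\<And>n. n \<ge> n1 \<Longrightarrow> seminorm (\<sigma> n) \<le> M1" using Cauchy_sums_bounded[OF \<sigma>] by blast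
  obtain M2 n2 where M2: "M2 > 0" "\<And>n. n \<ge> n2 \<Longrightarrow> seminorm (\<tau> n) \<le> M2" using Cauchy_sums_bounded[OF \<tau>] by blast
  have "e / (2 * M2) > 0" "e / (2 * M1) > 0" using e M1(1) M2(1) by auto
  then obtain m1 m2 where m: "\<And>m n. m \<ge> m1 \<Longrightarrow> n \<ge> m1 \<Longrightarrow> seminorm (formal_diff (\<sigma> m) (\<sigma> n)) < e / (2 * M2)"
      "\<And>m n. m \<ge> m2 \<Longrightarrow> n \<ge> m2 \<Longrightarrow> seminorm (formal_diff (\<tau> m) (\<tau> n)) < e / (2 * M1)"
    using \<sigma> \<tau> unfolding Cauchy_sums_def by metis
  define N where "N = Max {n1, n2, m1, m2}"
  have N: "n1 \<le> N" "n2 \<le> N" "m1 \<le> N" "m2 \<le> N" by (auto simp: N_def)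
  have "dist (form (\<sigma> m) (\<tau> m)) (form (\<sigma> n) (\<tau> n)) < e" if mn: "m \<ge> N" "n \<ge> N" for m n
  proof -
    have "form (\<sigma> m) (\<tau> m) - form (\<sigma> n) (\<tau> n) =
        form (formal_diff (\<sigma> m) (\<sigma> n)) (\<tau> m) + form (\<sigma> n) (formal_diff (\<tau> m) (\<tau> n))"
      by (simp add: form_diff_left form_diff_right)
    then have "dist (form (\<sigma> m) (\<tau> m)) (form (\<sigma> n) (\<tau> n)) \<le>
        seminorm (formal_diff (\<sigma> m) (\<sigma> n)) * seminorm (\<tau> m) + seminorm (\<sigma> n) * seminorm (formal_diff (\<tau> m) (\<tau> n))"
      using norm_triangle_ineq[of "form (formal_diff (\<sigma> m) (\<sigma> n)) (\<tau> m)" "form (\<sigma> n) (formal_diff (\<tau> m) (\<tau> n))"]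
        form_Cauchy_Schwarz[of "formal_diff (\<sigma> m) (\<sigma> n)" "\<tau> m"]
        form_Cauchy_Schwarz[of "\<sigma> n" "formal_diff (\<tau> m) (\<tau> n)"]
      by (simp add: dist_norm)
    also have "\<dots> \<le> seminorm (formal_diff (\<sigma> m) (\<sigma> n)) * M2 + M1 * seminorm (formal_diff (\<tau> m) (\<tau> n))"
      using M1 M2 mn N by (intro add_mono mult_left_mono mult_right_mono) (auto simp: seminorm_nonneg)
    also have "\<dots> < e / (2 * M2) * M2 + M1 * (e / (2 * M1))"
      using m mn N M1(1) M2(1) by (intro add_strict_mono mult_strict_left_mono mult_strict_right_mono) auto
    also have "\<dots> = e" using M1(1) M2(1) by simp
    finally show ?thesis .
  qed
  then show "\<exists>M. \<forall>m\<ge>M. \<forall>n\<ge>M. dist (form (\<sigma> m) (\<tau> m)) (form (\<sigma> n) (\<tau> n)) < e" by blast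
qed

lemma represents_exists: "Cauchy_sums \<sigma> \<Longrightarrow> \<exists>f. represents \<sigma> f"
proof -
  assume \<sigma>: "Cauchy_sums \<sigma>"
  have "(\<lambda>n. form (\<sigma> n) w) \<longlonglongrightarrow> lim (\<lambda>n. form (\<sigma> n) w)" for w
    using convergent_form[OF \<sigma> Cauchy_sums_const] by (simp add: convergent_LIMSEQ_iff)
  then have "represents \<sigma> (\<lambda>w. lim (\<lambda>n. form (\<sigma> n) w))"
    using \<sigma> by (simp add: represents_def)
  then show ?thesis by blast
qed

text \<open>
  The limit of \<open>\<langle>\<sigma> n, \<tau> n\<rangle>\<close> is determined by \<open>\<tau>\<close> and the function that \<open>\<sigma>\<close> represents.
\<close>

lemma tendsto_represented:
  assumes \<sigma>: "represents \<sigma> f" and \<tau>: "Cauchy_sums \<tau>"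
    and c: "(\<lambda>n. form (\<sigma> n) (\<tau> n)) \<longlonglongrightarrow> c"
  shows "(\<lambda>m. f (\<tau> m)) \<longlonglongrightarrow> c"
proof (rule LIMSEQ_I)
  fix e :: real assume e: "e > 0"
  obtain M n0 where M: "M > 0" "\<And>n. n \<ge> n0 \<Longrightarrow> seminorm (\<sigma> n) \<le> M"
    using Cauchy_sums_bounded \<sigma> unfolding represents_def by blast
  have "e / (2 * M) > 0" using e M(1) by simp
  then obtain N where N: "\<And>m n. m \<ge> N \<Longrightarrow> n \<ge> N \<Longrightarrow> seminorm (formal_diff (\<tau> m) (\<tau> n)) < e / (2 * M)"
    using \<tau> unfolding Cauchy_sums_def by metis
  have "norm (f (\<tau> m) - c) < e" if m: "m \<ge> N" for m
  proof -
    have "(\<lambda>n. norm (form (\<sigma> n) (\<tau> m) - form (\<sigma> n) (\<tau> n))) \<longlonglongrightarrow> norm (f (\<tau> m) - c)"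
      using \<sigma> c by (intro tendsto_intros) (auto simp: represents_def)
    moreover have "norm (form (\<sigma> n) (\<tau> m) - form (\<sigma> n) (\<tau> n)) \<le> e / 2"
      if n: "n \<ge> max n0 N" for n
    proof -
      have "norm (form (\<sigma> n) (\<tau> m) - form (\<sigma> n) (\<tau> n)) \<le>
          seminorm (\<sigma> n) * seminorm (formal_diff (\<tau> m) (\<tau> n))"
        using form_Cauchy_Schwarz[of "\<sigma> n" "formal_diff (\<tau> m) (\<tau> n)"] by (simp add: form_diff_right)
      also have "\<dots> \<le> M * (e / (2 * M))"
        using M n N[OF m, of n] by (intro mult_mono) (auto simp: seminorm_nonneg)
      also have "\<dots> = e / 2" using M(1) by simp
      finally show ?thesis .
    qed
    ultimately have "norm (f (\<tau> m) - c) \<le> e / 2"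
      by (intro LIMSEQ_le_const2) blast+
    then show ?thesis using e by simp
  qed
  then show "\<exists>N. \<forall>m\<ge>N. norm (f (\<tau> m) - c) < e" by blast
qed

text \<open>
  By \<open>tendsto_represented\<close> and its conjugate, the two sequences can be exchanged one after the other.
\<close>

lemma represented_form_unique:
  assumes "represents \<sigma> f" "represents \<sigma>' f" "represents \<tau> g" "represents \<tau>' g"
    and c: "(\<lambda>n. form (\<sigma> n) (\<tau> n)) \<longlonglongrightarrow> c"
  shows "(\<lambda>n. form (\<sigma>' n) (\<tau>' n)) \<longlonglongrightarrow> c"
proof -
  have C: "Cauchy_sums \<sigma>" "Cauchy_sums \<sigma>'" "Cauchy_sums \<tau>" "Cauchy_sums \<tau>'"
    using assms by (auto simp: represents_def)
  obtain c1 where c1: "(\<lambda>n. form (\<sigma>' n) (\<tau> n)) \<longlonglongrightarrow> c1"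
    using convergent_form[OF C(2,3)] by (auto simp: convergent_def)
  have "c1 = c"
    using LIMSEQ_unique tendsto_represented[OF assms(1) C(3) c] tendsto_represented[OF assms(2) C(3) c1] by blast
  obtain c2 where c2: "(\<lambda>n. form (\<sigma>' n) (\<tau>' n)) \<longlonglongrightarrow> c2"
    using convergent_form[OF C(2,4)] by (auto simp: convergent_def)
  have "(\<lambda>n. form (\<tau> n) (\<sigma>' n)) \<longlonglongrightarrow> cnj c1" "(\<lambda>n. form (\<tau>' n) (\<sigma>' n)) \<longlonglongrightarrow> cnj c2"
    using tendsto_cnj[OF c1] tendsto_cnj[OF c2] by (simp_all flip: form_cnj)
  then have "cnj c1 = cnj c2"
    using LIMSEQ_unique tendsto_represented[OF assms(3) C(2)] tendsto_represented[OF assms(4) C(2)] by blast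
  then show ?thesis using c2 \<open>c1 = c\<close> by simp
qed

definition limit_form :: "('p formal_sum \<Rightarrow> complex) \<Rightarrow> ('p formal_sum \<Rightarrow> complex) \<Rightarrow> complex" where
  "limit_form f g =
     lim (\<lambda>n. form ((SOME \<sigma>. represents \<sigma> f) n) ((SOME \<tau>. represents \<tau> g) n))"

lemma limit_form:
  assumes "represents \<sigma> f" "represents \<tau> g"
  shows "(\<lambda>n. form (\<sigma> n) (\<tau> n)) \<longlonglongrightarrow> limit_form f g"
proof -
  have r: "represents (SOME \<sigma>. represents \<sigma> f) f" "represents (SOME \<tau>. represents \<tau> g) g"
    using someI[of "\<lambda>\<sigma>. represents \<sigma> f"] someI[of "\<lambda>\<tau>. represents \<tau> g"] assms by auto
  then have "(\<lambda>n. form ((SOME \<sigma>. represents \<sigma> f) n) ((SOME \<tau>. represents \<tau> g) n)) \<longlonglongrightarrow> limit_form f g"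
    unfolding limit_form_def convergent_LIMSEQ_iff[symmetric]
    using convergent_form by (auto simp: represents_def)
  then show ?thesis by (rule represented_form_unique[OF r(1) assms(1) r(2) assms(2)])
qed

lemma represents_const: "represents (\<lambda>_. u) (form u)"
  by (simp add: represents_def Cauchy_sums_const)

lemma represents_add:
  "represents \<sigma> f \<Longrightarrow> represents \<tau> g \<Longrightarrow> represents (\<lambda>n. \<sigma> n @ \<tau> n) (\<lambda>w. f w + g w)"
  by (auto simp: represents_def Cauchy_sums_add kernel_form_append_left intro!: tendsto_add)

lemma represents_scale: "represents \<sigma> f \<Longrightarrow> represents (\<lambda>n. formal_scale a (\<sigma> n)) (\<lambda>w. a * f w)"
  by (auto simp: represents_def Cauchy_sums_scale kernel_form_scale_left intro!: tendsto_mult_left)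

text \<open>
  The summand \<open>Inr\<close> of the sum type leaves \<open>Inl\<close> for the space of scalars, so that both can occur in one
  factorization.
\<close>

definition hilbert_completion :: "(complex + ('p formal_sum \<Rightarrow> complex)) inner_space" where
  "hilbert_completion = \<lparr>vectors = Inr ` {f. \<exists>\<sigma>. represents \<sigma> f},
     vzero = Inr (\<lambda>_. 0),
     vplus = (\<lambda>x y. Inr (\<lambda>w. projr x w + projr y w)),
     vscale = (\<lambda>a x. Inr (\<lambda>w. a * projr x w)),
     vinner = (\<lambda>x y. limit_form (projr x) (projr y))\<rparr>"

definition point :: "'p \<Rightarrow> complex + ('p formal_sum \<Rightarrow> complex)" where
  "point p = Inr (form [(1, p)])"

lemma completion_simps [simp]:
  "Inr f \<in> vectors hilbert_completion \<longleftrightarrow> (\<exists>\<sigma>. represents \<sigma> f)"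
  "vzero hilbert_completion = Inr (\<lambda>_. 0)"
  "vplus hilbert_completion (Inr f) (Inr g) = Inr (\<lambda>w. f w + g w)"
  "vscale hilbert_completion a (Inr f) = Inr (\<lambda>w. a * f w)"
  "vinner hilbert_completion (Inr f) (Inr g) = limit_form f g"
  by (auto simp: hilbert_completion_def)

lemma completion_vectorE:
  assumes "x \<in> vectors hilbert_completion"
  obtains f \<sigma> where "x = Inr f" "represents \<sigma> f"
  using assms by (auto simp: hilbert_completion_def)

lemma seminorm_tendsto_vdist:
  assumes \<sigma>: "represents \<sigma> f" and \<tau>: "represents \<tau> g"
  shows "(\<lambda>n. seminorm (formal_diff (\<sigma> n) (\<tau> n))) \<longlonglongrightarrow> vdist hilbert_completion (Inr f) (Inr g)"
proof -
  have r: "represents (\<lambda>n. formal_diff (\<sigma> n) (\<tau> n)) (\<lambda>w. f w + - 1 * g w)"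
    by (intro represents_add represents_scale \<sigma> \<tau>)
  show ?thesis
    unfolding vdist_def vnorm_def seminorm_def
    using limit_form[OF r r] by (auto intro!: tendsto_real_sqrt tendsto_Re)
qed

lemma vdist_completion_triangle:
  assumes "x \<in> vectors hilbert_completion" "y \<in> vectors hilbert_completion" "z \<in> vectors hilbert_completion"
  shows "vdist hilbert_completion x z \<le> vdist hilbert_completion x y + vdist hilbert_completion y z"
proof -
  obtain f \<sigma> g \<tau> h \<rho> where r: "x = Inr f" "y = Inr g" "z = Inr h" and
    s: "represents \<sigma> f" "represents \<tau> g" "represents \<rho> h"
    using assms completion_vectorE by metis
  show ?thesis
    unfolding r
    by (rule LIMSEQ_le[OF seminorm_tendsto_vdist[OF s(1,3)]
          tendsto_add[OF seminorm_tendsto_vdist[OF s(1,2)] seminorm_tendsto_vdist[OF s(2,3)]]])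
      (auto intro: seminorm_diff_triangle)
qed

lemma vdist_completion_commute:
  assumes "x \<in> vectors hilbert_completion" "y \<in> vectors hilbert_completion"
  shows "vdist hilbert_completion x y = vdist hilbert_completion y x"
proof -
  obtain f \<sigma> g \<tau> where r: "x = Inr f" "y = Inr g" and s: "represents \<sigma> f" "represents \<tau> g"
    using assms completion_vectorE by metis
  show ?thesis
    unfolding r using seminorm_tendsto_vdist[OF s(1,2)] seminorm_tendsto_vdist[OF s(2,1)] LIMSEQ_unique
    by (subst (asm) seminorm_diff_commute) blast
qed

lemma vdist_represents:
  assumes "represents \<sigma> f"
  shows "(\<lambda>m. vdist hilbert_completion (Inr (form (\<sigma> m))) (Inr f)) \<longlonglongrightarrow> 0"
proof (rule LIMSEQ_I)
  fix e :: real assume "e > 0"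
  then obtain N where N: "\<And>m n. m \<ge> N \<Longrightarrow> n \<ge> N \<Longrightarrow> seminorm (formal_diff (\<sigma> m) (\<sigma> n)) < e / 2"
    using assms unfolding represents_def Cauchy_sums_def by (meson half_gt_zero)
  have "norm (vdist hilbert_completion (Inr (form (\<sigma> m))) (Inr f) - 0) < e" if m: "m \<ge> N" for m
  proof -
    note lim = seminorm_tendsto_vdist[OF represents_const assms, of "\<sigma> m"]
    have "vdist hilbert_completion (Inr (form (\<sigma> m))) (Inr f) \<le> e / 2"
      by (rule LIMSEQ_le_const2[OF lim]) (use N[OF m] in \<open>auto intro: less_imp_le\<close>)
    moreover have "0 \<le> vdist hilbert_completion (Inr (form (\<sigma> m))) (Inr f)"
      by (rule LIMSEQ_le_const[OF lim]) (auto simp: seminorm_nonneg)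
    ultimately show ?thesis using \<open>e > 0\<close> by simp
  qed
  then show "\<exists>N. \<forall>m\<ge>N. norm (vdist hilbert_completion (Inr (form (\<sigma> m))) (Inr f) - 0) < e" by blast
qed

text \<open>
  For completeness, the \<open>n\<close>th vector of a Cauchy sequence is replaced by a formal sum at distance less
  than \<open>1 / (n + 1)\<close>; these formal sums represent the limit.
\<close>

lemma completion_hilbert: "complex_hilbert_space hilbert_completion"
proof
  show "vzero hilbert_completion \<in> vectors hilbert_completion"
  proof -
    have "form [] = (\<lambda>_. 0)" by (simp add: fun_eq_iff)
    then show ?thesis using represents_const[of "[]"] by auto
  qed
next
  fix x y assume "x \<in> vectors hilbert_completion" "y \<in> vectors hilbert_completion"
  then show "vplus hilbert_completion x y \<in> vectors hilbert_completion"
    by (elim completion_vectorE) (auto intro: represents_add)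
next
  fix x a assume "x \<in> vectors hilbert_completion"
  then show "vscale hilbert_completion a x \<in> vectors hilbert_completion"
    by (elim completion_vectorE) (auto intro: represents_scale)
next
  fix x y z assume "x \<in> vectors hilbert_completion" "y \<in> vectors hilbert_completion" "z \<in> vectors hilbert_completion"
  then obtain f \<sigma> g \<tau> h \<rho> where r: "x = Inr f" "y = Inr g" "z = Inr h" and
    s: "represents \<sigma> f" "represents \<tau> g" "represents \<rho> h"
    using completion_vectorE by metis
  show "vplus hilbert_completion (vplus hilbert_completion x y) z = vplus hilbert_completion x (vplus hilbert_completion y z)"
    by (simp add: r add.assoc)
  have "(\<lambda>n. form (\<sigma> n @ \<tau> n) (\<rho> n)) \<longlonglongrightarrow> limit_form (\<lambda>w. f w + g w) h"
    by (intro limit_form represents_add s)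
  moreover have "(\<lambda>n. form (\<sigma> n @ \<tau> n) (\<rho> n)) \<longlonglongrightarrow> limit_form f h + limit_form g h"
    unfolding kernel_form_append_left by (intro tendsto_add limit_form s)
  ultimately show "vinner hilbert_completion (vplus hilbert_completion x y) z = vinner hilbert_completion x z + vinner hilbert_completion y z"
    using LIMSEQ_unique by (simp add: r) blast
next
  fix x y a assume "x \<in> vectors hilbert_completion" "y \<in> vectors hilbert_completion"
  then obtain f \<sigma> g \<tau> where r: "x = Inr f" "y = Inr g" and s: "represents \<sigma> f" "represents \<tau> g"
    using completion_vectorE by metis
  show "vplus hilbert_completion x y = vplus hilbert_completion y x" by (simp add: r add.commute)
  show "vscale hilbert_completion a (vplus hilbert_completion x y) = vplus hilbert_completion (vscale hilbert_completion a x) (vscale hilbert_completion a y)"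
    by (simp add: r distrib_left)
  have "(\<lambda>n. form (formal_scale a (\<sigma> n)) (\<tau> n)) \<longlonglongrightarrow> limit_form (\<lambda>w. a * f w) g"
    by (intro limit_form represents_scale s)
  moreover have "(\<lambda>n. form (formal_scale a (\<sigma> n)) (\<tau> n)) \<longlonglongrightarrow> a * limit_form f g"
    unfolding kernel_form_scale_left by (intro tendsto_mult_left limit_form s)
  ultimately show "vinner hilbert_completion (vscale hilbert_completion a x) y = a * vinner hilbert_completion x y"
    using LIMSEQ_unique by (simp add: r) blast
  have "(\<lambda>n. form (\<tau> n) (\<sigma> n)) \<longlonglongrightarrow> cnj (limit_form f g)"
    using tendsto_cnj[OF limit_form[OF s]] by (simp flip: form_cnj)
  then show "vinner hilbert_completion y x = cnj (vinner hilbert_completion x y)"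
    using LIMSEQ_unique[OF limit_form[OF s(2,1)]] by (simp add: r)
next
  fix x a b assume "x \<in> vectors hilbert_completion"
  then obtain f \<sigma> where r: "x = Inr f" and s: "represents \<sigma> f"
    using completion_vectorE by metis
  show "vplus hilbert_completion x (vzero hilbert_completion) = x" "vplus hilbert_completion x (vscale hilbert_completion (-1) x) = vzero hilbert_completion"
    "vscale hilbert_completion a (vscale hilbert_completion b x) = vscale hilbert_completion (a * b) x" "vscale hilbert_completion 1 x = x"
    "vscale hilbert_completion (a + b) x = vplus hilbert_completion (vscale hilbert_completion a x) (vscale hilbert_completion b x)"
    by (simp_all add: r algebra_simps)
  show "0 \<le> Re (vinner hilbert_completion x x)"
    unfolding r completion_simps
    by (rule LIMSEQ_le_const[OF tendsto_Re[OF limit_form[OF s s]]]) (auto simp: form_nonneg)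
  assume "vinner hilbert_completion x x = 0"
  then have "(\<lambda>n. Re (form (\<sigma> n) (\<sigma> n))) \<longlonglongrightarrow> 0"
    using tendsto_Re[OF limit_form[OF s s]] by (simp add: r)
  then have lim: "(\<lambda>n. seminorm (\<sigma> n)) \<longlonglongrightarrow> 0"
    unfolding seminorm_def using tendsto_real_sqrt by fastforce
  have "f w = 0" for w
  proof -
    have "(\<lambda>n. form (\<sigma> n) w) \<longlonglongrightarrow> 0"
      by (rule Lim_null_comparison[OF _ tendsto_mult_left_zero[OF lim, of "seminorm w"]])
        (simp add: form_Cauchy_Schwarz)
    then show ?thesis using s LIMSEQ_unique unfolding represents_def by blast
  qed
  then show "x = vzero hilbert_completion" by (simp add: r fun_eq_iff)
next
  fix F :: "nat \<Rightarrow> complex + ('p formal_sum \<Rightarrow> complex)"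
  assume F: "\<forall>n. F n \<in> vectors hilbert_completion"
    and C: "\<forall>e>0. \<exists>N. \<forall>m\<ge>N. \<forall>n\<ge>N. vdist hilbert_completion (F m) (F n) < e"
  let ?i = "\<lambda>u. Inr (form u)"
  have i: "?i u \<in> vectors hilbert_completion" for u using represents_const by auto
  have "\<exists>u. vdist hilbert_completion (F n) (?i u) < 1 / Suc n" for n
  proof -
    obtain f \<sigma> where f: "F n = Inr f" "represents \<sigma> f" using F completion_vectorE by metis
    have "\<exists>m. \<forall>l\<ge>m. norm (vdist hilbert_completion (?i (\<sigma> l)) (Inr f) - 0) < 1 / Suc n"
      by (rule LIMSEQ_D[OF vdist_represents[OF f(2)]]) simp
    then obtain m where "norm (vdist hilbert_completion (?i (\<sigma> m)) (Inr f) - 0) < 1 / Suc n" by blast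
    then have "vdist hilbert_completion (?i (\<sigma> m)) (Inr f) < 1 / Suc n" by simp
    moreover have "vdist hilbert_completion (F n) (?i (\<sigma> m)) = vdist hilbert_completion (?i (\<sigma> m)) (F n)"
      using F i by (intro vdist_completion_commute) blast+
    ultimately show ?thesis
      using f(1) by (intro exI[of _ "\<sigma> m"]) simp
  qed
  then obtain u where u: "\<And>n. vdist hilbert_completion (F n) (?i (u n)) < 1 / Suc n" by metis
  have dist_i: "vdist hilbert_completion (?i v) (?i w) = seminorm (formal_diff v w)" for v w
    using LIMSEQ_unique[OF seminorm_tendsto_vdist[OF represents_const represents_const, of v w] tendsto_const]
    by simp
  have inv: "\<exists>N. \<forall>n\<ge>N. 1 / Suc n < e" if e: "e > 0" for e :: real
  proof -
    obtain N where "1 / Suc N < e" using nat_approx_posE[OF e] by blast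
    moreover have "1 / Suc n \<le> 1 / Suc N" if "n \<ge> N" for n using that by (simp add: frac_le)
    ultimately show ?thesis by (meson le_less_trans)
  qed
  have "Cauchy_sums u"
    unfolding Cauchy_sums_def
  proof (intro allI impI)
    fix e :: real assume e: "e > 0"
    obtain N1 where N1: "\<And>n. n \<ge> N1 \<Longrightarrow> 1 / Suc n < e / 3" using inv[of "e / 3"] e by auto
    obtain N2 where N2: "\<And>m n. m \<ge> N2 \<Longrightarrow> n \<ge> N2 \<Longrightarrow> vdist hilbert_completion (F m) (F n) < e / 3"
      using C[rule_format, of "e / 3"] e by auto
    have "seminorm (formal_diff (u m) (u n)) < e" if mn: "m \<ge> max N1 N2" "n \<ge> max N1 N2" for m n
    proof -
      have "vdist hilbert_completion (?i (u m)) (?i (u n)) \<le> vdist hilbert_completion (?i (u m)) (F m) + vdist hilbert_completion (F m) (?i (u n))"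
        using F i by (intro vdist_completion_triangle) blast+
      moreover have "vdist hilbert_completion (F m) (?i (u n)) \<le> vdist hilbert_completion (F m) (F n) + vdist hilbert_completion (F n) (?i (u n))"
        using F i by (intro vdist_completion_triangle) blast+
      moreover have "vdist hilbert_completion (?i (u m)) (F m) = vdist hilbert_completion (F m) (?i (u m))"
        using F i by (intro vdist_completion_commute) blast+
      moreover have "m \<ge> N1" "m \<ge> N2" "n \<ge> N1" "n \<ge> N2" using mn by auto
      ultimately show ?thesis
        using u[of m] u[of n] N1[of m] N1[of n] N2[of m n] dist_i[of "u m" "u n"] by linarith
    qed
    then show "\<exists>M. \<forall>m\<ge>M. \<forall>n\<ge>M. seminorm (formal_diff (u m) (u n)) < e" by blast
  qed
  then obtain f where f: "represents u f" using represents_exists by blast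
  have "(\<lambda>n. vdist hilbert_completion (F n) (Inr f)) \<longlonglongrightarrow> 0"
  proof (rule LIMSEQ_I)
    fix e :: real assume e: "e > 0"
    obtain N1 where N1: "\<And>n. n \<ge> N1 \<Longrightarrow> 1 / Suc n < e / 2" using inv[of "e / 2"] e by auto
    obtain N2 where N2: "\<And>n. n \<ge> N2 \<Longrightarrow> norm (vdist hilbert_completion (?i (u n)) (Inr f) - 0) < e / 2"
      using LIMSEQ_D[OF vdist_represents[OF f], of "e / 2"] e by auto
    have "norm (vdist hilbert_completion (F n) (Inr f) - 0) < e" if n: "n \<ge> max N1 N2" for n
    proof -
      have "vdist hilbert_completion (F n) (Inr f) \<le> vdist hilbert_completion (F n) (?i (u n)) + vdist hilbert_completion (?i (u n)) (Inr f)"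
        using F i f by (intro vdist_completion_triangle) auto
      moreover have "0 \<le> vdist hilbert_completion (F n) (Inr f)"
      proof -
        obtain g \<sigma> where g: "F n = Inr g" "represents \<sigma> g" using F completion_vectorE by metis
        show ?thesis
          unfolding g(1) by (rule LIMSEQ_le_const[OF seminorm_tendsto_vdist[OF g(2) f]]) (auto simp: seminorm_nonneg)
      qed
      ultimately show ?thesis using u[of n] N1[of n] N2[of n] n by simp
    qed
    then show "\<exists>N. \<forall>n\<ge>N. norm (vdist hilbert_completion (F n) (Inr f) - 0) < e" by blast
  qed
  moreover have "Inr f \<in> vectors hilbert_completion" using f by auto
  ultimately show "\<exists>x\<in>vectors hilbert_completion. (\<lambda>n. vdist hilbert_completion (F n) x) \<longlonglongrightarrow> 0" by blast
qed

lemma point_closed: "point p \<in> vectors hilbert_completion"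
  using represents_const by (auto simp: point_def)

lemma inner_point: "vinner hilbert_completion (point p) (point q) = k p q"
proof -
  have "limit_form (form [(1, p)]) (form [(1, q)]) = form [(1, p)] [(1, q)]"
    by (rule LIMSEQ_unique[OF limit_form[OF represents_const represents_const] tendsto_const])
  then show ?thesis by (simp add: point_def kernel_form_def)
qed

lemma lincomb_point: "lincomb hilbert_completion point u = Inr (form u)"
proof (induction u)
  case (Cons ap u)
  then show ?case
    by (cases ap) (simp add: point_def fun_eq_iff kernel_form_Cons_left)
qed (simp add: fun_eq_iff)

lemma points_dense:
  assumes "x \<in> vectors hilbert_completion"
  shows "\<exists>\<sigma>. (\<lambda>n. vdist hilbert_completion (lincomb hilbert_completion point (\<sigma> n)) x) \<longlonglongrightarrow> 0"
  using assms by (elim completion_vectorE) (auto simp: lincomb_point intro: vdist_represents)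

end


section \<open>Operations on factorizations\<close>

lemma Md_imp_Cb: "\<phi> \<in> Md d \<Longrightarrow> \<phi> \<in> Cb"
  by (simp add: Md_def)

lemma Cb_bound:
  assumes "\<phi> \<in> Cb"
  obtains B where "\<And>t. cmod (\<phi> t) \<le> B"
  using assms by (auto simp: Cb_def bounded_iff)

lemma Cb_measurable: "\<phi> \<in> Cb \<Longrightarrow> \<phi> \<in> borel_measurable borel"
  by (simp add: Cb_def borel_measurable_continuous_onI)

lemma scalars_simps [simp]:
  "vectors scalars = range Inl" "vzero scalars = Inl 0"
  "vplus scalars (Inl a) (Inl b) = Inl (a + b)" "vscale scalars z (Inl a) = Inl (z * a)"
  "vinner scalars (Inl a) (Inl b) = a * cnj b"
  by (simp_all add: scalars_def)

lemma vnorm_scalars [simp]: "vnorm scalars (Inl a) = cmod a"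
  by (simp add: vnorm_def cmod_def power2_eq_square)

lemma vdist_scalars [simp]: "vdist scalars (Inl a) (Inl b) = dist a b"
  by (simp add: vdist_def dist_norm)

lemma scalars_hilbert: "complex_hilbert_space scalars"
proof
  fix \<sigma> :: "nat \<Rightarrow> complex + 'w"
  assume 1: "\<forall>n. \<sigma> n \<in> vectors scalars" and C: "\<forall>e>0. \<exists>N. \<forall>m\<ge>N. \<forall>n\<ge>N. vdist scalars (\<sigma> m) (\<sigma> n) < e"
  have "\<forall>n. \<exists>a. \<sigma> n = Inl a" using 1 by auto
  then obtain a where a: "\<And>n. \<sigma> n = Inl (a n)" by metis
  have "Cauchy a" using C by (simp add: a Cauchy_def)
  then obtain x where "a \<longlonglongrightarrow> x" using Cauchy_convergent convergent_def by blast
  then show "\<exists>x\<in>vectors scalars. (\<lambda>n. vdist scalars (\<sigma> n) x) \<longlonglongrightarrow> 0"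
    using tendsto_dist_iff[of a x] by (auto simp: a)
qed (auto simp: algebra_simps)

lemma lincomb_scalars: "lincomb scalars (\<lambda>p. Inl (f p)) u = Inl (\<Sum>(a, p)\<leftarrow>u. a * f p)"
  by (induction u) auto

lemma operator_norm_le:
  assumes "complex_hilbert_space E" "0 \<le> c"
    and "\<And>x. x \<in> vectors E \<Longrightarrow> vnorm F (T x) \<le> c * vnorm E x"
  shows "operator_norm E F T \<le> c"
proof -
  interpret complex_hilbert_space E by fact
  show ?thesis
    unfolding operator_norm_def
  proof (rule cSUP_least)
    show "vectors E \<noteq> {}" using zero_closed by blast
    show "vnorm F (T x) / vnorm E x \<le> c" if x: "x \<in> vectors E" for x
      using assms(2) assms(3)[OF x] vnorm_nonneg[OF x]
      by (cases "vnorm E x = 0") (auto simp: pos_divide_le_eq)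
  qed
qed

lemma vnorm_operator_le:
  assumes "complex_hilbert_space E" "complex_hilbert_space F" "T \<in> bounded_operators E F"
    and x: "x \<in> vectors E"
  shows "vnorm F (T x) \<le> operator_norm E F T * vnorm E x"
proof -
  interpret complex_hilbert_space E by fact
  obtain c where c: "vnorm F (T x) \<le> c * vnorm E x"
    using assms(3) x unfolding bounded_operators_def by blast
  show ?thesis
  proof (cases "vnorm E x = 0")
    case False
    then have "vnorm E x > 0" using vnorm_nonneg[OF x] by simp
    moreover have "vnorm F (T x) / vnorm E x \<le> operator_norm E F T"
      unfolding operator_norm_def
      by (intro cSUP_upper operator_norm_bdd assms)
    ultimately show ?thesis by (simp add: pos_divide_le_eq)
  qed (use c in simp)
qed

text \<open>
  In a factorization through \<open>H\<close>, this is a vector of \<open>H i\<close>, and it depends only on the entries of \<open>t\<close>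
  beyond \<open>i\<close>. These vectors span the part of \<open>H i\<close> that the multiplier sees.
\<close>

definition orbit ::
  "nat \<Rightarrow> (nat \<Rightarrow> 'g \<Rightarrow> complex + 'w \<Rightarrow> complex + 'w) \<Rightarrow> nat \<Rightarrow> (nat \<Rightarrow> 'g) \<Rightarrow> complex + 'w" where
  "orbit d \<xi> i t = foldr (\<lambda>j. \<xi> j (t j)) [Suc i..<Suc d] (Inl 1)"

lemma orbit_top [simp]: "orbit d \<xi> d t = Inl 1"
  by (simp add: orbit_def)

lemma orbit_step: "i \<in> {1..d} \<Longrightarrow> orbit d \<xi> (i - Suc 0) t = \<xi> i (t i) (orbit d \<xi> i t)"
  by (simp add: orbit_def upt_conv_Cons del: upt_Suc)

lemma orbit_upd [simp]: "orbit d \<xi> i (t(i := s)) = orbit d \<xi> i t"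
  unfolding orbit_def by (intro foldr_cong) auto

lemma down_induct [consumes 1, case_names top step]:
  assumes "(i::nat) \<le> d" "P d" "\<And>i. i \<in> {1..d} \<Longrightarrow> P i \<Longrightarrow> P (i - 1)"
  shows "P i"
  using assms(1)
proof (induction rule: inc_induct)
  case (step n)
  then show ?case using assms(3)[of "Suc n"] by simp
qed fact

text \<open>
  In contrast to \<^const>\<open>Md_factorization\<close>, the suprema of operator norms are replaced by given upper
  bounds \<open>c i\<close>. Norm estimates for multipliers then reduce to estimates for single vectors.
\<close>

locale bounded_factorization =
  fixes d :: nat and c :: "nat \<Rightarrow> real" and \<phi> :: "'g::group_add \<Rightarrow> complex"
    and H :: "nat \<Rightarrow> (complex + 'w) inner_space"
    and \<xi> :: "nat \<Rightarrow> 'g \<Rightarrow> complex + 'w \<Rightarrow> complex + 'w"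
  assumes hilbert: "i \<le> d \<Longrightarrow> complex_hilbert_space (H i)"
    and H_0: "H 0 = scalars" and H_d: "H d = scalars"
    and op: "i \<in> {1..d} \<Longrightarrow> \<xi> i t \<in> bounded_operators (H i) (H (i - 1))"
    and op_bound: "i \<in> {1..d} \<Longrightarrow> x \<in> vectors (H i) \<Longrightarrow> vnorm (H (i - 1)) (\<xi> i t x) \<le> c i * vnorm (H i) x"
    and c_nonneg: "i \<in> {1..d} \<Longrightarrow> 0 \<le> c i"
    and factors: "orbit d \<xi> 0 w = Inl (\<phi> (sum_list (map w [1..<Suc d])))"
begin

lemma orbit_closed: "i \<le> d \<Longrightarrow> orbit d \<xi> i t \<in> vectors (H i)"
proof (induction rule: down_induct)
  case top
  then show ?case by (simp add: H_d)
next
  case (step i)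
  then show ?case using op[of i "t i"] by (simp add: orbit_step bounded_operators_def)
qed

lemma vnorm_orbit_le: "i \<le> d \<Longrightarrow> vnorm (H i) (orbit d \<xi> i t) \<le> prod c {Suc i..d}"
proof (induction rule: down_induct)
  case top
  then show ?case by (simp add: H_d)
next
  case (step i)
  have "vnorm (H (i - 1)) (orbit d \<xi> (i - 1) t) \<le> c i * vnorm (H i) (orbit d \<xi> i t)"
    using op_bound[OF step(1) orbit_closed] step(1) by (simp add: orbit_step)
  also have "\<dots> \<le> c i * prod c {Suc i..d}"
    by (intro mult_left_mono step c_nonneg)
  also have "\<dots> = prod c {Suc (i - 1)..d}"
    using step(1) by (simp add: prod.atLeast_Suc_atMost[of i d])
  finally show ?case .
qed

lemma cmod_le:
  assumes "1 \<le> d"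
  shows "cmod (\<phi> s) \<le> prod c {1..d}"
proof -
  \<comment> \<open>The remaining arguments are neutral, so that the sum is \<open>s\<close>.\<close>
  define t where "t = (\<lambda>_ :: nat. 0 :: 'g)(1 := s)"
  have "[1..<Suc d] = 1 # [2..<Suc d]"
    using assms by (simp add: upt_conv_Cons numeral_2_eq_2 del: upt_Suc)
  moreover have "map t [2..<Suc d] = map (\<lambda>_. 0) [2..<Suc d]" by (simp add: t_def)
  ultimately have "sum_list (map t [1..<Suc d]) = s" by (simp add: t_def del: upt_Suc)
  then show ?thesis using vnorm_orbit_le[of 0 t] by (simp add: H_0 factors)
qed

lemma Md_factorization_and_bound:
  "Md_factorization d \<phi> H \<xi> \<and> Md_factorization_bound d H \<xi> \<le> prod c {1..d}"
proof
  have le: "operator_norm (H i) (H (i - 1)) (\<xi> i t) \<le> c i" if "i \<in> {1..d}" for i t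
    using that by (intro operator_norm_le hilbert c_nonneg op_bound) auto
  then have bdd: "bdd_above (range (\<lambda>t. operator_norm (H i) (H (i - 1)) (\<xi> i t)))" if "i \<in> {1..d}" for i
    using that by (intro bdd_aboveI2) blast
  show "Md_factorization d \<phi> H \<xi>"
    unfolding Md_factorization_def
    using hilbert H_0 H_d op bdd factors by (auto simp: orbit_def)
  show "Md_factorization_bound d H \<xi> \<le> prod c {1..d}"
    unfolding Md_factorization_bound_def
  proof (rule prod_mono, rule conjI)
    fix i assume i: "i \<in> {1..d}"
    show "(SUP t. operator_norm (H i) (H (i - 1)) (\<xi> i t)) \<le> c i"
      by (intro cSUP_least le i) auto
    have "0 \<le> operator_norm (H i) (H (i - 1)) (\<xi> i 0)"
      using i by (intro operator_norm_nonneg hilbert op) auto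
    also have "\<dots> \<le> (SUP t. operator_norm (H i) (H (i - 1)) (\<xi> i t))"
      using bdd[OF i] by (rule cSUP_upper[OF UNIV_I])
    finally show "0 \<le> (SUP t. operator_norm (H i) (H (i - 1)) (\<xi> i t))" .
  qed
qed

end

text \<open>
  The product of the operators need not be computed: it suffices to guess the vectors \<open>v i t\<close> through
  which it passes.
\<close>

lemma bounded_factorizationI:
  fixes v :: "nat \<Rightarrow> (nat \<Rightarrow> 'g::group_add) \<Rightarrow> complex + 'w"
  assumes hilbert: "\<And>i. i \<le> d \<Longrightarrow> complex_hilbert_space (H i)"
    and "H 0 = scalars" "H d = scalars"
    and "\<And>i t. i \<in> {1..d} \<Longrightarrow> \<xi> i t \<in> bounded_operators (H i) (H (i - 1))"
    and "\<And>i t x. i \<in> {1..d} \<Longrightarrow> x \<in> vectors (H i) \<Longrightarrow> vnorm (H (i - 1)) (\<xi> i t x) \<le> c i * vnorm (H i) x"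
    and "\<And>i. i \<in> {1..d} \<Longrightarrow> 0 \<le> c i"
    and v: "\<And>t. v d t = Inl 1" "\<And>t. v 0 t = Inl (\<phi> (sum_list (map t [1..<Suc d])))"
      "\<And>i t. i \<in> {1..d} \<Longrightarrow> \<xi> i (t i) (v i t) = v (i - 1) t"
  shows "bounded_factorization d c \<phi> H \<xi>"
proof (rule bounded_factorization.intro)
  fix t
  have "orbit d \<xi> i t = v i t" if "i \<le> d" for i
    using that by (induction rule: down_induct) (simp_all add: v orbit_step)
  then show "orbit d \<xi> 0 t = Inl (\<phi> (sum_list (map t [1..<Suc d])))" by (simp add: v)
qed (use assms in auto)

lemma Md_factorization_bounded_factorization:
  assumes "Md_factorization d \<phi> H \<xi>"
  shows "bounded_factorization d (\<lambda>i. SUP t. operator_norm (H i) (H (i - 1)) (\<xi> i t)) \<phi> H \<xi>"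
proof -
  have hil: "complex_hilbert_space (H i)" if "i \<le> d" for i using assms that by (simp add: Md_factorization_def)
  have op: "\<xi> i t \<in> bounded_operators (H i) (H (i - 1))" if "i \<in> {1..d}" for i t
    using assms that by (simp add: Md_factorization_def)
  have le: "operator_norm (H i) (H (i - 1)) (\<xi> i t) \<le> (SUP t. operator_norm (H i) (H (i - 1)) (\<xi> i t))"
    if "i \<in> {1..d}" for i t
    using assms that by (intro cSUP_upper) (auto simp: Md_factorization_def)
  show ?thesis
  proof (rule bounded_factorization.intro)
    show "H 0 = scalars" "H d = scalars" using assms by (auto simp: Md_factorization_def)
    show "orbit d \<xi> 0 t = Inl (\<phi> (sum_list (map t [1..<Suc d])))" for t
      using assms by (simp add: Md_factorization_def orbit_def del: upt_Suc)
    fix i assume i: "i \<in> {1..d}"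
    show "0 \<le> (SUP t. operator_norm (H i) (H (i - 1)) (\<xi> i t))"
      using order_trans[OF operator_norm_nonneg[OF hil hil op[OF i]] le[OF i]] i by auto
    fix t x assume x: "x \<in> vectors (H i)"
    then have nn: "0 \<le> vnorm (H i) x" using complex_hilbert_space.vnorm_nonneg[OF hil] i by auto
    have "vnorm (H (i - 1)) (\<xi> i t x) \<le> operator_norm (H i) (H (i - 1)) (\<xi> i t) * vnorm (H i) x"
      using i x by (intro vnorm_operator_le hil op) auto
    also have "\<dots> \<le> (SUP t. operator_norm (H i) (H (i - 1)) (\<xi> i t)) * vnorm (H i) x"
      by (intro mult_right_mono le i nn)
    finally show "vnorm (H (i - 1)) (\<xi> i t x) \<le> (SUP t. operator_norm (H i) (H (i - 1)) (\<xi> i t)) * vnorm (H i) x" .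
  qed (use hil op in auto)
qed

lemma Md_normI:
  fixes \<phi> :: "'g::topological_group_add \<Rightarrow> complex"
  assumes "\<phi> \<in> Cb" "bounded_factorization d c \<phi> H \<xi>"
  shows "\<phi> \<in> Md d" and "Md_norm d \<phi> \<le> prod c {1..d}"
proof -
  obtain H' :: "nat \<Rightarrow> 'g model inner_space" and \<xi>'
    where H': "Md_factorization d \<phi> H' \<xi>'" "Md_factorization_bound d H' \<xi>' \<le> prod c {1..d}"
    using Md_factorization_in_model[of d \<phi> H \<xi>] bounded_factorization.Md_factorization_and_bound[OF assms(2)]
      order_trans by blast
  show "\<phi> \<in> Md d" using assms(1) H' by (auto simp: Md_def)
  have "bdd_below {Md_factorization_bound d H \<xi> | (H :: nat \<Rightarrow> 'g model inner_space) \<xi>. Md_factorization d \<phi> H \<xi>}"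
  proof (rule bdd_belowI[of _ 0], clarify)
    fix H :: "nat \<Rightarrow> 'g model inner_space" and \<xi>
    assume "Md_factorization d \<phi> H \<xi>"
    then interpret bounded_factorization d "\<lambda>i. SUP t. operator_norm (H i) (H (i - 1)) (\<xi> i t)" \<phi> H \<xi>
      by (rule Md_factorization_bounded_factorization)
    show "0 \<le> Md_factorization_bound d H \<xi>"
      unfolding Md_factorization_bound_def by (intro prod_nonneg ballI c_nonneg)
  qed
  then have "Md_norm d \<phi> \<le> Md_factorization_bound d H' \<xi>'"
    unfolding Md_norm_def
  proof (rule cInf_lower[rotated])
    show "Md_factorization_bound d H' \<xi>' \<in> {Md_factorization_bound d H \<xi> | (H :: nat \<Rightarrow> 'g model inner_space) \<xi>. Md_factorization d \<phi> H \<xi>}"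
      using H'(1) by blast
  qed
  then show "Md_norm d \<phi> \<le> prod c {1..d}" using H'(2) by simp
qed

lemma Md_normE:
  fixes \<phi> :: "'g::topological_group_add \<Rightarrow> complex"
  assumes "\<phi> \<in> Md d" "Md_norm d \<phi> < r"
  obtains c and H :: "nat \<Rightarrow> 'g model inner_space" and \<xi>
  where "bounded_factorization d c \<phi> H \<xi>" "prod c {1..d} < r"
proof -
  let ?A = "{Md_factorization_bound d H \<xi> | (H :: nat \<Rightarrow> 'g model inner_space) \<xi>. Md_factorization d \<phi> H \<xi>}"
  have "?A \<noteq> {}" using assms(1) by (auto simp: Md_def)
  from cInf_lessD[OF this assms(2)[unfolded Md_norm_def]] obtain b where "b \<in> ?A" "b < r" by blast
  then obtain H :: "nat \<Rightarrow> 'g model inner_space" and \<xi>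
    where H: "Md_factorization d \<phi> H \<xi>" "Md_factorization_bound d H \<xi> < r" by blast
  show thesis
    by (rule that[OF Md_factorization_bounded_factorization[OF H(1)] H(2)[unfolded Md_factorization_bound_def]])
qed

text \<open>
  As the norm is an infimum that need not be attained, an operation on multipliers is estimated on
  factorizations with a slightly larger bound. The new factorization may use vectors of any type.
\<close>

lemma Md_norm_le_factorwise:
  fixes \<phi> :: "'g::topological_group_add \<Rightarrow> complex" and \<psi> :: "'h::topological_group_add \<Rightarrow> complex"
  assumes \<phi>: "\<phi> \<in> Md d" "Md_norm d \<phi> \<le> r" and \<psi>: "\<psi> \<in> Cb" and s: "0 \<le> s"
    and tr: "\<And>c (H :: nat \<Rightarrow> 'g model inner_space) \<xi>. bounded_factorization d c \<phi> H \<xi> \<Longrightarrow>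
      \<exists>c' (H' :: nat \<Rightarrow> (complex + 'w) inner_space) \<xi>'. bounded_factorization d c' \<psi> H' \<xi>' \<and>
        prod c' {1..d} \<le> s * prod c {1..d}"
  shows "\<psi> \<in> Md d" and "Md_norm d \<psi> \<le> s * r"
proof -
  have *: "\<psi> \<in> Md d \<and> Md_norm d \<psi> \<le> s * r'" if r': "r < r'" for r'
  proof -
    obtain c and H :: "nat \<Rightarrow> 'g model inner_space" and \<xi>
      where H: "bounded_factorization d c \<phi> H \<xi>" "prod c {1..d} < r'"
      by (rule Md_normE[OF \<phi>(1), of r']) (use \<phi>(2) r' in auto)
    obtain c' and H' :: "nat \<Rightarrow> (complex + 'w) inner_space" and \<xi>'
      where H': "bounded_factorization d c' \<psi> H' \<xi>'" "prod c' {1..d} \<le> s * prod c {1..d}"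
      using tr[OF H(1)] by blast
    have "s * prod c {1..d} \<le> s * r'" using H(2) s by (intro mult_left_mono) auto
    then show ?thesis using Md_normI[OF \<psi> H'(1)] H'(2) by auto
  qed
  show "\<psi> \<in> Md d" using *[of "r + 1"] by simp
  show "Md_norm d \<psi> \<le> s * r"
  proof (rule tendsto_lowerbound)
    show "((\<lambda>r'. s * r') \<longlongrightarrow> s * r) (at_right r)" by (intro tendsto_intros)
    show "\<forall>\<^sub>F r' in at_right r. Md_norm d \<psi> \<le> s * r'"
      using * by (auto simp: eventually_at_filter)
  qed simp
qed

lemma cmod_le_Md_norm:
  assumes "\<phi> \<in> Md d" "1 \<le> d"
  shows "cmod (\<phi> s) \<le> Md_norm d \<phi>"
proof (rule ccontr)
  assume "\<not> cmod (\<phi> s) \<le> Md_norm d \<phi>"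
  then obtain c and H :: "nat \<Rightarrow> 'a model inner_space" and \<xi>
    where "bounded_factorization d c \<phi> H \<xi>" "prod c {1..d} < cmod (\<phi> s)"
    using Md_normE[OF assms(1), of "cmod (\<phi> s)"] by (auto simp: not_le)
  then show False using bounded_factorization.cmod_le[OF _ assms(2), of c \<phi> H \<xi> s] by simp
qed

lemma one_Md:
  shows "(\<lambda>_ :: 'g::topological_group_add. 1) \<in> Md d" and "Md_norm d (\<lambda>_ :: 'g. 1) \<le> 1"
proof -
  have Cb: "(\<lambda>_ :: 'g. 1) \<in> Cb" by (simp add: Cb_def)
  have "bounded_factorization d (\<lambda>_. 1) (\<lambda>_ :: 'g. 1) (\<lambda>_. scalars :: (complex + unit) inner_space) (\<lambda>_ _ x. x)"
    by (rule bounded_factorizationI[where v = "\<lambda>_ _. Inl 1"])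
      (auto simp: scalars_hilbert bounded_operators_def intro: exI[of _ 1])
  from Md_normI[OF Cb this] show "(\<lambda>_ :: 'g. 1) \<in> Md d" "Md_norm d (\<lambda>_ :: 'g. 1) \<le> 1" by simp_all
qed

lemma bounded_factorization_comp:
  fixes h :: "'g::group_add \<Rightarrow> 'h::group_add"
  assumes "bounded_factorization d c \<phi> H \<xi>" and h: "h 0 = 0" "\<And>s t. h (s + t) = h s + h t"
  shows "bounded_factorization d c (\<lambda>s. \<phi> (h s)) H (\<lambda>i s. \<xi> i (h s))"
proof -
  interpret bounded_factorization d c \<phi> H \<xi> by fact
  have hs: "h (sum_list xs) = sum_list (map h xs)" for xs by (induction xs) (simp_all add: h)
  show ?thesis
    by (rule bounded_factorizationI[where v = "\<lambda>i t. orbit d \<xi> i (\<lambda>j. h (t j))"])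
      (use hilbert H_0 H_d op op_bound c_nonneg in \<open>auto simp: factors hs o_def orbit_step simp del: upt_Suc\<close>)
qed

text \<open>
  Only the last argument is translated, so the combination can be taken in the last operator alone, and
  the bound grows by the sum of the moduli of the coefficients.
\<close>

lemma bounded_factorization_right_translates:
  assumes "bounded_factorization d c \<phi> H \<xi>" and d: "1 \<le> d" and r: "(\<Sum>(a, t)\<leftarrow>u. cmod a) \<le> r"
  shows "\<exists>\<xi>'. bounded_factorization d (c(d := r * c d)) (\<lambda>s. \<Sum>(a, t)\<leftarrow>u. a * \<phi> (s + t)) H \<xi>'"
proof -
  interpret bounded_factorization d c \<phi> H \<xi> by fact
  have d1: "d \<in> {1..d}" using d by simp
  have r0: "0 \<le> r"
  proof -
    have "0 \<le> (\<Sum>(a, t)\<leftarrow>u. cmod a)" by (induction u) auto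
    then show ?thesis using r by simp
  qed
  define v where "v i t = (if i = d then Inl 1 else lincomb (H i) (\<lambda>w. orbit d \<xi> i (t(d := t d + w))) u)"
    for i and t :: "nat \<Rightarrow> 'a"
  define \<xi>' where "\<xi>' i s x = (if i = d then
      vscale (H (d - Suc 0)) (projl x) (lincomb (H (d - Suc 0)) (\<lambda>w. \<xi> d (s + w) (Inl 1)) u) else \<xi> i s x)" for i s x
  interpret D: complex_hilbert_space "H (d - Suc 0)" using hilbert by simp
  have one: "Inl 1 \<in> vectors (H d)" "vnorm (H d) (Inl 1) = 1" by (simp_all add: H_d)
  have cl: "\<xi> d s (Inl 1) \<in> vectors (H (d - Suc 0))" for s
    using op[OF d1, of s] one by (simp add: bounded_operators_def)
  have y: "lincomb (H (d - Suc 0)) (\<lambda>w. \<xi> d (s + w) (Inl 1)) u \<in> vectors (H (d - Suc 0))" for s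
    by (rule D.lincomb_closed) (rule cl)
  have y_le: "vnorm (H (d - Suc 0)) (lincomb (H (d - Suc 0)) (\<lambda>w. \<xi> d (s + w) (Inl 1)) u) \<le> r * c d" for s
  proof -
    have "vnorm (H (d - Suc 0)) (lincomb (H (d - Suc 0)) (\<lambda>w. \<xi> d (s + w) (Inl 1)) u) \<le> (\<Sum>(a, t)\<leftarrow>u. cmod a) * c d"
      using op_bound[OF d1 one(1)] one(2) by (intro D.vnorm_lincomb_le cl) simp
    also have "\<dots> \<le> r * c d" using r c_nonneg[OF d1] by (rule mult_right_mono)
    finally show ?thesis .
  qed
  have "bounded_factorization d (c(d := r * c d)) (\<lambda>s. \<Sum>(a, t)\<leftarrow>u. a * \<phi> (s + t)) H \<xi>'"
  proof (rule bounded_factorizationI[where v = v])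
    show "v d t = Inl 1" for t by (simp add: v_def)
    show "v 0 t = Inl (\<Sum>(a, w)\<leftarrow>u. a * \<phi> (sum_list (map t [1..<Suc d]) + w))" for t
    proof -
      have "map (t(d := t d + w)) [1..<d] = map t [1..<d]" for w by simp
      then show ?thesis
        using d by (simp add: v_def H_0 factors lincomb_scalars add.assoc del: fun_upd_apply map_fun_upd) simp
    qed
    show "\<xi>' i (t i) (v i t) = v (i - 1) t" if i: "i \<in> {1..d}" for i t
    proof (cases "i = d")
      case True
      then show ?thesis
        using i d1 y[of "t d"] by (auto simp: \<xi>'_def v_def orbit_step D.scale_one)
    next
      case False
      have "\<xi> i (t i) (lincomb (H i) (\<lambda>w. orbit d \<xi> i (t(d := t d + w))) u) =
          lincomb (H (i - 1)) (\<lambda>w. \<xi> i (t i) (orbit d \<xi> i (t(d := t d + w)))) u"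
        using i by (intro bounded_operator_lincomb hilbert op orbit_closed) auto
      then show ?thesis using False i by (auto simp: \<xi>'_def v_def orbit_step)
    qed
    show "\<xi>' i t \<in> bounded_operators (H i) (H (i - 1))" if i: "i \<in> {1..d}" for i t
    proof (cases "i = d")
      case True
      have "vnorm (H (d - Suc 0)) (\<xi>' d t (Inl a)) \<le> (r * c d) * cmod a" for a
        using mult_left_mono[OF y_le[of t], of "cmod a"] y[of t] by (simp add: \<xi>'_def D.vnorm_scale mult_ac)
      then show ?thesis
        unfolding True using y[of t]
        by (auto simp: bounded_operators_def H_d \<xi>'_def D.scale_closed D.scale_plus_left D.scale_scale)
    next
      case False
      then have "\<xi>' i t = \<xi> i t" by (simp add: \<xi>'_def fun_eq_iff)
      then show ?thesis using op[OF i] by simp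
    qed
    show "vnorm (H (i - 1)) (\<xi>' i t x) \<le> (c(d := r * c d)) i * vnorm (H i) x"
      if i: "i \<in> {1..d}" and x: "x \<in> vectors (H i)" for i t x
    proof (cases "i = d")
      case True
      then obtain a where "x = Inl a" using x by (auto simp: H_d)
      then show ?thesis
        using True mult_left_mono[OF y_le[of t], of "cmod a"] y[of t]
        by (simp add: \<xi>'_def H_d D.vnorm_scale mult_ac)
    qed (use op_bound[OF i x] in \<open>simp add: \<xi>'_def\<close>)
    show "0 \<le> (c(d := r * c d)) i" if "i \<in> {1..d}" for i
      using c_nonneg[OF that] r0 by auto
  qed (use hilbert H_0 H_d in auto)
  then show ?thesis by blast
qed

lemma Md_right_translates:
  fixes \<phi> :: "'g::topological_group_add \<Rightarrow> complex"
  assumes "\<phi> \<in> Md d" "Md_norm d \<phi> \<le> C" "1 \<le> d" "(\<Sum>(a, t)\<leftarrow>u. cmod a) \<le> r" "0 \<le> r"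
    and "(\<lambda>s. \<Sum>(a, t)\<leftarrow>u. a * \<phi> (s + t)) \<in> Cb"
  shows "(\<lambda>s. \<Sum>(a, t)\<leftarrow>u. a * \<phi> (s + t)) \<in> Md d"
    and "Md_norm d (\<lambda>s. \<Sum>(a, t)\<leftarrow>u. a * \<phi> (s + t)) \<le> r * C"
proof -
  have tr: "\<exists>c' (H' :: nat \<Rightarrow> 'g model inner_space) \<xi>'.
      bounded_factorization d c' (\<lambda>s. \<Sum>(a, t)\<leftarrow>u. a * \<phi> (s + t)) H' \<xi>' \<and> prod c' {1..d} \<le> r * prod c {1..d}"
    if "bounded_factorization d c \<phi> H \<xi>" for c and H :: "nat \<Rightarrow> 'g model inner_space" and \<xi>
  proof -
    have "prod (c(d := r * c d)) {1..d} = r * prod c {1..d}"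
      using assms(3) by (simp add: prod.remove[of "{Suc 0..d}" d])
    then show ?thesis
      using bounded_factorization_right_translates[OF that assms(3,4)] by (metis order_refl)
  qed
  show "(\<lambda>s. \<Sum>(a, t)\<leftarrow>u. a * \<phi> (s + t)) \<in> Md d"
    by (rule Md_norm_le_factorwise(1)[OF assms(1,2,6,5)]) (erule tr)
  show "Md_norm d (\<lambda>s. \<Sum>(a, t)\<leftarrow>u. a * \<phi> (s + t)) \<le> r * C"
    by (rule Md_norm_le_factorwise(2)[OF assms(1,2,6,5)]) (erule tr)
qed

lemma Md_scale:
  fixes \<phi> :: "'g::topological_group_add \<Rightarrow> complex"
  assumes "\<phi> \<in> Md d" "Md_norm d \<phi> \<le> C" "1 \<le> d"
  shows "(\<lambda>s. a * \<phi> s) \<in> Md d" "Md_norm d (\<lambda>s. a * \<phi> s) \<le> cmod a * C"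
proof -
  obtain B where "\<And>s. cmod (\<phi> s) \<le> B" using Md_imp_Cb[OF assms(1)] by (auto simp: Cb_def bounded_iff)
  then have "cmod (a * \<phi> s) \<le> cmod a * B" for s by (simp add: norm_mult mult_left_mono)
  then have "bounded (range (\<lambda>s. a * \<phi> s))" by (auto simp: bounded_iff)
  moreover have "continuous_on UNIV (\<lambda>s. a * \<phi> s)"
    using Md_imp_Cb[OF assms(1)] by (auto simp: Cb_def intro: continuous_intros)
  ultimately have "(\<lambda>s. a * \<phi> s) \<in> Cb" by (simp add: Cb_def)
  then show "(\<lambda>s. a * \<phi> s) \<in> Md d" "Md_norm d (\<lambda>s. a * \<phi> s) \<le> cmod a * C"
    using Md_right_translates[OF assms, of "[(a, 0)]" "cmod a"] by auto
qed

lemma Md_comp_hom: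
  fixes h :: "'g::topological_group_add \<Rightarrow> 'h::topological_group_add"
  assumes \<phi>: "\<phi> \<in> Md d" "Md_norm d \<phi> \<le> C"
    and h: "h 0 = 0" "\<And>s t. h (s + t) = h s + h t" "continuous_on UNIV h"
  shows "(\<lambda>s. \<phi> (h s)) \<in> Md d" and "Md_norm d (\<lambda>s. \<phi> (h s)) \<le> C"
proof -
  have "continuous_on UNIV \<phi>" using Md_imp_Cb[OF \<phi>(1)] by (simp add: Cb_def)
  then have "continuous_on UNIV (\<lambda>s. \<phi> (h s))" by (rule continuous_on_compose2[OF _ h(3)]) simp
  moreover obtain B where "\<And>t. cmod (\<phi> t) \<le> B" using Cb_bound[OF Md_imp_Cb[OF \<phi>(1)]] by blast
  then have "bounded (range (\<lambda>s. \<phi> (h s)))" by (auto simp: bounded_iff)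
  ultimately have Cb: "(\<lambda>s. \<phi> (h s)) \<in> Cb" by (simp add: Cb_def)
  have tr: "\<exists>c' (H' :: nat \<Rightarrow> 'h model inner_space) \<xi>'.
      bounded_factorization d c' (\<lambda>s. \<phi> (h s)) H' \<xi>' \<and> prod c' {1..d} \<le> 1 * prod c {1..d}"
    if "bounded_factorization d c \<phi> H \<xi>" for c and H :: "nat \<Rightarrow> 'h model inner_space" and \<xi>
    using bounded_factorization_comp[OF that h(1,2)] by (metis mult_1 order_refl)
  show "(\<lambda>s. \<phi> (h s)) \<in> Md d"
    by (rule Md_norm_le_factorwise(1)[OF \<phi> Cb zero_le_one]) (erule tr)
  have "Md_norm d (\<lambda>s. \<phi> (h s)) \<le> 1 * C"
    by (rule Md_norm_le_factorwise(2)[OF \<phi> Cb zero_le_one]) (erule tr)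
  then show "Md_norm d (\<lambda>s. \<phi> (h s)) \<le> C" by simp
qed


section \<open>Products of multipliers of two groups\<close>

lemma (in complex_hilbert_space) kernel_form_gram:
  assumes "\<And>p. \<delta> p \<in> vectors E"
  shows "kernel_form (\<lambda>p q. vinner E (\<delta> p) (\<delta> q)) u u = complex_of_real ((vnorm E (lincomb E \<delta> u))\<^sup>2)"
  using assms by (simp only: inner_lincomb[symmetric] inner_self lincomb_closed)

context bounded_factorization
begin

definition gram :: "nat \<Rightarrow> (nat \<Rightarrow> 'g) \<Rightarrow> (nat \<Rightarrow> 'g) \<Rightarrow> complex" where
  "gram i = (\<lambda>t t'. vinner (H i) (orbit d \<xi> i t) (orbit d \<xi> i t'))"

lemma psd_gram: "i \<le> d \<Longrightarrow> psd_kernel (gram i)"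
  unfolding gram_def by (intro psd_kernel_gram hilbert orbit_closed)

text \<open>
  The kernel form of the difference at a formal sum is \<open>(c i)\<^sup>2 * \<parallel>x\<parallel>\<^sup>2 - \<parallel>\<xi> i s x\<parallel>\<^sup>2\<close> for the
  combination \<open>x\<close> of orbit vectors.
\<close>

lemma psd_gram_step:
  assumes i: "i \<in> {1..d}"
  shows "psd_kernel (\<lambda>t t'. complex_of_real ((c i)\<^sup>2) * gram i t t' - gram (i - 1) (t(i := s)) (t'(i := s)))"
    (is "psd_kernel ?k")
proof
  have id: "i \<le> d" "i - 1 \<le> d" using i by auto
  interpret E: complex_hilbert_space "H i" by (rule hilbert[OF id(1)])
  interpret F: complex_hilbert_space "H (i - 1)" by (rule hilbert[OF id(2)])
  let ?\<delta> = "orbit d \<xi> i" and ?\<gamma> = "\<lambda>t. \<xi> i s (orbit d \<xi> i t)"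
  have \<delta>: "?\<delta> t \<in> vectors (H i)" for t by (rule orbit_closed[OF id(1)])
  have \<gamma>: "?\<gamma> t \<in> vectors (H (i - 1))" for t
    using op[OF i, of s] \<delta>[of t] unfolding bounded_operators_def by blast
  have step: "orbit d \<xi> (i - 1) (t(i := s)) = ?\<gamma> t" for t
    using orbit_step[OF i, of \<xi> "t(i := s)"] by simp
  show "?k q p = cnj (?k p q)" for p q
    using psd_kernel.hermitian[OF psd_gram[OF id(1)], of q p]
      psd_kernel.hermitian[OF psd_gram[OF id(2)], of "q(i := s)" "p(i := s)"] by simp
  fix u
  let ?x = "lincomb (H i) ?\<delta> u"
  have "(vnorm (H (i - 1)) (lincomb (H (i - 1)) ?\<gamma> u))\<^sup>2 \<le> (c i)\<^sup>2 * (vnorm (H i) ?x)\<^sup>2"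
  proof -
    have x: "?x \<in> vectors (H i)" by (rule E.lincomb_closed[OF \<delta>])
    have "lincomb (H (i - 1)) ?\<gamma> u = \<xi> i s ?x"
      by (rule bounded_operator_lincomb[symmetric, OF hilbert[OF id(1)] hilbert[OF id(2)] op[OF i] \<delta>])
    moreover have "0 \<le> vnorm (H (i - 1)) (lincomb (H (i - 1)) ?\<gamma> u)"
      by (rule F.vnorm_nonneg[OF F.lincomb_closed[OF \<gamma>]])
    ultimately show ?thesis
      using power_mono[OF op_bound[OF i x, of s], of 2] by (simp add: power_mult_distrib)
  qed
  moreover have "kernel_form ?k u u = complex_of_real ((c i)\<^sup>2 * (vnorm (H i) ?x)\<^sup>2 - (vnorm (H (i - 1)) (lincomb (H (i - 1)) ?\<gamma> u))\<^sup>2)"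
    unfolding kernel_form_diff kernel_form_cmult gram_def step
    by (simp only: E.kernel_form_gram[OF \<delta>] F.kernel_form_gram[OF \<gamma>] of_real_diff of_real_mult)
  ultimately show "0 \<le> Re (kernel_form ?k u u)" by simp
qed

end

text \<open>
  The kernel version of \<open>\<parallel>S \<otimes> T\<parallel> \<le> \<parallel>S\<parallel> \<parallel>T\<parallel>\<close>, proved as for operators by changing one factor
  at a time.
\<close>

lemma psd_kernel_diff_mult:
  assumes "psd_kernel l" "psd_kernel k'"
    and "psd_kernel (\<lambda>p q. complex_of_real a * k p q - l p q)"
    and "psd_kernel (\<lambda>p q. complex_of_real b * k' p q - l' p q)" and "0 \<le> b"
  shows "psd_kernel (\<lambda>p q. complex_of_real (a * b) * (k p q * k' p q) - l p q * l' p q)"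
proof -
  have "(\<lambda>p q. complex_of_real (a * b) * (k p q * k' p q) - l p q * l' p q) =
      (\<lambda>p q. complex_of_real b * ((complex_of_real a * k p q - l p q) * k' p q) +
        l p q * (complex_of_real b * k' p q - l' p q))"
    by (simp add: fun_eq_iff algebra_simps)
  moreover have "psd_kernel \<dots>"
    by (intro psd_kernel_add psd_kernel_scale psd_kernel_mult assms)
  ultimately show ?thesis by simp
qed

text \<open>
  The space \<open>E i\<close> plays the role of the tensor product of the spaces of \<open>\<phi>\<close> and \<open>\<psi>\<close>, and \<open>v i t\<close> that of
  the tensor product of their orbit vectors. For \<open>i = 0\<close> and \<open>i = d\<close> the tensor product is one-dimensional
  and is replaced by the scalars, as a factorization requires.
\<close>

lemma bounded_factorization_tensor:
  fixes \<phi> :: "'g::group_add \<Rightarrow> complex" and \<psi> :: "'h::group_add \<Rightarrow> complex"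
    and H :: "nat \<Rightarrow> (complex + 'v) inner_space" and H' :: "nat \<Rightarrow> (complex + 'w) inner_space"
  assumes "bounded_factorization d c \<phi> H \<xi>" and "bounded_factorization d c' \<psi> H' \<xi>'" and d: "1 \<le> d"
  shows "\<exists>(E :: nat \<Rightarrow> (complex + ((nat \<Rightarrow> 'g \<times> 'h) formal_sum \<Rightarrow> complex)) inner_space) \<zeta>.
    bounded_factorization d (\<lambda>i. c i * c' i) (\<lambda>x. \<phi> (fst x) * \<psi> (snd x)) E \<zeta>"
proof -
  interpret A: bounded_factorization d c \<phi> H \<xi> by fact
  interpret B: bounded_factorization d c' \<psi> H' \<xi>' by fact
  define k where "k i t t' = A.gram i (fst \<circ> t) (fst \<circ> t') * B.gram i (snd \<circ> t) (snd \<circ> t')"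
    for i and t t' :: "nat \<Rightarrow> 'g \<times> 'h"
  have k: "psd_kernel (k i)" if "i \<le> d" for i
    using psd_kernel_mult[OF psd_kernel_comp[OF A.psd_gram[OF that], of "\<lambda>t. fst \<circ> t"]
        psd_kernel_comp[OF B.psd_gram[OF that], of "\<lambda>t. snd \<circ> t"]]
    unfolding k_def .
  have k_step: "psd_kernel (\<lambda>t t'. complex_of_real ((c i * c' i)\<^sup>2) * k i t t' - k (i - 1) (t(i := s)) (t'(i := s)))"
    if i: "i \<in> {1..d}" for i s
  proof -
    have id: "i \<le> d" "i - 1 \<le> d" using i by auto
    show ?thesis
      unfolding k_def power_mult_distrib fun_upd_comp
      using psd_kernel_diff_mult[OF psd_kernel_comp[OF A.psd_gram[OF id(2)], of "\<lambda>t. (fst \<circ> t)(i := fst s)"]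
        psd_kernel_comp[OF B.psd_gram[OF id(1)], of "\<lambda>t. snd \<circ> t"]
        psd_kernel_comp[OF A.psd_gram_step[OF i, of "fst s"], of "\<lambda>t. fst \<circ> t"]
        psd_kernel_comp[OF B.psd_gram_step[OF i, of "snd s"], of "\<lambda>t. snd \<circ> t"] zero_le_power2]
      by simp
  qed
  define E where "E i = (if i = 0 \<or> i = d then scalars else psd_kernel.hilbert_completion (k i))" for i
  define v where "v i t = (if i = 0 then Inl (\<phi> (sum_list (map (fst \<circ> t) [1..<Suc d])) * \<psi> (sum_list (map (snd \<circ> t) [1..<Suc d])))
      else if i = d then Inl 1 else psd_kernel.point (k i) t)" for i and t :: "nat \<Rightarrow> 'g \<times> 'h"
  have E: "complex_hilbert_space (E i)" if "i \<le> d" for i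
    using psd_kernel.completion_hilbert[OF k[OF that]] by (simp add: E_def scalars_hilbert)
  have v: "v i t \<in> vectors (E i)" if "i \<le> d" for i t
    using psd_kernel.point_closed[OF k[OF that]] by (auto simp: E_def v_def)
  have inner_v: "vinner (E i) (v i t) (v i t') = k i t t'" if "i \<le> d" for i t t'
  proof -
    consider "i = 0" | "i = d" "i \<noteq> 0" | "i \<noteq> 0" "i \<noteq> d" by blast
    then show ?thesis
    proof cases
      case 1
      then show ?thesis
        by (simp add: E_def v_def k_def A.gram_def B.gram_def A.H_0 B.H_0 A.factors B.factors del: upt_Suc)
    next
      case 2
      then show ?thesis by (simp add: E_def v_def k_def A.gram_def B.gram_def A.H_d B.H_d)
    next
      case 3
      then show ?thesis using psd_kernel.inner_point[OF k[OF that]] by (simp add: E_def v_def)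
    qed
  qed
  have dense: "\<exists>\<sigma>. (\<lambda>n. vdist (E i) (lincomb (E i) (v i) (\<sigma> n)) x) \<longlonglongrightarrow> 0"
    if i: "i \<in> {1..d}" and x: "x \<in> vectors (E i)" for i x
  proof (cases "i = d")
    case True
    then obtain a where "x = Inl a" using x by (auto simp: E_def)
    then have "vdist (E i) (lincomb (E i) (v i) [(a, \<lambda>_. 0)]) x = 0"
      using True i by (simp add: E_def v_def)
    then show ?thesis by (intro exI[of _ "\<lambda>_. [(a, \<lambda>_. 0)]"]) (simp del: lincomb_simps)
  next
    case False
    then have "v i = psd_kernel.point (k i)" using i by (simp add: fun_eq_iff v_def)
    then show ?thesis
      using False i x psd_kernel.points_dense[OF k, of i x] by (simp add: E_def)
  qed
  have "\<exists>T\<in>bounded_operators (E i) (E (i - 1)).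
      (\<forall>x\<in>vectors (E i). vnorm (E (i - 1)) (T x) \<le> c i * c' i * vnorm (E i) x) \<and>
      (\<forall>t. T (v i t) = v (i - 1) (t(i := s)))" if i: "i \<in> {1..d}" for i s
  proof (rule operator_extension)
    have id: "i \<le> d" "i - 1 \<le> d" using i by auto
    show "complex_hilbert_space (E i)" "complex_hilbert_space (E (i - 1))" using E id by blast+
    show vE: "v i t \<in> vectors (E i)" "v (i - 1) (t(i := s)) \<in> vectors (E (i - 1))" for t using v id by blast+
    show "\<exists>\<sigma>. (\<lambda>n. vdist (E i) (lincomb (E i) (v i) (\<sigma> n)) x) \<longlonglongrightarrow> 0" if "x \<in> vectors (E i)" for x
      by (rule dense[OF i that])
    show c0: "0 \<le> c i * c' i" using A.c_nonneg[OF i] B.c_nonneg[OF i] by simp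
    fix u
    \<comment> \<open>The norm estimate is positivity of the form of the kernel in \<open>k_step\<close> at \<open>u\<close>.\<close>
    let ?x = "lincomb (E i) (v i) u" and ?y = "lincomb (E (i - 1)) (\<lambda>t. v (i - 1) (t(i := s))) u"
    have "kernel_form (\<lambda>t t'. complex_of_real ((c i * c' i)\<^sup>2) * k i t t' - k (i - 1) (t(i := s)) (t'(i := s))) u u =
        complex_of_real ((c i * c' i)\<^sup>2) * complex_of_real ((vnorm (E i) ?x)\<^sup>2) - complex_of_real ((vnorm (E (i - 1)) ?y)\<^sup>2)"
      using complex_hilbert_space.kernel_form_gram[OF E[OF id(1)], where \<delta> = "v i" and u = u, OF vE(1)]
        complex_hilbert_space.kernel_form_gram[OF E[OF id(2)], where \<delta> = "\<lambda>t. v (i - 1) (t(i := s))" and u = u, OF vE(2)]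
      by (simp only: kernel_form_diff kernel_form_cmult inner_v id)
    then have "0 \<le> (c i * c' i)\<^sup>2 * (vnorm (E i) ?x)\<^sup>2 - (vnorm (E (i - 1)) ?y)\<^sup>2"
      using psd_kernel.form_nonneg[OF k_step[OF i, of s], of u] by (simp flip: of_real_mult of_real_power of_real_diff)
    then have "(vnorm (E (i - 1)) ?y)\<^sup>2 \<le> (c i * c' i * vnorm (E i) ?x)\<^sup>2" by (simp add: power_mult_distrib)
    moreover have "0 \<le> vnorm (E i) ?x"
      using E[OF id(1)] vE(1) by (intro complex_hilbert_space.vnorm_nonneg complex_hilbert_space.lincomb_closed)
    ultimately show "vnorm (E (i - 1)) ?y \<le> c i * c' i * vnorm (E i) ?x"
      using mult_nonneg_nonneg[OF c0] by (intro power2_le_imp_le[of "vnorm (E (i - 1)) ?y"])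
  qed
  then have "\<forall>i s. \<exists>T. i \<in> {1..d} \<longrightarrow> T \<in> bounded_operators (E i) (E (i - 1)) \<and>
      (\<forall>x\<in>vectors (E i). vnorm (E (i - 1)) (T x) \<le> c i * c' i * vnorm (E i) x) \<and>
      (\<forall>t. T (v i t) = v (i - 1) (t(i := s)))" by blast
  then obtain \<zeta> where \<zeta>: "\<And>i s. i \<in> {1..d} \<Longrightarrow> \<zeta> i s \<in> bounded_operators (E i) (E (i - 1))"
      "\<And>i s x. i \<in> {1..d} \<Longrightarrow> x \<in> vectors (E i) \<Longrightarrow> vnorm (E (i - 1)) (\<zeta> i s x) \<le> c i * c' i * vnorm (E i) x"
      "\<And>i s t. i \<in> {1..d} \<Longrightarrow> \<zeta> i s (v i t) = v (i - 1) (t(i := s))" by metis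
  have sum: "fst (sum_list ts) = sum_list (map fst ts)" "snd (sum_list ts) = sum_list (map snd ts)"
    for ts :: "('g \<times> 'h) list" by (induction ts) auto
  have "bounded_factorization d (\<lambda>i. c i * c' i) (\<lambda>x. \<phi> (fst x) * \<psi> (snd x)) E \<zeta>"
  proof (rule bounded_factorizationI[where v = v])
    show "E 0 = scalars" "E d = scalars" by (simp_all add: E_def)
    show "v d t = Inl 1" "v 0 t = Inl (\<phi> (fst (sum_list (map t [1..<Suc d]))) * \<psi> (snd (sum_list (map t [1..<Suc d]))))" for t
      using d by (simp_all add: v_def sum del: upt_Suc)
    show "\<zeta> i (t i) (v i t) = v (i - 1) t" if "i \<in> {1..d}" for i t
      using \<zeta>(3)[OF that, of "t i" t] by simp
    show "0 \<le> c i * c' i" if "i \<in> {1..d}" for i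
      using A.c_nonneg[OF that] B.c_nonneg[OF that] by simp
  qed (use E \<zeta> in auto)
  then show ?thesis by blast
qed

lemma Md_tensor:
  fixes \<phi> :: "'g::topological_group_add \<Rightarrow> complex" and \<psi> :: "'h::topological_group_add \<Rightarrow> complex"
  assumes \<phi>: "\<phi> \<in> Md d" "Md_norm d \<phi> \<le> C" and \<psi>: "\<psi> \<in> Md d" "Md_norm d \<psi> \<le> D" and d: "1 \<le> d"
    and D: "0 \<le> D" and Cb: "(\<lambda>x. \<phi> (fst x) * \<psi> (snd x)) \<in> Cb"
  shows "(\<lambda>x. \<phi> (fst x) * \<psi> (snd x)) \<in> Md d"
    and "Md_norm d (\<lambda>x. \<phi> (fst x) * \<psi> (snd x)) \<le> C * D"
proof -
  have *: "(\<lambda>x. \<phi> (fst x) * \<psi> (snd x)) \<in> Md d \<and> Md_norm d (\<lambda>x. \<phi> (fst x) * \<psi> (snd x)) \<le> D' * C"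
    if D': "D < D'" for D'
  proof -
    obtain c' and H' :: "nat \<Rightarrow> 'h model inner_space" and \<xi>'
      where H': "bounded_factorization d c' \<psi> H' \<xi>'" "prod c' {1..d} < D'"
      by (rule Md_normE[OF \<psi>(1), of D']) (use \<psi>(2) D' in auto)
    have tr: "\<exists>c'' (E :: nat \<Rightarrow> (complex + ((nat \<Rightarrow> 'g \<times> 'h) formal_sum \<Rightarrow> complex)) inner_space) \<zeta>.
        bounded_factorization d c'' (\<lambda>x. \<phi> (fst x) * \<psi> (snd x)) E \<zeta> \<and> prod c'' {1..d} \<le> D' * prod c {1..d}"
      if fac: "bounded_factorization d c \<phi> H \<xi>" for c and H :: "nat \<Rightarrow> 'g model inner_space" and \<xi>
    proof -
      have "0 \<le> prod c {1..d}" using bounded_factorization.c_nonneg[OF fac] by (intro prod_nonneg) auto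
      then have le: "(\<Prod>i=1..d. c i * c' i) \<le> D' * prod c {1..d}"
        using mult_right_mono[OF less_imp_le[OF H'(2)], of "prod c {1..d}"]
        by (simp add: prod.distrib mult.commute)
      obtain E :: "nat \<Rightarrow> (complex + ((nat \<Rightarrow> 'g \<times> 'h) formal_sum \<Rightarrow> complex)) inner_space" and \<zeta>
        where "bounded_factorization d (\<lambda>i. c i * c' i) (\<lambda>x. \<phi> (fst x) * \<psi> (snd x)) E \<zeta>"
        using bounded_factorization_tensor[OF fac H'(1) d] by blast
      with le show ?thesis by blast
    qed
    have D'0: "0 \<le> D'" using D D' by simp
    show ?thesis
    proof
      show "(\<lambda>x. \<phi> (fst x) * \<psi> (snd x)) \<in> Md d"
        by (rule Md_norm_le_factorwise(1)[OF \<phi> Cb D'0]) (erule tr)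
      show "Md_norm d (\<lambda>x. \<phi> (fst x) * \<psi> (snd x)) \<le> D' * C"
        by (rule Md_norm_le_factorwise(2)[OF \<phi> Cb D'0]) (erule tr)
    qed
  qed
  show "(\<lambda>x. \<phi> (fst x) * \<psi> (snd x)) \<in> Md d" using *[of "D + 1"] by simp
  show "Md_norm d (\<lambda>x. \<phi> (fst x) * \<psi> (snd x)) \<le> C * D"
  proof (rule tendsto_lowerbound)
    show "((\<lambda>D'. D' * C) \<longlongrightarrow> C * D) (at_right D)" by (auto intro!: tendsto_eq_intros)
    show "\<forall>\<^sub>F D' in at_right D. Md_norm d (\<lambda>x. \<phi> (fst x) * \<psi> (snd x)) \<le> D' * C"
      using * by (auto simp: eventually_at_filter)
  qed simp
qed


section \<open>Continuous functions with compact support\<close>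

lemma CcI:
  fixes \<phi> :: "'g::t2_space \<Rightarrow> complex"
  assumes "continuous_on UNIV \<phi>" "compact S" "\<And>t. t \<notin> S \<Longrightarrow> \<phi> t = 0"
  shows "\<phi> \<in> Cc"
proof -
  have "closure {t. \<phi> t \<noteq> 0} \<subseteq> S"
    using assms(2,3) by (intro closure_minimal compact_imp_closed) auto
  then have "compact (closure {t. \<phi> t \<noteq> 0})"
    using compact_Int_closed[OF assms(2) closed_closure, of "{t. \<phi> t \<noteq> 0}"] by (simp add: inf.absorb2)
  then show ?thesis using assms(1) by (simp add: Cc_def)
qed

lemma CcE:
  assumes "\<phi> \<in> Cc"
  obtains S where "compact S" "\<And>t. t \<notin> S \<Longrightarrow> \<phi> t = 0"
proof (rule that)
  show "compact (closure {t. \<phi> t \<noteq> 0})" using assms by (simp add: Cc_def)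
  show "\<phi> t = 0" if "t \<notin> closure {t. \<phi> t \<noteq> 0}" for t
    using that closure_subset[of "{t. \<phi> t \<noteq> 0}"] by blast
qed

lemma Cc_continuous: "\<phi> \<in> Cc \<Longrightarrow> continuous_on UNIV \<phi>"
  by (simp add: Cc_def)

lemma Cc_imp_Cb: "\<phi> \<in> Cc \<Longrightarrow> \<phi> \<in> Cb"
proof -
  assume \<phi>: "\<phi> \<in> Cc"
  then obtain S where S: "compact S" "\<And>t. t \<notin> S \<Longrightarrow> \<phi> t = 0" by (rule CcE) blast
  have "compact (\<phi> ` S)"
    using S(1) Cc_continuous[OF \<phi>] by (intro compact_continuous_image) (auto intro: continuous_on_subset)
  then have "bounded (insert 0 (\<phi> ` S))" by (simp add: compact_imp_bounded)
  moreover have "range \<phi> \<subseteq> insert 0 (\<phi> ` S)" using S(2) by blast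
  ultimately have "bounded (range \<phi>)" by (rule bounded_subset)
  then show ?thesis using Cc_continuous[OF \<phi>] by (simp add: Cb_def)
qed

lemma Cc_right_translates:
  fixes \<phi> :: "'g::{topological_group_add, t2_space} \<Rightarrow> complex"
  assumes "\<phi> \<in> Cc"
  shows "(\<lambda>s. \<Sum>(a, t)\<leftarrow>u. a * \<phi> (s + t)) \<in> Cc"
proof (induction u)
  case Nil
  then show ?case by (intro CcI[of _ "{}"]) auto
next
  case (Cons p u)
  obtain a t where p: "p = (a, t)" by (cases p)
  obtain S where S: "compact S" "\<And>s. s \<notin> S \<Longrightarrow> \<phi> s = 0" using CcE[OF assms] by blast
  obtain R where R: "compact R" "\<And>s. s \<notin> R \<Longrightarrow> (\<Sum>(a, t)\<leftarrow>u. a * \<phi> (s + t)) = 0" using CcE[OF Cons] by blast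
  show ?case
  proof (rule CcI)
    have "continuous_on UNIV (\<lambda>s. \<phi> (s + t))"
      by (rule continuous_on_compose2[OF Cc_continuous[OF assms]]) (auto intro!: continuous_intros)
    then show "continuous_on UNIV (\<lambda>s. \<Sum>(a, t)\<leftarrow>p # u. a * \<phi> (s + t))"
      using Cc_continuous[OF Cons] by (simp add: p continuous_intros)
    show "compact ((\<lambda>s. s + - t) ` S \<union> R)"
      by (intro compact_Un compact_continuous_image continuous_intros S(1) R(1))
    show "(\<Sum>(a, t)\<leftarrow>p # u. a * \<phi> (s + t)) = 0" if "s \<notin> (\<lambda>s. s + - t) ` S \<union> R" for s
    proof -
      have "s + t \<notin> S"
      proof
        assume "s + t \<in> S"
        then have "(s + t) + - t \<in> (\<lambda>s. s + - t) ` S" by blast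
        then show False using that by (simp add: add.assoc)
      qed
      then show ?thesis using S(2) R(2) that by (simp add: p)
    qed
  qed
qed

text \<open>
  Points \<open>s\<close> of a compact set \<open>S\<close> that carries \<open>\<phi>\<close> are treated by compactness. If \<open>s\<close> is outside \<open>S\<close> and \<open>s + w\<close> inside, then
  \<open>s\<close> is the translate of \<open>s + w\<close> by \<open>- w\<close>, whence the symmetric neighbourhood.
\<close>

lemma Cc_right_uniformly_continuous:
  fixes \<phi> :: "'g::{topological_group_add, t2_space} \<Rightarrow> complex"
  assumes \<phi>: "\<phi> \<in> Cc" and e: "e > 0"
  obtains N where "open N" "0 \<in> N" "\<And>w s. w \<in> N \<Longrightarrow> cmod (\<phi> (s + w) - \<phi> s) \<le> e"
proof -
  obtain S where S: "compact S" "\<And>s. s \<notin> S \<Longrightarrow> \<phi> s = 0" using CcE[OF \<phi>] by blast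
  have "continuous_on (UNIV \<times> S) (\<lambda>p. \<phi> (snd p + fst p))"
    by (rule continuous_on_compose2[OF Cc_continuous[OF \<phi>]]) (auto intro!: continuous_intros)
  then obtain X where X0: "0 \<in> X" "open X"
      "\<forall>w\<in>X \<inter> UNIV. \<forall>s\<in>S. dist (\<phi> (snd (w, s) + fst (w, s))) (\<phi> (snd (0, s) + fst (0, s))) \<le> e"
    by (rule continuous_on_prod_compactE[OF _ S(1) UNIV_I e, where ?x0.0 = 0]) (rule that; simp)
  then have X: "0 \<in> X" "open X" "\<And>w s. w \<in> X \<Longrightarrow> s \<in> S \<Longrightarrow> dist (\<phi> (s + w)) (\<phi> s) \<le> e" by simp_all
  show thesis
  proof
    show "open (X \<inter> uminus -` X)"
      using X(2) by (intro open_Int open_vimage continuous_intros) auto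
    show "0 \<in> X \<inter> uminus -` X" using X(1) by simp
    fix w s assume w: "w \<in> X \<inter> uminus -` X"
    show "cmod (\<phi> (s + w) - \<phi> s) \<le> e"
    proof (cases "s \<in> S")
      case True
      then show ?thesis using X(3)[of w s] w by (simp add: dist_norm)
    next
      case False
      have "cmod (\<phi> (s + w + - w) - \<phi> (s + w)) \<le> e" if "s + w \<in> S"
        using X(3)[of "- w" "s + w"] w that by (simp add: dist_norm)
      then have "cmod (\<phi> s - \<phi> (s + w)) \<le> e" if "s + w \<in> S" using that by (simp add: add.assoc)
      then show ?thesis
        using S(2)[OF False] S(2)[of "s + w"] e by (cases "s + w \<in> S") auto
    qed
  qed
qed


section \<open>Regularity and translations of Haar measure\<close>

locale haar_measure =
  fixes \<mu> :: "'g::{topological_group_add, t2_space} measure"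
  assumes haar: "left_haar_measure \<mu>"
begin

lemma sets_eq [measurable_cong, simp]: "sets \<mu> = sets borel"
  using haar by (simp add: left_haar_measure_def)

lemma space_eq [simp]: "space \<mu> = UNIV"
  using sets_eq_imp_space_eq[OF sets_eq] by simp

lemma emeasure_compact: "compact K \<Longrightarrow> emeasure \<mu> K < \<infinity>"
  using haar by (simp add: left_haar_measure_def)

lemma emeasure_shift: "A \<in> sets borel \<Longrightarrow> emeasure \<mu> ((+) s ` A) = emeasure \<mu> A"
  using haar by (simp add: left_haar_measure_def)

lemma outer_regular:
  assumes A: "A \<in> sets borel" and less: "emeasure \<mu> A < x"
  shows "\<exists>U. open U \<and> A \<subseteq> U \<and> emeasure \<mu> U < x"
proof -
  have "emeasure \<mu> A = (INF U\<in>{U. open U \<and> A \<subseteq> U}. emeasure \<mu> U)"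
    using haar A unfolding left_haar_measure_def by blast
  then show ?thesis using less by (simp only: INF_less_iff) blast
qed

lemma inner_regular:
  assumes U: "open U" and less: "x < emeasure \<mu> U"
  shows "\<exists>K. compact K \<and> K \<subseteq> U \<and> x < emeasure \<mu> K"
proof -
  have "emeasure \<mu> U = (SUP K\<in>{K. compact K \<and> K \<subseteq> U}. emeasure \<mu> K)"
    using haar U unfolding left_haar_measure_def by blast
  then show ?thesis using less by (simp only: less_SUP_iff) blast
qed

lemma borel_compact: "compact K \<Longrightarrow> K \<in> sets (borel :: 'g measure)"
  by (intro borel_closed compact_imp_closed)

lemma compact_shift: "compact K \<Longrightarrow> compact ((+) (s::'g) ` K)"
  by (intro compact_continuous_image continuous_intros) auto

lemma shift_eq_vimage: "(+) s ` A = (+) (- s) -` (A :: 'g set)"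
proof (intro set_eqI iffI)
  fix x assume "x \<in> (+) (- s) -` A"
  then have "s + (- s + x) \<in> (+) s ` A" by blast
  then show "x \<in> (+) s ` A" by (simp flip: add.assoc)
qed (auto simp flip: add.assoc)

lemma borel_shift: "A \<in> sets borel \<Longrightarrow> (+) s ` A \<in> sets (borel :: 'g measure)"
proof -
  assume A: "A \<in> sets borel"
  have "(+) (- s) \<in> borel_measurable (borel :: 'g measure)"
    by (intro borel_measurable_continuous_onI continuous_intros)
  from measurable_sets[OF this A] show ?thesis by (simp add: shift_eq_vimage)
qed

lemma distr_shift: "distr \<mu> \<mu> ((+) s) = \<mu>"
proof (rule measure_eqI)
  have meas: "(+) s \<in> measurable \<mu> \<mu>"
    by (subst measurable_cong_sets[OF sets_eq sets_eq])
      (intro borel_measurable_continuous_onI continuous_intros)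
  show "sets (distr \<mu> \<mu> ((+) s)) = sets \<mu>" by simp
  fix A assume "A \<in> sets (distr \<mu> \<mu> ((+) s))"
  then have A: "A \<in> sets borel" by simp
  then have "emeasure (distr \<mu> \<mu> ((+) s)) A = emeasure \<mu> ((+) s -` A)"
    using meas by (simp add: emeasure_distr)
  also have "(+) s -` A = (+) (- s) ` A" by (simp add: shift_eq_vimage)
  finally show "emeasure (distr \<mu> \<mu> ((+) s)) A = emeasure \<mu> A" using A by (simp add: emeasure_shift)
qed

lemma integral_shift:
  fixes f :: "'g \<Rightarrow> complex"
  assumes "f \<in> borel_measurable borel"
  shows "(\<integral>t. f (s + t) \<partial>\<mu>) = (\<integral>t. f t \<partial>\<mu>)"
proof -
  have meas: "(+) s \<in> measurable \<mu> \<mu>"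
    by (subst measurable_cong_sets[OF sets_eq sets_eq])
      (intro borel_measurable_continuous_onI continuous_intros)
  have "f \<in> borel_measurable \<mu>" using assms by simp
  from integral_distr[OF meas this] show ?thesis by (simp add: distr_shift)
qed

lemma compact_pos: "\<exists>V. compact V \<and> 0 < measure \<mu> V"
proof -
  have "emeasure \<mu> UNIV \<noteq> 0" using haar unfolding left_haar_measure_def by blast
  then have "0 < emeasure \<mu> UNIV" by (simp add: zero_less_iff_neq_zero)
  then obtain K where K: "compact K" "0 < emeasure \<mu> K" using inner_regular[OF open_UNIV] by blast
  then have "0 < measure \<mu> K" using emeasure_compact[OF K(1)] by (simp add: measure_def enn2real_positive_iff)
  then show ?thesis using K(1) by blast
qed

text \<open>
  A Borel set of finite measure lies in an open set of finite measure, and open sets are approximated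
  from inside by compact sets.
\<close>

lemma compact_tight:
  assumes A: "A \<in> sets borel" "emeasure \<mu> A < \<infinity>" and e: "e > 0"
  shows "\<exists>K. compact K \<and> measure \<mu> (A - K) < e"
proof -
  obtain U where U: "open U" "A \<subseteq> U" "emeasure \<mu> U < \<infinity>" using outer_regular[OF A] by blast
  have fin: "U \<in> fmeasurable \<mu>" using U by (simp add: fmeasurable_def)
  have "\<exists>K. compact K \<and> K \<subseteq> U \<and> measure \<mu> U - e < measure \<mu> K"
  proof (cases "measure \<mu> U < e")
    case True
    then show ?thesis by (intro exI[of _ "{}"]) simp
  next
    case False
    have "ennreal (measure \<mu> U - e) < emeasure \<mu> U"
      using e False U(3) by (simp add: emeasure_eq_ennreal_measure ennreal_less_iff)
    from inner_regular[OF U(1) this] obtain K where K: "compact K" "K \<subseteq> U" "ennreal (measure \<mu> U - e) < emeasure \<mu> K" by blast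
    then have "measure \<mu> U - e < measure \<mu> K"
      using emeasure_compact[OF K(1)] False by (simp add: emeasure_eq_ennreal_measure ennreal_less_iff)
    then show ?thesis using K by blast
  qed
  then obtain K where K: "compact K" "K \<subseteq> U" "measure \<mu> U - e < measure \<mu> K" by blast
  have "measure \<mu> (A - K) \<le> measure \<mu> (U - K)"
    using A U borel_compact[OF K(1)] by (intro measure_mono_fmeasurable) (auto intro: fmeasurableI2[OF fin])
  also have "\<dots> = measure \<mu> U - measure \<mu> K"
    using U K borel_compact[OF K(1)] by (intro measure_Diff) auto
  finally show ?thesis using K by (intro exI[of _ K]) simp
qed

text \<open>
  Outer regularity of \<open>V\<close> gives an open superset of almost the same measure, and by compactness it
  contains all translates of \<open>V\<close> by small elements.
\<close>

lemma compact_shift_small: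
  assumes V: "compact V" and e: "e > 0"
  obtains N where "open N" "0 \<in> N" "\<And>r. r \<in> N \<Longrightarrow> measure \<mu> ((+) r ` V - V) < e"
proof -
  have fin: "V \<in> fmeasurable \<mu>" using borel_compact[OF V] emeasure_compact[OF V] by (simp add: fmeasurable_def)
  have "emeasure \<mu> V < ennreal (measure \<mu> V + e)"
    using emeasure_compact[OF V] e by (simp add: emeasure_eq_ennreal_measure ennreal_less_iff)
  from outer_regular[OF borel_compact[OF V] this] obtain U
    where U: "open U" "V \<subseteq> U" "emeasure \<mu> U < ennreal (measure \<mu> V + e)" by blast
  then have finU: "emeasure \<mu> U < \<infinity>" by (metis ennreal_less_top infinity_ennreal_def order.strict_trans)
  then have U_fin: "U \<in> fmeasurable \<mu>" using U(1) by (simp add: fmeasurable_def)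
  have less: "measure \<mu> U < measure \<mu> V + e"
    using U(3) finU e by (simp add: emeasure_eq_ennreal_measure ennreal_less_iff del: ennreal_plus)
  have W: "open ((\<lambda>p. fst p + snd p) -` U :: ('g \<times> 'g) set)"
    using U(1) by (intro open_vimage continuous_intros) auto
  have "{0} \<times> V \<subseteq> (\<lambda>p. fst p + snd p) -` U" using U(2) by auto
  from Elementary_Topology.tube_lemma[OF V W this]
  obtain N where N: "0 \<in> N" "open N" "N \<times> V \<subseteq> (\<lambda>p. fst p + snd p) -` U" by blast
  have "measure \<mu> ((+) r ` V - V) < e" if "r \<in> N" for r
  proof -
    have "(+) r ` V \<subseteq> U" using N(3) that by auto
    then have "measure \<mu> ((+) r ` V - V) \<le> measure \<mu> (U - V)"
      using U(1) borel_compact[OF V] borel_shift[OF borel_compact[OF V]]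
      by (intro measure_mono_fmeasurable) (auto intro: fmeasurableI2[OF U_fin])
    also have "\<dots> = measure \<mu> U - measure \<mu> V"
      using U finU borel_compact[OF V] by (intro measure_Diff) auto
    finally show ?thesis using less by simp
  qed
  then show thesis using N that by blast
qed

text \<open>
  Up to an arbitrarily small error, \<open>g\<close> lives on the set where \<open>\<bar>g\<bar>\<close> is between \<open>1 / n\<close> and \<open>n\<close>. This set
  has finite measure, and on it a set of small measure contributes little.
\<close>

lemma integrable_tight:
  fixes g :: "'g \<Rightarrow> complex"
  assumes g: "integrable \<mu> g" and e: "e > 0"
  obtains K where "compact K" "(\<integral>t. cmod (g t) * indicator (- K) t \<partial>\<mu>) < e"
proof -
  have [measurable]: "g \<in> borel_measurable borel" using borel_measurable_integrable[OF g] by simp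
  define B where "B n = {t. 1 / real (Suc n) \<le> cmod (g t) \<and> cmod (g t) \<le> real (Suc n)}" for n
  have B [measurable]: "B n \<in> sets borel" for n unfolding B_def by measurable
  have "(\<lambda>n. \<integral>t. cmod (g t) * indicator (- B n) t \<partial>\<mu>) \<longlonglongrightarrow> (\<integral>t. 0 \<partial>\<mu>)"
  proof (rule integral_dominated_convergence)
    show "integrable \<mu> (\<lambda>t. cmod (g t))" using g by simp
    show "AE t in \<mu>. (\<lambda>n. cmod (g t) * indicator (- B n) t) \<longlonglongrightarrow> 0"
    proof (rule AE_I2)
      fix t
      have "\<forall>\<^sub>F n in sequentially. cmod (g t) * indicator (- B n) t = 0"
      proof (cases "g t = 0")
        case False
        obtain n1 where n1: "1 / real (Suc n1) < cmod (g t)"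
          using nat_approx_posE[of "cmod (g t)"] False by auto
        obtain n2 where n2: "cmod (g t) \<le> real n2" using real_arch_simple by blast
        have "t \<in> B n" if "n \<ge> max n1 n2" for n
        proof -
          have "1 / real (Suc n) \<le> 1 / real (Suc n1)" using that by (simp add: frac_le)
          then show ?thesis using n1 n2 that by (simp add: B_def)
        qed
        then show ?thesis unfolding eventually_sequentially by (intro exI[of _ "max n1 n2"]) simp
      qed simp
      then show "(\<lambda>n. cmod (g t) * indicator (- B n) t) \<longlonglongrightarrow> 0" by (rule tendsto_eventually)
    qed
    show "AE t in \<mu>. norm (cmod (g t) * indicator (- B n) t) \<le> cmod (g t)" for n
      by (rule AE_I2) (simp add: indicator_def)
  qed measurable
  then have "\<forall>\<^sub>F n in sequentially. (\<integral>t. cmod (g t) * indicator (- B n) t \<partial>\<mu>) < e / 2"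
    using e by (intro order_tendstoD(2)) auto
  then obtain n where n: "(\<integral>t. cmod (g t) * indicator (- B n) t \<partial>\<mu>) < e / 2"
    by (auto simp: eventually_sequentially)
  have "emeasure \<mu> (B n) \<le> emeasure \<mu> {t \<in> space \<mu>. 1 / real (Suc n) \<le> cmod (g t)}"
    by (intro emeasure_mono) (auto simp: B_def)
  also have "\<dots> \<le> ennreal (1 / (1 / real (Suc n)) * (\<integral>t. cmod (g t) \<partial>\<mu>))"
    using g by (intro integral_Markov_inequality) auto
  finally have Bfin: "emeasure \<mu> (B n) < \<infinity>" by (metis ennreal_less_top infinity_ennreal_def le_less_trans)
  obtain K where K: "compact K" "measure \<mu> (B n - K) < e / (2 * real (Suc n))"
    using compact_tight[OF B Bfin, of "e / (2 * real (Suc n))"] e by auto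
  have [measurable]: "K \<in> sets borel" by (rule borel_compact[OF K(1)])
  have fin: "B n - K \<in> fmeasurable \<mu>"
    using Bfin by (auto simp: fmeasurable_def intro!: order_le_less_trans[OF emeasure_mono Bfin[unfolded infinity_ennreal_def]])
  have int1: "integrable \<mu> (\<lambda>t. cmod (g t) * indicator (- A) t)" if [measurable]: "A \<in> sets borel" for A
    using g by (intro Bochner_Integration.integrable_bound[OF integrable_norm[OF g]]) (auto simp: indicator_def)
  have int2: "integrable \<mu> (\<lambda>t. real (Suc n) * indicator (B n - K) t)"
    using fin by (intro integrable_mult_right) (auto simp: fmeasurable_def integrable_indicator_iff)
  have "(\<integral>t. cmod (g t) * indicator (- K) t \<partial>\<mu>) \<le>
      (\<integral>t. cmod (g t) * indicator (- B n) t + real (Suc n) * indicator (B n - K) t \<partial>\<mu>)"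
    by (intro integral_mono int1 int2 Bochner_Integration.integrable_add) (auto simp: B_def indicator_def)
  also have "\<dots> = (\<integral>t. cmod (g t) * indicator (- B n) t \<partial>\<mu>) + real (Suc n) * measure \<mu> (B n - K)"
    using int1 int2 by (subst Bochner_Integration.integral_add) auto
  also have "\<dots> < e / 2 + real (Suc n) * (e / (2 * real (Suc n)))"
    using n K(2) by (intro add_strict_mono mult_strict_left_mono) auto
  also have "\<dots> = e" by (simp add: field_simps)
  finally show thesis using that K(1) by blast
qed

end


section \<open>The predual\<close>

context haar_measure
begin

lemma pairing_integrable:
  assumes "\<phi> \<in> Cb" "integrable \<mu> g"
  shows "integrable \<mu> (\<lambda>t. \<phi> t * g t)"
proof -
  obtain B where B: "\<And>t. cmod (\<phi> t) \<le> B" using Cb_bound[OF assms(1)] by blast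
  have [measurable]: "\<phi> \<in> borel_measurable borel" "g \<in> borel_measurable borel"
    using Cb_measurable[OF assms(1)] borel_measurable_integrable[OF assms(2)] by simp_all
  show ?thesis
  proof (rule Bochner_Integration.integrable_bound)
    show "integrable \<mu> (\<lambda>t. B * cmod (g t))" using assms(2) by simp
    show "AE t in \<mu>. norm (\<phi> t * g t) \<le> norm (B * cmod (g t))"
      using order_trans[OF B abs_ge_self] by (intro AE_I2) (simp add: norm_mult abs_mult mult_right_mono)
  qed measurable
qed

lemma pairing_diff:
  assumes "\<phi> \<in> Cb" "integrable \<mu> g" "integrable \<mu> h"
  shows "pairing \<mu> \<phi> (\<lambda>t. g t - h t) = pairing \<mu> \<phi> g - pairing \<mu> \<phi> h"
  unfolding pairing_def
  using Bochner_Integration.integral_diff[OF pairing_integrable[OF assms(1,2)] pairing_integrable[OF assms(1,3)]]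
  by (simp add: algebra_simps)

lemma cmod_pairing_le:
  assumes "\<phi> \<in> Cb" "integrable \<mu> g" and B: "\<And>t. cmod (\<phi> t) \<le> B"
  shows "cmod (pairing \<mu> \<phi> g) \<le> B * (\<integral>t. cmod (g t) \<partial>\<mu>)"
proof -
  have "cmod (pairing \<mu> \<phi> g) \<le> (\<integral>t. cmod (\<phi> t * g t) \<partial>\<mu>)"
    unfolding pairing_def by (rule integral_norm_bound)
  also have "\<dots> \<le> (\<integral>t. B * cmod (g t) \<partial>\<mu>)"
    using assms pairing_integrable[OF assms(1,2)]
    by (intro integral_mono integrable_norm integrable_mult_right) (auto simp: norm_mult mult_right_mono)
  finally show ?thesis by simp
qed

lemma Xd_norm_bdd:
  assumes "integrable \<mu> g" "1 \<le> d"
  shows "bdd_above ((\<lambda>\<phi>. cmod (pairing \<mu> \<phi> g)) ` {\<phi> \<in> Md d. Md_norm d \<phi> \<le> 1})"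
proof (rule bdd_aboveI2)
  fix \<phi> :: "'g \<Rightarrow> complex" assume "\<phi> \<in> {\<phi> \<in> Md d. Md_norm d \<phi> \<le> 1}"
  then have \<phi>: "\<phi> \<in> Md d" "Md_norm d \<phi> \<le> 1" by auto
  show "cmod (pairing \<mu> \<phi> g) \<le> 1 * (\<integral>t. cmod (g t) \<partial>\<mu>)"
    using cmod_le_Md_norm[OF \<phi>(1) assms(2)] \<phi>(2) order_trans
    by (intro cmod_pairing_le Md_imp_Cb[OF \<phi>(1)] assms) blast
qed

lemma cmod_pairing_le_Xd_norm:
  assumes \<phi>: "\<phi> \<in> Md d" "Md_norm d \<phi> \<le> C" and C: "0 < C" and g: "integrable \<mu> g" and d: "1 \<le> d"
  shows "cmod (pairing \<mu> \<phi> g) \<le> C * Xd_norm \<mu> d g"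
proof -
  \<comment> \<open>The norm of the predual is a supremum over the unit ball, hence the scaling.\<close>
  let ?\<psi> = "\<lambda>s. complex_of_real (1 / C) * \<phi> s"
  have "cmod (complex_of_real (1 / C)) * C = 1" using C by (simp add: norm_divide)
  then have "?\<psi> \<in> Md d" "Md_norm d ?\<psi> \<le> 1"
    using Md_scale[OF \<phi> d, of "complex_of_real (1 / C)"] by metis+
  then have le: "cmod (pairing \<mu> ?\<psi> g) \<le> Xd_norm \<mu> d g"
    unfolding Xd_norm_def by (intro cSUP_upper Xd_norm_bdd g d) auto
  have "pairing \<mu> ?\<psi> g = complex_of_real (1 / C) * pairing \<mu> \<phi> g"
    unfolding pairing_def by (simp only: mult.assoc integral_mult_right_zero)
  then have "cmod (pairing \<mu> \<phi> g) = C * cmod (pairing \<mu> ?\<psi> g)" using C by (simp add: norm_mult norm_divide)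
  then show ?thesis using mult_left_mono[OF le, of C] C by simp
qed

lemma Xd_norm_zero: "Xd_norm \<mu> d (\<lambda>t. 0) = 0"
  unfolding Xd_norm_def pairing_def using one_Md[where 'g = 'g] by (auto intro!: cSUP_const)

lemma Xd_nonempty: "x \<in> Xd \<mu> d \<Longrightarrow> \<exists>g. g \<in> x"
  by (auto simp: Xd_def quotient_def Xd_equiv_def Xd_norm_zero)

lemma Xd_member_Cauchy: "x \<in> Xd \<mu> d \<Longrightarrow> g \<in> x \<Longrightarrow> g \<in> Xd_Cauchy \<mu> d"
  by (auto simp: Xd_def quotient_def Xd_equiv_def)

text \<open>
  Equivalent sequences differ by a null sequence for the norm of the predual, which dominates the
  pairing with a multiplier. Hence the limits along all members of a class exist and agree, which is
  what the definite description in \<^const>\<open>Xd_pairing\<close> needs.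
\<close>

lemma tendsto_Xd_pairing:
  assumes x: "x \<in> Xd \<mu> d" and \<phi>: "\<phi> \<in> Md d" and d: "1 \<le> d" and f: "f \<in> x"
  shows "(\<lambda>n. pairing \<mu> \<phi> (f n)) \<longlonglongrightarrow> Xd_pairing \<mu> \<phi> x"
proof -
  obtain g where g: "g \<in> Xd_Cauchy \<mu> d" "x = Xd_equiv \<mu> d `` {g}"
    using x by (auto simp: Xd_def quotient_def)
  have int: "integrable \<mu> (g n)" for n using g(1) by (simp add: Xd_Cauchy_def)
  have gx: "g \<in> x" using g by (simp add: Xd_equiv_def Xd_norm_zero)
  define C where "C = max 1 (Md_norm d \<phi>)"
  have C: "0 < C" "Md_norm d \<phi> \<le> C" by (auto simp: C_def)
  note le = cmod_pairing_le_Xd_norm[OF \<phi> C(2,1) _ d]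
  note diff = pairing_diff[OF Md_imp_Cb[OF \<phi>]]
  have "Cauchy (\<lambda>n. pairing \<mu> \<phi> (g n))"
  proof (rule metric_CauchyI)
    fix e :: real assume "e > 0"
    then have "e / C > 0" using C by simp
    then obtain N where N: "\<And>m n. m \<ge> N \<Longrightarrow> n \<ge> N \<Longrightarrow> Xd_norm \<mu> d (\<lambda>t. g m t - g n t) < e / C"
      using g(1) unfolding Xd_Cauchy_def by blast
    have "dist (pairing \<mu> \<phi> (g m)) (pairing \<mu> \<phi> (g n)) < e" if "m \<ge> N" "n \<ge> N" for m n
    proof -
      have "dist (pairing \<mu> \<phi> (g m)) (pairing \<mu> \<phi> (g n)) \<le> C * Xd_norm \<mu> d (\<lambda>t. g m t - g n t)"
        unfolding dist_norm diff[OF int int, symmetric] by (intro le Bochner_Integration.integrable_diff int)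
      also have "\<dots> < C * (e / C)" using N[OF that] C(1) by (rule mult_strict_left_mono)
      finally show ?thesis using C(1) by simp
    qed
    then show "\<exists>N. \<forall>m\<ge>N. \<forall>n\<ge>N. dist (pairing \<mu> \<phi> (g m)) (pairing \<mu> \<phi> (g n)) < e" by blast
  qed
  then obtain c where c: "(\<lambda>n. pairing \<mu> \<phi> (g n)) \<longlonglongrightarrow> c" using Cauchy_convergent convergent_def by blast
  have all: "(\<lambda>n. pairing \<mu> \<phi> (h n)) \<longlonglongrightarrow> c" if h: "h \<in> x" for h
  proof -
    have h': "h \<in> Xd_Cauchy \<mu> d" "(\<lambda>n. Xd_norm \<mu> d (\<lambda>t. g n t - h n t)) \<longlonglongrightarrow> 0"
      using h g by (auto simp: Xd_equiv_def)
    have int': "integrable \<mu> (h n)" for n using h'(1) by (simp add: Xd_Cauchy_def)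
    have "norm (pairing \<mu> \<phi> (g n) - pairing \<mu> \<phi> (h n)) \<le> C * Xd_norm \<mu> d (\<lambda>t. g n t - h n t)" for n
      unfolding diff[OF int int', symmetric] by (intro le Bochner_Integration.integrable_diff int int')
    then have "(\<lambda>n. pairing \<mu> \<phi> (g n) - pairing \<mu> \<phi> (h n)) \<longlonglongrightarrow> 0"
      by (intro Lim_null_comparison[OF _ tendsto_mult_right_zero[OF h'(2), of C]]) simp
    from tendsto_diff[OF c this] show ?thesis by simp
  qed
  have "Xd_pairing \<mu> \<phi> x = c"
    unfolding Xd_pairing_def
  proof (rule the_equality)
    show "\<forall>g\<in>x. (\<lambda>n. pairing \<mu> \<phi> (g n)) \<longlonglongrightarrow> c" using all by blast
    show "c' = c" if "\<forall>g\<in>x. (\<lambda>n. pairing \<mu> \<phi> (g n)) \<longlonglongrightarrow> c'" for c'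
      using that gx c LIMSEQ_unique by blast
  qed
  then show ?thesis using all[OF f] by simp
qed

lemma Xd_pairing_const:
  assumes g: "integrable \<mu> g" and d: "1 \<le> d"
  defines "x \<equiv> Xd_equiv \<mu> d `` {\<lambda>_. g}"
  shows "x \<in> Xd \<mu> d" and "\<phi> \<in> Md d \<Longrightarrow> Xd_pairing \<mu> \<phi> x = pairing \<mu> \<phi> g"
proof -
  have C: "(\<lambda>_. g) \<in> Xd_Cauchy \<mu> d" using g by (simp add: Xd_Cauchy_def Xd_norm_zero)
  then show x: "x \<in> Xd \<mu> d" by (auto simp: Xd_def quotient_def x_def)
  assume \<phi>: "\<phi> \<in> Md d"
  obtain h where h: "h \<in> x" using Xd_nonempty[OF x] by blast
  have h': "h \<in> Xd_Cauchy \<mu> d" "(\<lambda>n. Xd_norm \<mu> d (\<lambda>t. g t - h n t)) \<longlonglongrightarrow> 0"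
    using h by (auto simp: Xd_equiv_def x_def)
  have int: "integrable \<mu> (h n)" for n using h'(1) by (simp add: Xd_Cauchy_def)
  define C where "C = max 1 (Md_norm d \<phi>)"
  have C: "0 < C" "Md_norm d \<phi> \<le> C" by (auto simp: C_def)
  have "norm (pairing \<mu> \<phi> g - pairing \<mu> \<phi> (h n)) \<le> C * Xd_norm \<mu> d (\<lambda>t. g t - h n t)" for n
    unfolding pairing_diff[OF Md_imp_Cb[OF \<phi>] g int, symmetric]
    by (intro cmod_pairing_le_Xd_norm[OF \<phi> C(2,1) _ d] Bochner_Integration.integrable_diff g int)
  then have "(\<lambda>n. pairing \<mu> \<phi> g - pairing \<mu> \<phi> (h n)) \<longlonglongrightarrow> 0"
    by (intro Lim_null_comparison[OF _ tendsto_mult_right_zero[OF h'(2), of C]]) simp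
  then have "(\<lambda>n. pairing \<mu> \<phi> (h n)) \<longlonglongrightarrow> pairing \<mu> \<phi> g"
    using tendsto_diff[OF tendsto_const[of "pairing \<mu> \<phi> g"], of _ 0] by fastforce
  then show "Xd_pairing \<mu> \<phi> x = pairing \<mu> \<phi> g" using tendsto_Xd_pairing[OF x \<phi> d h] LIMSEQ_unique by blast
qed

lemma topspace_Md_weak: "1 \<le> d \<Longrightarrow> topspace (Md_weak_topology \<mu> d) = Md d"
proof -
  assume d: "1 \<le> d"
  have "integrable \<mu> (\<lambda>_. 0 :: complex)" by simp
  from Xd_pairing_const(1)[OF this d]
  have "Md d \<in> {{\<phi>\<in>Md d. Xd_pairing \<mu> \<phi> x \<in> U} | x U. x \<in> Xd \<mu> d \<and> open U}"
    by (intro CollectI exI[of _ "Xd_equiv \<mu> d `` {\<lambda>_ _. 0}"] exI[of _ UNIV]) simp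
  then show ?thesis unfolding Md_weak_topology_def topology_generated_by_topspace by blast
qed

end


section \<open>Weak amenability as approximation of the unit on compact sets\<close>

abbreviation Cc_multipliers :: "nat \<Rightarrow> real \<Rightarrow> ('g::topological_group_add \<Rightarrow> complex) set" where
  "Cc_multipliers d C \<equiv> {\<phi> \<in> Cc \<inter> Md d. Md_norm d \<phi> \<le> C}"

definition unit_locally_uniform_limit :: "('g::topological_space \<Rightarrow> complex) set \<Rightarrow> bool" where
  "unit_locally_uniform_limit F \<longleftrightarrow>
     (\<forall>K. \<forall>e>0. compact K \<longrightarrow> (\<exists>\<phi>\<in>F. \<forall>t\<in>K. cmod (\<phi> t - 1) < e))"

context haar_measure
begin

lemma weakly_amenable_pairing:
  assumes amen: "Md_weakly_amenable_with \<mu> d C" and d: "1 \<le> d" and "finite I"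
    and "\<And>i. i \<in> I \<Longrightarrow> integrable \<mu> (g i)" and e: "e > 0"
  shows "\<exists>\<phi>\<in>Cc \<inter> Md d. Md_norm d \<phi> \<le> C \<and> (\<forall>i\<in>I. cmod (pairing \<mu> \<phi> (g i) - pairing \<mu> (\<lambda>_. 1) (g i)) < e)"
proof -
  define W where "W i = {\<phi>\<in>Md d. Xd_pairing \<mu> \<phi> (Xd_equiv \<mu> d `` {\<lambda>_. g i}) \<in> ball (pairing \<mu> (\<lambda>_. 1) (g i)) e}" for i
  have W: "openin (Md_weak_topology \<mu> d) (W i)" if "i \<in> I" for i
    unfolding Md_weak_topology_def W_def
    using Xd_pairing_const(1)[OF assms(4)[OF that] d] open_ball by (intro topology_generated_by_Basis) blast
  have "openin (Md_weak_topology \<mu> d) (Md d \<inter> \<Inter> (W ` I))"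
  proof (cases "I = {}")
    case True
    then show ?thesis using openin_topspace[of "Md_weak_topology \<mu> d"] topspace_Md_weak[OF d] by simp
  next
    case False
    then have "openin (Md_weak_topology \<mu> d) (\<Inter> (W ` I))"
      using W assms(3) by (intro openin_Inter) auto
    then show ?thesis
      using openin_topspace[of "Md_weak_topology \<mu> d"] topspace_Md_weak[OF d] by (simp add: openin_Int)
  qed
  moreover have "(\<lambda>_. 1) \<in> Md d \<inter> \<Inter> (W ` I)"
    using one_Md(1) e by (auto simp: W_def Xd_pairing_const(2)[OF assms(4) d one_Md(1)])
  moreover have "\<exists>y. y \<in> Cc_multipliers d C \<and> y \<in> T"
    if "openin (Md_weak_topology \<mu> d) T" "(\<lambda>_. 1) \<in> T" for T
    using amen that unfolding Md_weakly_amenable_with_def in_closure_of by blast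
  ultimately obtain \<phi> where \<phi>: "\<phi> \<in> Cc \<inter> Md d" "Md_norm d \<phi> \<le> C" "\<phi> \<in> Md d \<inter> \<Inter> (W ` I)"
    by blast
  have "cmod (pairing \<mu> \<phi> (g i) - pairing \<mu> (\<lambda>_. 1) (g i)) < e" if i: "i \<in> I" for i
  proof -
    have "\<phi> \<in> W i" "\<phi> \<in> Md d" using \<phi>(3) i by auto
    then show ?thesis
      using Xd_pairing_const(2)[OF assms(4)[OF i] d] by (simp add: W_def dist_norm norm_minus_commute)
  qed
  then show ?thesis using \<phi> by blast
qed

text \<open>
  Let \<open>near K e\<close> be the set of admissible multipliers within \<open>e\<close> of \<open>1\<close> on \<open>K\<close>. Every weak neighbourhood
  of \<open>1\<close> contains such a set. For a subbasic neighbourhood, given by a class \<open>x\<close>, a late member \<open>g\<close> of a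
  sequence in \<open>x\<close> has almost the same pairing with all admissible multipliers at once, and \<open>K\<close> is
  chosen to carry most of the mass of \<open>g\<close>.
\<close>

lemma weakly_amenable_if_unit_locally_uniform_limit:
  assumes unif: "unit_locally_uniform_limit (Cc_multipliers d C :: ('g \<Rightarrow> complex) set)"
    and d: "1 \<le> d" and C: "1 \<le> C"
  shows "Md_weakly_amenable_with \<mu> d C"
proof -
  let ?F = "(Cc_multipliers d C :: ('g \<Rightarrow> complex) set)" and ?one = "\<lambda>_ :: 'g. 1 :: complex"
  define near where "near K e = {\<phi> \<in> ?F. \<forall>t\<in>K. cmod (\<phi> t - 1) < e}" for K e
  have one: "?one \<in> Md d" "Md_norm d ?one \<le> C" using one_Md[where 'g = 'g and d = d] C by auto
  have basic: "\<exists>K e. compact K \<and> e > 0 \<and> near K e \<subseteq> {\<phi>\<in>Md d. Xd_pairing \<mu> \<phi> x \<in> U}"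
    if x: "x \<in> Xd \<mu> d" and U: "open U" "Xd_pairing \<mu> ?one x \<in> U" for x U
  proof -
    obtain r where r: "r > 0" "\<And>z. dist z (Xd_pairing \<mu> ?one x) < r \<Longrightarrow> z \<in> U"
      using U unfolding open_dist by blast
    obtain g0 where g0: "g0 \<in> x" "g0 \<in> Xd_Cauchy \<mu> d" using Xd_nonempty[OF x] Xd_member_Cauchy[OF x] by blast
    have "r / (6 * C) > 0" using r(1) C by simp
    then obtain N where N: "\<And>m n. m \<ge> N \<Longrightarrow> n \<ge> N \<Longrightarrow> Xd_norm \<mu> d (\<lambda>t. g0 m t - g0 n t) < r / (6 * C)"
      using g0(2) unfolding Xd_Cauchy_def by blast
    define g where "g = g0 N"
    have g0_int: "integrable \<mu> (g0 n)" for n using g0(2) by (simp add: Xd_Cauchy_def)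
    then have g: "integrable \<mu> g" by (simp add: g_def)
    have close: "cmod (Xd_pairing \<mu> \<phi> x - pairing \<mu> \<phi> g) \<le> r / 6"
      if \<phi>: "\<phi> \<in> Md d" "Md_norm d \<phi> \<le> C" for \<phi>
    proof -
      have "(\<lambda>n. cmod (pairing \<mu> \<phi> (g0 n) - pairing \<mu> \<phi> g)) \<longlonglongrightarrow> cmod (Xd_pairing \<mu> \<phi> x - pairing \<mu> \<phi> g)"
        by (intro tendsto_intros tendsto_Xd_pairing[OF x \<phi>(1) d g0(1)])
      moreover have "cmod (pairing \<mu> \<phi> (g0 n) - pairing \<mu> \<phi> g) \<le> r / 6" if n: "n \<ge> N" for n
      proof -
        have "cmod (pairing \<mu> \<phi> (g0 n) - pairing \<mu> \<phi> g) \<le> C * Xd_norm \<mu> d (\<lambda>t. g0 n t - g t)"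
          unfolding pairing_diff[OF Md_imp_Cb[OF \<phi>(1)] g0_int g, symmetric] using C
          by (intro cmod_pairing_le_Xd_norm[OF \<phi> _ _ d] Bochner_Integration.integrable_diff g0_int g) simp
        also have "\<dots> \<le> C * (r / (6 * C))"
          using N[OF n order_refl] C by (intro mult_left_mono) (auto simp: g_def)
        also have "\<dots> = r / 6" using C by simp
        finally show ?thesis .
      qed
      ultimately show ?thesis by (intro LIMSEQ_le_const2) blast+
    qed
    define I where "I = (\<integral>t. cmod (g t) \<partial>\<mu>)"
    have I: "0 \<le> I" by (simp add: I_def)
    obtain K where K: "compact K" "(\<integral>t. cmod (g t) * indicator (- K) t \<partial>\<mu>) < r / (6 * (C + 1))"
      using integrable_tight[OF g, of "r / (6 * (C + 1))"] r(1) C by auto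
    define e where "e = r / (6 * (I + 1))"
    have e: "e > 0" using r(1) I by (simp add: e_def)
    have "Xd_pairing \<mu> \<phi> x \<in> U" if \<phi>: "\<phi> \<in> near K e" for \<phi>
    proof -
      have \<phi>': "\<phi> \<in> Md d" "Md_norm d \<phi> \<le> C" "\<And>t. t \<in> K \<Longrightarrow> cmod (\<phi> t - 1) < e"
        using \<phi> by (auto simp: near_def)
      have [measurable]: "K \<in> sets borel" "g \<in> borel_measurable borel"
        using borel_compact[OF K(1)] borel_measurable_integrable[OF g] by simp_all
      have int: "integrable \<mu> (\<lambda>t. cmod (g t) * indicator (- K) t)"
        by (intro Bochner_Integration.integrable_bound[OF integrable_norm[OF g]]) (auto simp: indicator_def)
      have "pairing \<mu> \<phi> g - pairing \<mu> ?one g = (\<integral>t. \<phi> t * g t - 1 * g t \<partial>\<mu>)"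
        unfolding pairing_def
        by (intro Bochner_Integration.integral_diff[symmetric] pairing_integrable Md_imp_Cb[OF \<phi>'(1)] Md_imp_Cb[OF one(1)] g)
      also have "cmod \<dots> \<le> (\<integral>t. cmod (\<phi> t * g t - 1 * g t) \<partial>\<mu>)" by (rule integral_norm_bound)
      also have "\<dots> \<le> (\<integral>t. e * cmod (g t) + (C + 1) * (cmod (g t) * indicator (- K) t) \<partial>\<mu>)"
      proof (rule integral_mono)
        show "integrable \<mu> (\<lambda>t. cmod (\<phi> t * g t - 1 * g t))"
          by (intro integrable_norm Bochner_Integration.integrable_diff pairing_integrable Md_imp_Cb[OF \<phi>'(1)] Md_imp_Cb[OF one(1)] g)
        show "integrable \<mu> (\<lambda>t. e * cmod (g t) + (C + 1) * (cmod (g t) * indicator (- K) t))"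
          using g int by simp
        fix t
        have eq: "cmod (\<phi> t * g t - 1 * g t) = cmod (\<phi> t - 1) * cmod (g t)"
          by (simp flip: norm_mult add: algebra_simps)
        show "cmod (\<phi> t * g t - 1 * g t) \<le> e * cmod (g t) + (C + 1) * (cmod (g t) * indicator (- K) t)"
        proof (cases "t \<in> K")
          case True
          then show ?thesis unfolding eq using \<phi>'(3)[OF True] by (simp add: mult_right_mono)
        next
          case False
          have "cmod (\<phi> t - 1) \<le> cmod (\<phi> t) + 1" using norm_triangle_ineq4[of "\<phi> t" 1] by simp
          also have "\<dots> \<le> C + 1" using cmod_le_Md_norm[OF \<phi>'(1) d, of t] \<phi>'(2) by simp
          finally have "cmod (\<phi> t - 1) * cmod (g t) \<le> (C + 1) * cmod (g t)" by (simp add: mult_right_mono)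
          moreover have "0 \<le> e * cmod (g t)" using e by simp
          ultimately show ?thesis unfolding eq using False by simp
        qed
      qed
      also have "\<dots> = e * I + (C + 1) * (\<integral>t. cmod (g t) * indicator (- K) t \<partial>\<mu>)"
        using g int by (simp add: I_def)
      also have "\<dots> \<le> r / 6 + r / 6"
      proof (rule add_mono)
        have "e * I \<le> e * (I + 1)" using e by simp
        also have "\<dots> = r / 6" using I by (simp add: e_def field_simps)
        finally show "e * I \<le> r / 6" .
        have "(C + 1) * (\<integral>t. cmod (g t) * indicator (- K) t \<partial>\<mu>) \<le> (C + 1) * (r / (6 * (C + 1)))"
          using K(2) C by (intro mult_left_mono) auto
        also have "\<dots> = r / 6" using C by (simp add: field_simps)
        finally show "(C + 1) * (\<integral>t. cmod (g t) * indicator (- K) t \<partial>\<mu>) \<le> r / 6" .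
      qed
      finally have "cmod (pairing \<mu> \<phi> g - pairing \<mu> ?one g) \<le> r / 3" by simp
      moreover have "dist (Xd_pairing \<mu> \<phi> x) (Xd_pairing \<mu> ?one x) \<le>
          dist (Xd_pairing \<mu> \<phi> x) (pairing \<mu> \<phi> g) + dist (pairing \<mu> \<phi> g) (pairing \<mu> ?one g) +
          dist (pairing \<mu> ?one g) (Xd_pairing \<mu> ?one x)"
        using dist_triangle[of "Xd_pairing \<mu> \<phi> x" "Xd_pairing \<mu> ?one x" "pairing \<mu> \<phi> g"]
          dist_triangle[of "pairing \<mu> \<phi> g" "Xd_pairing \<mu> ?one x" "pairing \<mu> ?one g"] by linarith
      ultimately show ?thesis
        using close[OF \<phi>'(1,2)] close[OF one] r(1)
        by (intro r(2)) (simp add: dist_norm norm_minus_commute)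
    qed
    then have "near K e \<subseteq> {\<phi>\<in>Md d. Xd_pairing \<mu> \<phi> x \<in> U}" by (auto simp: near_def)
    then show ?thesis using K(1) e by blast
  qed
  have "\<exists>K e. compact K \<and> e > 0 \<and> near K e \<subseteq> T"
    if "generate_topology_on {{\<phi>\<in>Md d. Xd_pairing \<mu> \<phi> x \<in> U} | x U. x \<in> Xd \<mu> d \<and> open U} T" "?one \<in> T" for T
    using that
  proof (induction rule: generate_topology_on.induct)
    case (Int a b)
    then obtain K e K' e' where *: "compact K" "e > 0" "near K e \<subseteq> a" "compact K'" "e' > 0" "near K' e' \<subseteq> b"
      by blast
    have "near (K \<union> K') (min e e') \<subseteq> near K e \<inter> near K' e'" by (auto simp: near_def)
    then have "near (K \<union> K') (min e e') \<subseteq> a \<inter> b" using *(3,6) by blast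
    then show ?case using * by (intro exI[of _ "K \<union> K'"] exI[of _ "min e e'"]) (simp add: compact_Un)
  next
    case (UN \<T>)
    then obtain a where a: "a \<in> \<T>" "?one \<in> a" by blast
    obtain K e where "compact K" "e > 0" "near K e \<subseteq> a" using UN.IH[OF a] by blast
    then show ?case using a(1) by (intro exI[of _ K] exI[of _ e]) blast
  next
    case (Basis s)
    then obtain x U where s: "s = {\<phi>\<in>Md d. Xd_pairing \<mu> \<phi> x \<in> U}" "x \<in> Xd \<mu> d" "open U" by blast
    then have "Xd_pairing \<mu> ?one x \<in> U" using Basis.prems by simp
    then show ?case unfolding s(1) by (rule basic[OF s(2,3)])
  qed simp
  then have nbhd: "\<exists>K e. compact K \<and> e > 0 \<and> near K e \<subseteq> T"
    if "openin (Md_weak_topology \<mu> d) T" "?one \<in> T" for T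
    using that unfolding Md_weak_topology_def openin_topology_generated_by_iff by simp
  have "\<exists>\<phi>. \<phi> \<in> ?F \<and> \<phi> \<in> T" if T: "openin (Md_weak_topology \<mu> d) T" "?one \<in> T" for T
  proof -
    obtain K e where K: "compact K" "e > 0" "near K e \<subseteq> T" using nbhd[OF T] by blast
    then obtain \<phi> where "\<phi> \<in> ?F" "\<forall>t\<in>K. cmod (\<phi> t - 1) < e"
      using unif unfolding unit_locally_uniform_limit_def by blast
    then have "\<phi> \<in> near K e" by (simp add: near_def)
    then show ?thesis using \<open>\<phi> \<in> ?F\<close> K(3) by blast
  qed
  then show ?thesis
    unfolding Md_weakly_amenable_with_def in_closure_of topspace_Md_weak[OF d] using one(1) by blast
qed

text \<open>
  A Riemann sum for the integral over \<open>V\<close>: the pieces of \<open>V\<close> are obtained by removing the sets \<open>N t\<close> one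
  after the other, and each is weighted by its measure.
\<close>

lemma right_translate_average:
  assumes "finite F" and \<phi>: "\<phi> \<in> Cb" and V: "V \<in> sets borel" "emeasure \<mu> V < \<infinity>"
    and N: "\<And>t. t \<in> F \<Longrightarrow> N t \<in> sets borel" and cover: "V \<subseteq> (\<Union>t\<in>F. N t)"
    and close: "\<And>t w s. t \<in> F \<Longrightarrow> w \<in> N t \<Longrightarrow> cmod (\<phi> (s + w) - \<phi> (s + t)) \<le> e"
  shows "\<exists>u. (\<Sum>(a, t)\<leftarrow>u. cmod a) = measure \<mu> V \<and>
    (\<forall>s. cmod ((\<integral>w. \<phi> (s + w) * indicator V w \<partial>\<mu>) - (\<Sum>(a, t)\<leftarrow>u. a * \<phi> (s + t))) \<le> e * measure \<mu> V)"
  using assms(1) V N cover close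
proof (induction F arbitrary: V rule: finite_induct)
  case empty
  then show ?case by (intro exI[of _ "[]"]) simp
next
  case (insert t F)
  let ?I = "\<lambda>s X. \<integral>w. \<phi> (s + w) * indicator X w \<partial>\<mu>"
  let ?A = "V \<inter> N t" and ?B = "V - N t"
  have meas [measurable]: "V \<in> sets borel" "N t \<in> sets borel" using insert.prems by auto
  have Vfin: "V \<in> fmeasurable \<mu>" using insert.prems by (simp add: fmeasurable_def)
  then have fin: "?A \<in> fmeasurable \<mu>" "?B \<in> fmeasurable \<mu>"
    by (auto intro: fmeasurableI2)
  obtain u where u: "(\<Sum>(a, t)\<leftarrow>u. cmod a) = measure \<mu> ?B"
      "\<And>s. cmod (?I s ?B - (\<Sum>(a, t)\<leftarrow>u. a * \<phi> (s + t))) \<le> e * measure \<mu> ?B"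
  proof -
    have "emeasure \<mu> ?B < \<infinity>" using fin(2) by (simp add: fmeasurable_def)
    moreover have "?B \<subseteq> (\<Union>t\<in>F. N t)" using insert.prems(4) by auto
    ultimately show thesis
      using insert.IH[of ?B] insert.prems(3,5) that by auto
  qed
  obtain B where B: "\<And>t. cmod (\<phi> t) \<le> B" using Cb_bound[OF \<phi>] by blast
  have shift_meas [measurable]: "(\<lambda>w. \<phi> (s + w)) \<in> borel_measurable borel" for s
  proof (rule borel_measurable_continuous_onI)
    have "continuous_on UNIV \<phi>" using \<phi> by (simp add: Cb_def)
    then show "continuous_on UNIV (\<lambda>w. \<phi> (s + w))"
      by (rule continuous_on_compose2) (auto intro!: continuous_intros)
  qed
  have ind: "integrable \<mu> (\<lambda>w. indicator A w :: complex)"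
      and ind_integral: "(\<integral>w. indicator A w \<partial>\<mu>) = complex_of_real (measure \<mu> A)"
    if "A \<in> fmeasurable \<mu>" for A
  proof -
    have "(\<integral>w. complex_of_real (indicator A w) \<partial>\<mu>) = complex_of_real (measure \<mu> A)"
      by (simp only: integral_complex_of_real) (simp add: Int_absorb1)
    moreover have "integrable \<mu> (\<lambda>w. complex_of_real (indicator A w))"
      using that by (intro integrable_of_real) (simp add: fmeasurable_def integrable_indicator_iff)
    moreover have "(\<lambda>w. complex_of_real (indicator A w)) = indicator A" by (auto simp: indicator_def)
    ultimately show "integrable \<mu> (\<lambda>w. indicator A w :: complex)"
        "(\<integral>w. indicator A w \<partial>\<mu>) = complex_of_real (measure \<mu> A)" by (simp_all only:)
  qed
  have int: "integrable \<mu> (\<lambda>w. \<phi> (s + w) * indicator A w)" if A: "A \<in> fmeasurable \<mu>" for A s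
  proof -
    have [measurable]: "A \<in> sets borel" using A by (simp add: fmeasurable_def)
    show ?thesis
    proof (rule Bochner_Integration.integrable_bound)
      show "integrable \<mu> (\<lambda>w. B * indicator A w)"
        using A by (intro integrable_mult_right) (simp add: fmeasurable_def integrable_indicator_iff)
      show "AE w in \<mu>. norm (\<phi> (s + w) * indicator A w) \<le> norm (B * indicator A w)"
        using order_trans[OF B abs_ge_self] by (intro AE_I2) (simp add: indicator_def)
    qed measurable
  qed
  define a where "a = measure \<mu> ?A"
  have sum: "measure \<mu> V = a + measure \<mu> ?B"
  proof -
    have "measure \<mu> (?A \<union> ?B) = measure \<mu> ?A + measure \<mu> ?B"
      using fin by (intro measure_Union) (auto simp: fmeasurable_def)
    moreover have "?A \<union> ?B = V" by blast
    ultimately show ?thesis by (simp add: a_def)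
  qed
  have "cmod (?I s V - (\<Sum>(a, t)\<leftarrow>(complex_of_real a, t) # u. a * \<phi> (s + t))) \<le> e * measure \<mu> V" for s
  proof -
    have "?I s V = (\<integral>w. \<phi> (s + w) * indicator ?A w + \<phi> (s + w) * indicator ?B w \<partial>\<mu>)"
      by (intro Bochner_Integration.integral_cong) (auto simp: indicator_def)
    also have "\<dots> = ?I s ?A + ?I s ?B"
      by (intro Bochner_Integration.integral_add int fin)
    finally have split: "?I s V =
      ?I s ?A + ?I s ?B" .
    have "?I s ?A - a * \<phi> (s + t) =
        (\<integral>w. \<phi> (s + w) * indicator ?A w - \<phi> (s + t) * indicator ?A w \<partial>\<mu>)"
      using ind[OF fin(1)] by (subst Bochner_Integration.integral_diff[OF int[OF fin(1)]]) (auto simp: a_def ind_integral[OF fin(1)])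
    also have "cmod \<dots> \<le> (\<integral>w. cmod (\<phi> (s + w) * indicator ?A w - \<phi> (s + t) * indicator ?A w) \<partial>\<mu>)"
      by (rule integral_norm_bound)
    also have "\<dots> \<le> (\<integral>w. e * indicator ?A w \<partial>\<mu>)"
    proof (rule integral_mono)
      show "integrable \<mu> (\<lambda>w. cmod (\<phi> (s + w) * indicator ?A w - \<phi> (s + t) * indicator ?A w))"
        using ind[OF fin(1)] by (intro integrable_norm Bochner_Integration.integrable_diff int fin integrable_mult_right)
      show "integrable \<mu> (\<lambda>w. e * indicator ?A w)"
        using fin(1) by (intro integrable_mult_right) (simp add: fmeasurable_def integrable_indicator_iff)
      show "cmod (\<phi> (s + w) * indicator ?A w - \<phi> (s + t) * indicator ?A w) \<le> e * indicator ?A w" for w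
        using insert.prems(5)[of t w s] by (auto simp: indicator_def)
    qed
    also have "\<dots> = e * a" by (simp add: a_def)
    finally have "cmod (?I s ?A - a * \<phi> (s + t)) \<le> e * a" .
    then have "cmod ((?I s ?A - a * \<phi> (s + t)) +
        (?I s ?B - (\<Sum>(a, t)\<leftarrow>u. a * \<phi> (s + t)))) \<le> e * a + e * measure \<mu> ?B"
      using u(2)[of s] by (intro norm_triangle_mono)
    then show ?thesis unfolding split sum by (simp add: algebra_simps)
  qed
  moreover have "(\<Sum>(a, t)\<leftarrow>(complex_of_real a, t) # u. cmod a) = measure \<mu> V"
    by (simp add: u(1) sum a_def)
  ultimately show ?case by (intro exI[of _ "(complex_of_real a, t) # u"]) blast
qed

lemma right_translate_average_Cc:
  assumes \<phi>: "\<phi> \<in> Cc" and V: "compact V" and e: "e > 0"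
  shows "\<exists>u. (\<Sum>(a, t)\<leftarrow>u. cmod a) = measure \<mu> V \<and>
    (\<forall>s. cmod ((\<integral>w. \<phi> (s + w) * indicator V w \<partial>\<mu>) - (\<Sum>(a, t)\<leftarrow>u. a * \<phi> (s + t))) \<le> e * measure \<mu> V)"
proof -
  obtain N where N: "open N" "0 \<in> N" "\<And>w s. w \<in> N \<Longrightarrow> cmod (\<phi> (s + w) - \<phi> s) \<le> e"
    using Cc_right_uniformly_continuous[OF \<phi> e] by metis
  have op: "open ((+) (- t) -` N)" for t
    using N(1) by (intro open_vimage continuous_intros) auto
  have "V \<subseteq> (\<Union>t\<in>V. (+) (- t) -` N)" using N(2) by auto
  then obtain F where F: "F \<subseteq> V" "finite F" "V \<subseteq> (\<Union>t\<in>F. (+) (- t) -` N)"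
    using compactE_image[OF V, of V "\<lambda>t. (+) (- t) -` N"] op by metis
  show ?thesis
  proof (rule right_translate_average[OF F(2) Cc_imp_Cb[OF \<phi>] borel_compact[OF V] emeasure_compact[OF V] _ F(3)])
    show "(+) (- t) -` N \<in> sets borel" for t using op by (rule borel_open)
    show "cmod (\<phi> (s + w) - \<phi> (s + t)) \<le> e" if "w \<in> (+) (- t) -` N" for t w s
      using N(3)[of "- t + w" "s + t"] that by (simp add: add.assoc)
  qed
qed

text \<open>
  With \<open>h s\<close> the normalized indicator function of \<open>s + V\<close>, the numbers \<open>\<psi> s\<close>, \<open>\<langle>\<phi>, h s\<rangle>\<close>,
  \<open>\<langle>\<phi>, h s0\<rangle>\<close> and \<open>1\<close> are close to each other in this order, for a suitable \<open>s0\<close> in a finite subset \<open>F\<close>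
  of \<open>K\<close>. The reasons are that \<open>\<psi>\<close> is a Riemann sum for the mean of right translates, that \<open>s \<mapsto> h s\<close> is
  continuous in \<open>L\<^sup>1\<close>, and that \<open>\<phi>\<close> is weakly close to \<open>1\<close> against the finitely many \<open>h s0\<close>.
\<close>

lemma unit_locally_uniform_limit_if_weakly_amenable:
  assumes amen: "Md_weakly_amenable_with \<mu> d C" and d: "1 \<le> d" and C: "1 \<le> C"
  shows "unit_locally_uniform_limit (Cc_multipliers d C :: ('g \<Rightarrow> complex) set)"
  unfolding unit_locally_uniform_limit_def
proof (intro allI impI)
  fix K :: "'g set" and e :: real
  assume e: "e > 0" and K: "compact K"
  obtain V where V: "compact V" "0 < measure \<mu> V" using compact_pos by blast
  define m where "m = measure \<mu> V"
  have m: "m > 0" using V(2) by (simp add: m_def)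
  have Vb: "V \<in> sets borel" by (rule borel_compact[OF V(1)])
  have shift_b: "(+) s ` V \<in> sets borel" for s :: 'g by (rule borel_shift[OF Vb])
  have shift_fin: "(+) s ` V \<in> fmeasurable \<mu>" for s :: 'g
    using shift_b emeasure_compact[OF compact_shift[OF V(1)]] by (simp add: fmeasurable_def)
  define h where "h s t = complex_of_real (indicator ((+) s ` V) t / m)" for s t :: 'g
  have h_int: "integrable \<mu> (h s)" for s
  proof -
    have "integrable \<mu> (\<lambda>t. indicator ((+) s ` V) t / m)"
      using shift_fin[of s] by (intro integrable_divide) (simp add: fmeasurable_def integrable_indicator_iff)
    then show ?thesis unfolding h_def by (rule integrable_of_real)
  qed
  define \<eta> where "\<eta> = e / (8 * (C + 1)) * m"
  have \<eta>: "\<eta> > 0" using e m C by (simp add: \<eta>_def)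
  obtain N0 where N0: "open N0" "0 \<in> N0" "\<And>r. r \<in> N0 \<Longrightarrow> measure \<mu> ((+) r ` V - V) < \<eta>"
    using compact_shift_small[OF V(1) \<eta>] by metis
  \<comment> \<open>Both differences of \<open>s + V\<close> and \<open>s0 + V\<close> have to be small, whence the symmetry.\<close>
  define N where "N = N0 \<inter> uminus -` N0"
  have N: "open N" "0 \<in> N" unfolding N_def using N0(1,2) by (auto intro!: open_Int open_vimage continuous_intros)
  \<comment> \<open>Translation by \<open>- s'\<close> moves the difference to one between \<open>V\<close> and a translate of \<open>V\<close>.\<close>
  have diff_small: "measure \<mu> ((+) s ` V - (+) s' ` V) < \<eta>" if "- s' + s \<in> N0" for s s'
  proof -
    have "(+) s ` V - (+) s' ` V = (+) s' ` ((+) (- s' + s) ` V - V)"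
      by (simp add: image_set_diff inj_on_def image_image flip: add.assoc)
    moreover have "(+) (- s' + s) ` V - V \<in> sets borel" using shift_b Vb by (rule sets.Diff)
    ultimately have "measure \<mu> ((+) s ` V - (+) s' ` V) = measure \<mu> ((+) (- s' + s) ` V - V)"
      using emeasure_shift by (simp add: measure_def)
    then show ?thesis using N0(3)[OF that] by simp
  qed
  have op: "open ((+) (- s) -` N)" for s using N(1) by (intro open_vimage continuous_intros) auto
  have "K \<subseteq> (\<Union>s\<in>K. (+) (- s) -` N)" using N(2) by auto
  then obtain F where F: "F \<subseteq> K" "finite F" "K \<subseteq> (\<Union>s\<in>F. (+) (- s) -` N)"
    using compactE_image[OF K, of K "\<lambda>s. (+) (- s) -` N"] op by metis
  obtain \<phi> where \<phi>: "\<phi> \<in> Cc" "\<phi> \<in> Md d" "Md_norm d \<phi> \<le> C"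
      "\<And>s. s \<in> F \<Longrightarrow> cmod (pairing \<mu> \<phi> (h s) - pairing \<mu> (\<lambda>_. 1) (h s)) < e / 4"
    using weakly_amenable_pairing[OF amen d F(2), of h "e / 4"] h_int e by auto
  obtain u where u: "(\<Sum>(a, t)\<leftarrow>u. cmod a) = m"
      "\<And>s. cmod ((\<integral>w. \<phi> (s + w) * indicator V w \<partial>\<mu>) - (\<Sum>(a, t)\<leftarrow>u. a * \<phi> (s + t))) \<le> e / 4 * m"
    using right_translate_average_Cc[OF \<phi>(1) V(1), of "e / 4"] e unfolding m_def by auto
  define v where "v = formal_scale (complex_of_real (1 / m)) u"
  define \<psi> where "\<psi> s = (\<Sum>(a, t)\<leftarrow>v. a * \<phi> (s + t))" for s
  have v_norm: "(\<Sum>(a, t)\<leftarrow>v. cmod a) = 1"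
  proof -
    have "(\<Sum>(a, t)\<leftarrow>formal_scale b u. cmod a) = cmod b * (\<Sum>(a, t)\<leftarrow>u. cmod a)" for b
      by (induction u) (auto simp: norm_mult distrib_left)
    then show ?thesis using m by (simp add: v_def u(1) norm_divide)
  qed
  have \<psi>_eq: "\<psi> s = (\<Sum>(a, t)\<leftarrow>u. a * \<phi> (s + t)) / m" for s
  proof -
    have "(\<Sum>(a, t)\<leftarrow>formal_scale b u. a * \<phi> (s + t)) = b * (\<Sum>(a, t)\<leftarrow>u. a * \<phi> (s + t))" for b
      by (induction u) (auto simp: distrib_left)
    then show ?thesis by (simp add: \<psi>_def v_def)
  qed
  have \<psi>: "\<psi> \<in> Cc" unfolding \<psi>_def by (rule Cc_right_translates[OF \<phi>(1)])
  have "\<psi> \<in> Md d" "Md_norm d \<psi> \<le> C"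
    using Md_right_translates[OF \<phi>(2,3) d, of v 1] v_norm Cc_imp_Cb[OF \<psi>] unfolding \<psi>_def by auto
  moreover have "cmod (\<psi> s - 1) < e" if "s \<in> K" for s
  proof -
    have \<phi>_Cb: "\<phi> \<in> Cb" by (rule Cc_imp_Cb[OF \<phi>(1)])
    have one: "pairing \<mu> (\<lambda>_. 1) (h s) = 1" for s
    proof -
      have "measure \<mu> ((+) s ` V) = m" using emeasure_shift[OF Vb] by (simp add: measure_def m_def)
      then have "(\<integral>t. indicator ((+) s ` V) t / m \<partial>\<mu>) = 1"
        using m shift_b by simp
      then show ?thesis unfolding pairing_def h_def by (simp only: mult_1 integral_complex_of_real of_real_1)
    qed
    have "cmod (\<psi> s - pairing \<mu> \<phi> (h s)) \<le> e / 4"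
    proof -
      have "pairing \<mu> \<phi> (h s) = (\<integral>t. \<phi> (s + t) * h s (s + t) \<partial>\<mu>)"
        unfolding pairing_def
        by (rule integral_shift[symmetric]) (use Cb_measurable[OF \<phi>_Cb] borel_measurable_integrable[OF h_int[of s]] in simp)
      also have "\<dots> = (\<integral>t. \<phi> (s + t) * indicator V t / m \<partial>\<mu>)"
        by (intro Bochner_Integration.integral_cong) (auto simp: h_def indicator_def)
      also have "\<dots> = (\<integral>t. \<phi> (s + t) * indicator V t \<partial>\<mu>) / m" by simp
      finally have "\<psi> s - pairing \<mu> \<phi> (h s) = - ((\<integral>t. \<phi> (s + t) * indicator V t \<partial>\<mu>) - (\<Sum>(a, t)\<leftarrow>u. a * \<phi> (s + t))) / m"
        by (simp add: \<psi>_eq diff_divide_distrib)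
      then have "cmod (\<psi> s - pairing \<mu> \<phi> (h s)) = cmod ((\<integral>t. \<phi> (s + t) * indicator V t \<partial>\<mu>) - (\<Sum>(a, t)\<leftarrow>u. a * \<phi> (s + t))) / m"
        using m by (simp add: norm_divide norm_minus_commute)
      also have "\<dots> \<le> e / 4 * m / m" using u(2)[of s] m by (intro divide_right_mono) auto
      finally show ?thesis using m by simp
    qed
    moreover obtain s0 where s0: "s0 \<in> F" "- s0 + s \<in> N" using F(3) \<open>s \<in> K\<close> by auto
    moreover have "cmod (pairing \<mu> \<phi> (h s) - pairing \<mu> \<phi> (h s0)) \<le> e / 4"
    proof -
      have "- (- s0 + s) = - s + s0" by (simp add: minus_add)
      then have small: "measure \<mu> ((+) s ` V - (+) s0 ` V) < \<eta>" "measure \<mu> ((+) s0 ` V - (+) s ` V) < \<eta>"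
        using s0(2) diff_small unfolding N_def by auto
      have fin: "(+) s ` V - (+) s' ` V \<in> fmeasurable \<mu>" for s s'
        using fmeasurableI2[OF shift_fin[of s]] shift_b by (simp add: sets.Diff)
      have ind: "integrable \<mu> (indicator ((+) s ` V - (+) s' ` V) :: 'g \<Rightarrow> real)" for s s'
        using fin[of s s'] by (simp add: fmeasurable_def integrable_indicator_iff)
      have "(\<integral>t. cmod (h s t - h s0 t) \<partial>\<mu>) \<le>
          (\<integral>t. (indicator ((+) s ` V - (+) s0 ` V) t + indicator ((+) s0 ` V - (+) s ` V) t) / m \<partial>\<mu>)"
      proof (rule integral_mono)
        show "integrable \<mu> (\<lambda>t. cmod (h s t - h s0 t))"
          by (intro integrable_norm Bochner_Integration.integrable_diff h_int)
        show "integrable \<mu> (\<lambda>t. (indicator ((+) s ` V - (+) s0 ` V) t + indicator ((+) s0 ` V - (+) s ` V) t) / m)"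
          by (intro integrable_divide Bochner_Integration.integrable_add ind)
        show "cmod (h s t - h s0 t) \<le> (indicator ((+) s ` V - (+) s0 ` V) t + indicator ((+) s0 ` V - (+) s ` V) t) / m" for t
          using m by (simp add: h_def indicator_def norm_divide)
      qed
      also have "\<dots> = (measure \<mu> ((+) s ` V - (+) s0 ` V) + measure \<mu> ((+) s0 ` V - (+) s ` V)) / m"
        using ind shift_b by (simp add: Bochner_Integration.integral_add sets.Diff)
      also have "\<dots> \<le> (\<eta> + \<eta>) / m" using small m by (intro divide_right_mono add_mono) auto
      also have "\<dots> = 2 * (e / (8 * (C + 1)))" using m by (simp add: \<eta>_def flip: distrib_right)
      also have "\<dots> = e / (4 * (C + 1))" using C by (simp add: divide_simps)
      finally have L1: "(\<integral>t. cmod (h s t - h s0 t) \<partial>\<mu>) \<le> e / (4 * (C + 1))" .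
      have "pairing \<mu> \<phi> (h s) - pairing \<mu> \<phi> (h s0) = pairing \<mu> \<phi> (\<lambda>t. h s t - h s0 t)"
        by (rule pairing_diff[symmetric, OF \<phi>_Cb h_int h_int])
      also have "cmod \<dots> \<le> C * (\<integral>t. cmod (h s t - h s0 t) \<partial>\<mu>)"
        using order_trans[OF cmod_le_Md_norm[OF \<phi>(2) d] \<phi>(3)]
        by (intro cmod_pairing_le \<phi>_Cb Bochner_Integration.integrable_diff h_int)
      also have "\<dots> \<le> C * (e / (4 * (C + 1)))" using L1 C by (intro mult_left_mono) auto
      also have "\<dots> \<le> (C + 1) * (e / (4 * (C + 1)))" using e C by (intro mult_right_mono) auto
      also have "\<dots> = e / 4" using C by (simp add: field_simps)
      finally show ?thesis .
    qed
    moreover have "cmod (pairing \<mu> \<phi> (h s0) - 1) < e / 4" using \<phi>(4)[OF s0(1)] by (simp only: one)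
    moreover have "cmod (\<psi> s - 1) \<le> cmod (\<psi> s - pairing \<mu> \<phi> (h s)) +
        cmod (pairing \<mu> \<phi> (h s) - pairing \<mu> \<phi> (h s0)) + cmod (pairing \<mu> \<phi> (h s0) - 1)"
      using norm_triangle_ineq[of "\<psi> s - pairing \<mu> \<phi> (h s)" "pairing \<mu> \<phi> (h s) - pairing \<mu> \<phi> (h s0)"]
        norm_triangle_ineq[of "\<psi> s - pairing \<mu> \<phi> (h s0)" "pairing \<mu> \<phi> (h s0) - 1"] by simp
    ultimately show ?thesis using e by linarith
  qed
  ultimately show "\<exists>\<phi>\<in>Cc_multipliers d C. \<forall>t\<in>K. cmod (\<phi> t - 1) < e"
    using \<psi> by blast
qed

theorem weakly_amenable_iff_unit_locally_uniform_limit: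
  assumes "1 \<le> d" "1 \<le> C"
  shows "Md_weakly_amenable_with \<mu> d C \<longleftrightarrow>
    unit_locally_uniform_limit (Cc_multipliers d C :: ('g \<Rightarrow> complex) set)"
  using weakly_amenable_if_unit_locally_uniform_limit unit_locally_uniform_limit_if_weakly_amenable assms
  by blast

end


section \<open>Products of weakly amenable groups\<close>

lemma Cc_tensor:
  fixes \<phi> :: "'g::t2_space \<Rightarrow> complex" and \<psi> :: "'h::t2_space \<Rightarrow> complex"
  assumes "\<phi> \<in> Cc" "\<psi> \<in> Cc"
  shows "(\<lambda>x. \<phi> (fst x) * \<psi> (snd x)) \<in> Cc"
proof -
  obtain S R where S: "compact S" "\<And>s. s \<notin> S \<Longrightarrow> \<phi> s = 0" and R: "compact R" "\<And>t. t \<notin> R \<Longrightarrow> \<psi> t = 0"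
    using CcE[OF assms(1)] CcE[OF assms(2)] by metis
  show ?thesis
  proof (rule CcI)
    have "continuous_on UNIV (\<lambda>x :: 'g \<times> 'h. \<phi> (fst x))" "continuous_on UNIV (\<lambda>x :: 'g \<times> 'h. \<psi> (snd x))"
      using continuous_on_compose2[OF Cc_continuous[OF assms(1)] continuous_on_fst[OF continuous_on_id]]
        continuous_on_compose2[OF Cc_continuous[OF assms(2)] continuous_on_snd[OF continuous_on_id]] by auto
    then show "continuous_on UNIV (\<lambda>x. \<phi> (fst x) * \<psi> (snd x))" by (rule continuous_on_mult)
    show "compact (S \<times> R)" using S(1) R(1) by (rule compact_Times)
    show "\<phi> (fst x) * \<psi> (snd x) = 0" if "x \<notin> S \<times> R" for x
      using that S(2)[of "fst x"] R(2)[of "snd x"] by (cases x) auto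
  qed
qed

text \<open>
  The map \<open>h\<close> embeds the first group as a subgroup of the second, with a continuous left inverse \<open>p\<close>.
  Restriction to the subgroup does not increase the norm, and \<open>p\<close> maps a compact set that carries \<open>\<phi>\<close>
  onto one that carries the restriction.
\<close>

lemma unit_limit_section:
  fixes h :: "'g::{topological_group_add, t2_space} \<Rightarrow> 'k::{topological_group_add, t2_space}" and p :: "'k \<Rightarrow> 'g"
  assumes unif: "unit_locally_uniform_limit (Cc_multipliers d C :: ('k \<Rightarrow> complex) set)"
    and h: "h 0 = 0" "\<And>s t. h (s + t) = h s + h t" "continuous_on UNIV h"
    and p: "continuous_on UNIV p" "\<And>s. p (h s) = s"
  shows "unit_locally_uniform_limit (Cc_multipliers d C :: ('g \<Rightarrow> complex) set)"
  unfolding unit_locally_uniform_limit_def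
proof (intro allI impI)
  fix K :: "'g set" and e :: real assume "e > 0" and K: "compact K"
  have "compact (h ` K)" using K h(3) by (auto intro: compact_continuous_image continuous_on_subset)
  then obtain \<phi> where \<phi>: "\<phi> \<in> Cc" "\<phi> \<in> Md d" "Md_norm d \<phi> \<le> C" "\<forall>t\<in>h ` K. cmod (\<phi> t - 1) < e"
    using unif \<open>e > 0\<close> unfolding unit_locally_uniform_limit_def by blast
  obtain S where S: "compact S" "\<And>t. t \<notin> S \<Longrightarrow> \<phi> t = 0" using CcE[OF \<phi>(1)] by blast
  have "(\<lambda>s. \<phi> (h s)) \<in> Cc"
  proof (rule CcI)
    show "continuous_on UNIV (\<lambda>s. \<phi> (h s))"
      by (rule continuous_on_compose2[OF Cc_continuous[OF \<phi>(1)] h(3)]) simp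
    show "compact (p ` S)" using S(1) p(1) by (auto intro: compact_continuous_image continuous_on_subset)
    show "\<phi> (h s) = 0" if "s \<notin> p ` S" for s
      using S(2)[of "h s"] that p(2)[of s] by (metis imageI)
  qed
  then show "\<exists>\<phi>\<in>Cc_multipliers d C. \<forall>t\<in>K. cmod (\<phi> t - 1) < e"
    using Md_comp_hom[OF \<phi>(2,3) h] \<phi>(4) by (intro bexI[of _ "\<lambda>s. \<phi> (h s)"]) auto
qed

lemma unit_limit_product:
  assumes G: "unit_locally_uniform_limit (Cc_multipliers d C :: ('g::{topological_group_add, t2_space} \<Rightarrow> complex) set)"
    and H: "unit_locally_uniform_limit (Cc_multipliers d D :: ('h::{topological_group_add, t2_space} \<Rightarrow> complex) set)"
    and d: "1 \<le> d" and D: "0 \<le> D"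
  shows "unit_locally_uniform_limit (Cc_multipliers d (C * D) :: ('g \<times> 'h \<Rightarrow> complex) set)"
  unfolding unit_locally_uniform_limit_def
proof (intro allI impI)
  fix K :: "('g \<times> 'h) set" and e :: real assume e: "e > 0" and K: "compact K"
  have K12: "compact (fst ` K)" "compact (snd ` K)"
    using K by (auto intro!: compact_continuous_image continuous_intros)
  define r where "r = e / (2 * (D + 1))"
  have r: "r > 0" using e D by (simp add: r_def)
  obtain \<phi> where \<phi>: "\<phi> \<in> Cc" "\<phi> \<in> Md d" "Md_norm d \<phi> \<le> C" "\<forall>t\<in>fst ` K. cmod (\<phi> t - 1) < r"
    using G K12(1) r unfolding unit_locally_uniform_limit_def by blast
  have "e / 2 > 0" using e by simp
  then obtain \<psi> where \<psi>: "\<psi> \<in> Cc" "\<psi> \<in> Md d" "Md_norm d \<psi> \<le> D" "\<forall>t\<in>snd ` K. cmod (\<psi> t - 1) < e / 2"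
    using H K12(2) unfolding unit_locally_uniform_limit_def by blast
  have Cc: "(\<lambda>x. \<phi> (fst x) * \<psi> (snd x)) \<in> Cc" by (rule Cc_tensor[OF \<phi>(1) \<psi>(1)])
  note Md = Md_tensor[OF \<phi>(2,3) \<psi>(2,3) d D Cc_imp_Cb[OF Cc]]
  have "cmod (\<phi> (fst x) * \<psi> (snd x) - 1) < e" if x: "x \<in> K" for x
  proof -
    have "\<phi> (fst x) * \<psi> (snd x) - 1 = (\<phi> (fst x) - 1) * \<psi> (snd x) + (\<psi> (snd x) - 1)" by (simp add: algebra_simps)
    then have "cmod (\<phi> (fst x) * \<psi> (snd x) - 1) \<le> cmod (\<phi> (fst x) - 1) * cmod (\<psi> (snd x)) + cmod (\<psi> (snd x) - 1)"
      by (simp only: norm_mult[symmetric] norm_triangle_ineq)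
    also have "\<dots> < r * (D + 1) + e / 2"
    proof (rule add_le_less_mono)
      have "cmod (\<psi> (snd x)) \<le> D + 1" using cmod_le_Md_norm[OF \<psi>(2) d, of "snd x"] \<psi>(3) by simp
      then show "cmod (\<phi> (fst x) - 1) * cmod (\<psi> (snd x)) \<le> r * (D + 1)"
        using \<phi>(4) x r by (intro mult_mono) auto
      show "cmod (\<psi> (snd x) - 1) < e / 2" using \<psi>(4) x by blast
    qed
    also have "\<dots> = e" using D by (simp add: r_def field_simps)
    finally show ?thesis .
  qed
  then show "\<exists>\<phi>\<in>Cc_multipliers d (C * D). \<forall>t\<in>K. cmod (\<phi> t - 1) < e"
    using Cc Md by (intro bexI[of _ "\<lambda>x. \<phi> (fst x) * \<psi> (snd x)"]) auto
qed

lemma ereal_le_mult_Inf: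
  assumes "0 < c" "\<And>b. b \<in> B \<Longrightarrow> x \<le> ereal (c * b)"
  shows "x \<le> ereal c * Inf (ereal ` B)"
proof -
  have "x \<le> Inf {ereal c * y | y. y \<in> ereal ` B}" using assms(2) by (intro Inf_greatest) auto
  also have "\<dots> = ereal c * Inf {y. y \<in> ereal ` B}" by (rule ereal_Inf_cmult[OF assms(1)])
  finally show ?thesis by simp
qed

lemma ereal_Inf_mult_le:
  assumes "B \<noteq> {}" and A: "\<And>a. a \<in> A \<Longrightarrow> 1 \<le> a" and B: "\<And>b. b \<in> B \<Longrightarrow> 1 \<le> b"
    and x: "\<And>a b. a \<in> A \<Longrightarrow> b \<in> B \<Longrightarrow> x \<le> ereal (a * b)"
  shows "x \<le> Inf (ereal ` A) * Inf (ereal ` B)"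
proof -
  have "Inf (ereal ` B) = ereal (Inf B)"
    using ereal_Inf'[OF bdd_belowI[OF B] assms(1)] by simp
  moreover have "1 \<le> Inf B" using assms(1) B by (rule cInf_greatest)
  moreover have "x \<le> ereal a * Inf (ereal ` B)" if "a \<in> A" for a
    using A[OF that] x[OF that] by (intro ereal_le_mult_Inf) auto
  ultimately have "x \<le> ereal (Inf B) * Inf (ereal ` A)"
    by (intro ereal_le_mult_Inf) (auto simp: mult.commute)
  then show ?thesis using \<open>Inf (ereal ` B) = ereal (Inf B)\<close> by (simp add: mult.commute)
qed

theorem lemma4p4:
  fixes \<mu> :: "'g::{topological_group_add, t2_space} measure"
    and \<nu> :: "'h::{topological_group_add, t2_space} measure"
    and \<omega> :: "('g \<times> 'h) measure"
    and d :: nat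
  assumes "locally_compact_space (euclidean :: 'g topology)"
    and "locally_compact_space (euclidean :: 'h topology)"
    and "left_haar_measure \<mu>"
    and "left_haar_measure \<nu>"
    and "left_haar_measure \<omega>"
    and "d \<ge> 2"
  shows "(Md_weakly_amenable \<omega> d \<longleftrightarrow> Md_weakly_amenable \<mu> d \<and> Md_weakly_amenable \<nu> d) \<and>
    (Md_weakly_amenable \<omega> d \<longrightarrow> Md_constant \<omega> d \<le> Md_constant \<mu> d * Md_constant \<nu> d)"
proof -
  interpret G: haar_measure \<mu> by unfold_locales fact
  interpret H: haar_measure \<nu> by unfold_locales fact
  interpret GH: haar_measure \<omega> by unfold_locales fact
  have d: "1 \<le> d" using assms(6) by simp
  note crit = G.weakly_amenable_iff_unit_locally_uniform_limit[OF d]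
    H.weakly_amenable_iff_unit_locally_uniform_limit[OF d] GH.weakly_amenable_iff_unit_locally_uniform_limit[OF d]
  have down: "Md_weakly_amenable_with \<mu> d C" "Md_weakly_amenable_with \<nu> d C"
    if "Md_weakly_amenable_with \<omega> d C" "1 \<le> C" for C
  proof -
    have unif: "unit_locally_uniform_limit (Cc_multipliers d C :: ('g \<times> 'h \<Rightarrow> complex) set)"
      using that crit by simp
    show "Md_weakly_amenable_with \<mu> d C"
      unfolding crit(1)[OF that(2)]
      by (rule unit_limit_section[OF unif, of "\<lambda>s. (s, 0)" fst]) (auto simp: zero_prod_def intro!: continuous_intros)
    show "Md_weakly_amenable_with \<nu> d C"
      unfolding crit(2)[OF that(2)]
      by (rule unit_limit_section[OF unif, of "\<lambda>t. (0, t)" snd]) (auto simp: zero_prod_def intro!: continuous_intros)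
  qed
  have up: "Md_weakly_amenable_with \<omega> d (C * D)"
    if "Md_weakly_amenable_with \<mu> d C" "1 \<le> C" "Md_weakly_amenable_with \<nu> d D" "1 \<le> D" for C D
  proof -
    have "1 \<le> C * D" using mult_mono[of 1 C 1 D] that by simp
    then show ?thesis
      using unit_limit_product[of d C D] that d crit by simp
  qed
  have iff: "Md_weakly_amenable \<omega> d \<longleftrightarrow> Md_weakly_amenable \<mu> d \<and> Md_weakly_amenable \<nu> d"
  proof
    assume "Md_weakly_amenable \<omega> d"
    then show "Md_weakly_amenable \<mu> d \<and> Md_weakly_amenable \<nu> d"
      using down unfolding Md_weakly_amenable_def by blast
  next
    assume "Md_weakly_amenable \<mu> d \<and> Md_weakly_amenable \<nu> d"
    then obtain C D where CD: "Md_weakly_amenable_with \<mu> d C" "1 \<le> C" "Md_weakly_amenable_with \<nu> d D" "1 \<le> D"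
      unfolding Md_weakly_amenable_def by blast
    have "1 \<le> C * D" using mult_mono[of 1 C 1 D] CD by simp
    then show "Md_weakly_amenable \<omega> d" using up[OF CD] unfolding Md_weakly_amenable_def by blast
  qed
  have "Md_constant \<omega> d \<le> Md_constant \<mu> d * Md_constant \<nu> d" if "Md_weakly_amenable \<omega> d"
  proof -
    let ?A = "{C. 1 \<le> C \<and> Md_weakly_amenable_with \<mu> d C}" and ?B = "{C. 1 \<le> C \<and> Md_weakly_amenable_with \<nu> d C}"
    have const: "Md_constant \<mu> d = Inf (ereal ` ?A)" "Md_constant \<nu> d = Inf (ereal ` ?B)"
      unfolding Md_constant_def by (auto intro!: arg_cong[where f = Inf])
    show ?thesis
      unfolding const
    proof (rule ereal_Inf_mult_le)
      show "?B \<noteq> {}" using that iff unfolding Md_weakly_amenable_def by blast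
      fix C D assume CD: "C \<in> ?A" "D \<in> ?B"
      then have "1 \<le> C * D" using mult_mono[of 1 C 1 D] by simp
      then show "Md_constant \<omega> d \<le> ereal (C * D)"
        unfolding Md_constant_def using CD up by (intro Inf_lower) blast
    qed auto
  qed
  then show ?thesis using iff by blast
qed

end
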